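(* Let $G=(V,E)$ be a Cayley graph of a finitely generated amenable group and let $\#\in\{A,D,N\}$. Assume there is a continuous strictly decreasing function $f:[1,\infty)\to\mathbb{R}^+$ with $\lim_{s\to\infty}f(s)=0$ such that $\lambda^{\#}(G')\ge f(|G'|)$ for every finite subgraph $G'$ of $G$. Consider independent site or independent bond percolation on $G$ with parameter $p$, and let $p_c$ be the corresponding critical parameter. Then for every $0<p<p_c$ there is a constant $a_p>0$ such that for all $E>0$ small enough $$N^{\#}(E)-N^{\#}(0)\le e^{-a_p f^{-1}(E)},$$ where $f^{-1}$ is the inverse function of $f$.
   Context: $G$ is the Cayley graph with respect to a finite symmetric generating set $S$ not containing the identity $\iota$; $k=|S|$. For a subgraph $G'=(V',E')$, $|G'|$ is its number of vertices, $d_{G'}(x)$ its vertex degrees, and on $\ell^2(V')$: $(D(G')\varphi)(x)=d_{G'}(x)\varphi(x)$, $(A(G')\varphi)(x)=\sum_{y\in V',y\sim_{G'}x}\varphi(y)$, $\Delta^A(G')=k\,\mathrm{Id}-A(G')$, $\Delta^D(G')=2k\,\mathrm{Id}-D(G')-A(G')$, $\Delta^N(G')=D(G')-A(G')$. For finite $G'$, $\lambda^{\#}(G')$ denotes the lowest non-zero eigenvalue of $\Delta^{\#}(G')$. Site percolation: vertices open independently with probability $p$, $G(\omega)$ the induced subgraph on open vertices; bond percolation: edges open independently with probability $p$, $G(\omega)$ consisting of open edges and their endpoints. $p_c$: for $p<p_c$ almost surely no infinite cluster, for $p>p_c$ almost surely an infinite cluster. $\Delta^{\#}_\omega=\Delta^{\#}(G(\omega))$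 on $\ell^2(V(\omega))$ and $N^{\#}(E)=\mathbb{E}\{\langle\chi_{(-\infty,E]}(\Delta^{\#}_\omega)\delta_\iota,\delta_\iota\rangle\}$, with the inner product taken as $0$ if $\iota\notin V(\omega)$. *)

theory Defs
  imports "HOL-Probability.Probability"
begin

datatype lap_kind = LapA | LapD | LapN
datatype perc_kind = Site | Bond

definition cayley_adj :: "'g::group_add set \<Rightarrow> 'g \<Rightarrow> 'g \<Rightarrow> bool" where
  "cayley_adj S x y \<longleftrightarrow> (\<exists>s\<in>S. y = x + s)"

definition gen_set :: "'g::group_add set \<Rightarrow> bool" where
  "gen_set S \<longleftrightarrow> finite S \<and> (\<forall>s\<in>S. - s \<in> S) \<and> 0 \<notin> S \<and>
     (\<forall>g. \<exists>xs. set xs \<subseteq> S \<and> g = sum_list xs)"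

definition amenable_group :: "'g::group_add itself \<Rightarrow> bool" where
  "amenable_group _ \<longleftrightarrow> (\<exists>m :: 'g set \<Rightarrow> real.
     (\<forall>A. m A \<ge> 0) \<and> m UNIV = 1 \<and>
     (\<forall>A B. A \<inter> B = {} \<longrightarrow> m (A \<union> B) = m A + m B) \<and>
     (\<forall>g A. m ((\<lambda>x. g + x) ` A) = m A))"

text \<open>Graphs are pairs (V, Adj); functions in l2(V) are functions vanishing outside V.\<close>
definition nbrs :: "'g set \<Rightarrow> ('g \<Rightarrow> 'g \<Rightarrow> bool) \<Rightarrow> 'g \<Rightarrow> 'g set" where
  "nbrs V Adj x = {y \<in> V. Adj x y}"

definition deg :: "'g set \<Rightarrow> ('g \<Rightarrow> 'g \<Rightarrow> bool) \<Rightarrow> 'g \<Rightarrow> nat" where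
  "deg V Adj x = card (nbrs V Adj x)"

definition adj_op :: "'g set \<Rightarrow> ('g \<Rightarrow> 'g \<Rightarrow> bool) \<Rightarrow> ('g \<Rightarrow> real) \<Rightarrow> 'g \<Rightarrow> real" where
  "adj_op V Adj \<phi> x = (if x \<in> V then (\<Sum>y\<in>nbrs V Adj x. \<phi> y) else 0)"

text \<open>The three Laplacians Delta^A, Delta^D, Delta^N (k = |S|).\<close>
definition lap :: "lap_kind \<Rightarrow> nat \<Rightarrow> 'g set \<Rightarrow> ('g \<Rightarrow> 'g \<Rightarrow> bool) \<Rightarrow> ('g \<Rightarrow> real) \<Rightarrow> 'g \<Rightarrow> real" where
  "lap t k V Adj \<phi> x = (if x \<in> V then (case t of
      LapA \<Rightarrow> real k * \<phi> x - adj_op V Adj \<phi> x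
    | LapD \<Rightarrow> 2 * real k * \<phi> x - real (deg V Adj x) * \<phi> x - adj_op V Adj \<phi> x
    | LapN \<Rightarrow> real (deg V Adj x) * \<phi> x - adj_op V Adj \<phi> x) else 0)"

definition is_eigenvalue :: "lap_kind \<Rightarrow> nat \<Rightarrow> 'g set \<Rightarrow> ('g \<Rightarrow> 'g \<Rightarrow> bool) \<Rightarrow> real \<Rightarrow> bool" where
  "is_eigenvalue t k V Adj \<mu> \<longleftrightarrow> (\<exists>\<phi>. (\<forall>x. x \<notin> V \<longrightarrow> \<phi> x = 0) \<and> \<phi> \<noteq> (\<lambda>_. 0) \<and>
      lap t k V Adj \<phi> = (\<lambda>x. \<mu> * \<phi> x))"

definition nonzero_eigenvalues :: "lap_kind \<Rightarrow> nat \<Rightarrow> 'g set \<Rightarrow> ('g \<Rightarrow> 'g \<Rightarrow> bool) \<Rightarrow> real set" where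
  "nonzero_eigenvalues t k V Adj = {\<mu>. is_eigenvalue t k V Adj \<mu> \<and> \<mu> \<noteq> 0}"

definition lowest_nonzero_eigenvalue :: "lap_kind \<Rightarrow> nat \<Rightarrow> 'g set \<Rightarrow> ('g \<Rightarrow> 'g \<Rightarrow> bool) \<Rightarrow> real" where
  "lowest_nonzero_eigenvalue t k V Adj = Min (nonzero_eigenvalues t k V Adj)"

definition finite_subgraph :: "'g::group_add set \<Rightarrow> 'g set \<Rightarrow> ('g \<Rightarrow> 'g \<Rightarrow> bool) \<Rightarrow> bool" where
  "finite_subgraph S V Adj \<longleftrightarrow> finite V \<and>
     (\<forall>x y. Adj x y \<longrightarrow> x \<in> V \<and> y \<in> V \<and> cayley_adj S x y) \<and>
     (\<forall>x y. Adj x y \<longrightarrow> Adj y x)"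

text \<open>Percolation. Configurations are indexed by sets of vertices: singletons {x}
  (site percolation) or edges {x,y} (bond percolation). True = open.\<close>
definition perc_index :: "'g::group_add set \<Rightarrow> perc_kind \<Rightarrow> 'g set set" where
  "perc_index S t = (case t of
      Site \<Rightarrow> {{x} | x. True}
    | Bond \<Rightarrow> {{x, y} | x y. cayley_adj S x y})"

definition perc_measure :: "'g::group_add set \<Rightarrow> perc_kind \<Rightarrow> real \<Rightarrow> ('g set \<Rightarrow> bool) measure" where
  "perc_measure S t p = PiM (perc_index S t) (\<lambda>_. measure_pmf (bernoulli_pmf p))"

definition perc_adj :: "'g::group_add set \<Rightarrow> perc_kind \<Rightarrow> ('g set \<Rightarrow> bool) \<Rightarrow> 'g \<Rightarrow> 'g \<Rightarrow> bool" where
  "perc_adj S t \<omega> x y = (case t of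
      Site \<Rightarrow> cayley_adj S x y \<and> \<omega> {x} \<and> \<omega> {y}
    | Bond \<Rightarrow> cayley_adj S x y \<and> \<omega> {x, y})"

definition perc_verts :: "'g::group_add set \<Rightarrow> perc_kind \<Rightarrow> ('g set \<Rightarrow> bool) \<Rightarrow> 'g set" where
  "perc_verts S t \<omega> = (case t of
      Site \<Rightarrow> {x. \<omega> {x}}
    | Bond \<Rightarrow> {x. \<exists>y. perc_adj S Bond \<omega> x y})"

definition cluster :: "('g \<Rightarrow> 'g \<Rightarrow> bool) \<Rightarrow> 'g \<Rightarrow> 'g set" where
  "cluster Adj x = {y. (x, y) \<in> {(a, b). Adj a b}\<^sup>*}"

definition has_infinite_cluster :: "'g set \<Rightarrow> ('g \<Rightarrow> 'g \<Rightarrow> bool) \<Rightarrow> bool" where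
  "has_infinite_cluster V Adj \<longleftrightarrow> (\<exists>x\<in>V. infinite (cluster Adj x))"

definition p_crit :: "'g::group_add set \<Rightarrow> perc_kind \<Rightarrow> real" where
  "p_crit S t = Sup {p \<in> {0..1}. AE \<omega> in perc_measure S t p.
       \<not> has_infinite_cluster (perc_verts S t \<omega>) (perc_adj S t \<omega>)}"

text \<open>Spectral measure of delta_o for the (bounded, self-adjoint) operator lap on l2(V):
  the unique compactly supported finite Borel measure whose moments are
  the matrix elements of the powers of the operator.\<close>
definition moment :: "lap_kind \<Rightarrow> nat \<Rightarrow> 'g set \<Rightarrow> ('g \<Rightarrow> 'g \<Rightarrow> bool) \<Rightarrow> 'g \<Rightarrow> nat \<Rightarrow> real" where
  "moment t k V Adj v0 n = ((lap t k V Adj ^^ n) (\<lambda>x. if x = v0 then 1 else 0)) v0"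

definition spectral_measure :: "lap_kind \<Rightarrow> nat \<Rightarrow> 'g set \<Rightarrow> ('g \<Rightarrow> 'g \<Rightarrow> bool) \<Rightarrow> 'g \<Rightarrow> real measure" where
  "spectral_measure t k V Adj v0 = (THE \<mu>. sets \<mu> = sets borel \<and> finite_measure \<mu> \<and>
      (\<exists>R. emeasure \<mu> (- {-R..R}) = 0) \<and>
      (\<forall>n. integrable \<mu> (\<lambda>x. x ^ n) \<and> (\<integral>x. x ^ n \<partial>\<mu>) = moment t k V Adj v0 n))"

text \<open>Integrated density of states N(E) = E < chi_(-inf,E](Delta_omega) delta_iota, delta_iota >.\<close>
definition IDS :: "'g::group_add set \<Rightarrow> perc_kind \<Rightarrow> lap_kind \<Rightarrow> real \<Rightarrow> real \<Rightarrow> real" where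
  "IDS S t lt p E = (\<integral>\<omega>. (if (0::'g) \<in> perc_verts S t \<omega>
       then measure (spectral_measure lt (card S) (perc_verts S t \<omega>) (perc_adj S t \<omega>) 0) {..E}
       else 0) \<partial>perc_measure S t p)"

end

theory Submission
  imports Defs "HOL-Computational_Algebra.Fundamental_Theorem_Algebra"
begin

text \<open>
  If the cluster \<open>C\<close> of the origin is finite, its spectral measure is carried by the eigenvalues of
  the Laplacian of \<open>C\<close>. Hence it can only charge \<open>(0, E]\<close> if \<open>f |C| \<le> E\<close>, i.e. if \<open>|C| \<ge> f\<^sup>-\<^sup>1 E\<close>, and
  the theorem reduces to an exponential moment of \<open>|C|\<close> below the critical parameter.

  That moment comes from the argument of Duminil-Copin and Tassion. Let \<open>\<phi> B\<close> be the expected number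
  of sites outside a finite set \<open>B\<close> that are adjacent to the cluster of the origin inside \<open>B\<close>.
  If \<open>\<phi> B \<ge> 1\<close> for all \<open>B\<close>, then Russo's formula shows that the probability \<open>\<theta> q\<close> of reaching the
  boundary of a box satisfies \<open>\<theta>' \<ge> 1 - \<theta>\<close>, which forces an infinite cluster at every larger parameter.
  So \<open>\<phi> B < 1\<close> for some \<open>B\<close>, and exploring a cluster by translates of \<open>B\<close> dominates it by a
  subcritical branching process with bounded offspring.

  Bond percolation is treated as site percolation on the line graph.
\<close>

section \<open>Symmetric operators on finite sets\<close>

text \<open>\<open>spectral_measure\<close> is defined by \<open>THE\<close>, so its value is
  meaningful only once a measure with the prescribed moments exists, and the integral in
  \<open>IDS\<close> says something only if its integrand is measurable. Existence is therefore
  proved for every configuration, with finite or infinite cluster. Measurability comes from writing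
  a distribution function as a limit of linear combinations of moments whose coefficients do not
  depend on the measure.

  The block with expectation below 1 is found at p from the absence of infinite clusters at some
  larger q: integrating the differential inequality over [p, q] would otherwise bound the
  probability of reaching the boundary of a box below by 1 - exp (p - q), uniformly in the box. The
  estimates live on finite sets, as sums \<open>bern_exp\<close>; the product measure enters through
  cylinder functions and their limits.

  The rate is \<open>h / 4\<close>. The exponential moment counts open elements with rate h; an
  element has at most two vertices, which leaves h/2 per vertex; half of that absorbs the prefactor
  \<open>m ^ card roots\<close> once E is small.\<close>

lemma nontrivial_dependence:
  fixes u :: "'i \<Rightarrow> 'a \<Rightarrow> real"
  assumes "finite W" "finite I" "card W < card I"
  shows "\<exists>c. (\<exists>i\<in>I. c i \<noteq> 0) \<and> (\<forall>x\<in>W. (\<Sum>i\<in>I. c i * u i x) = 0)"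
  using assms
proof (induction W arbitrary: I u rule: finite_induct)
  case empty
  then have "I \<noteq> {}" by auto
  then show ?case by (intro exI[of _ "\<lambda>_. 1"]) auto
next
  case (insert x W)
  show ?case
  proof (cases "\<forall>i\<in>I. u i x = 0")
    case True
    obtain c where "\<exists>i\<in>I. c i \<noteq> 0" "\<forall>y\<in>W. (\<Sum>i\<in>I. c i * u i y) = 0"
      using insert.IH[of I u] insert by force
    with True show ?thesis by (intro exI[of _ c]) auto
  next
    case False
    then obtain j where j: "j \<in> I" "u j x \<noteq> 0" by auto
    \<comment> \<open>Gaussian elimination with pivot \<open>u j x\<close>: the modified vectors
      vanish at \<open>x\<close>, so the induction hypothesis on \<open>W\<close> suffices, and the
      coefficient of \<open>u j\<close> is recovered as \<open>- d\<close>.\<close>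
    have "card W < card (I - {j})" using insert j by auto
    then obtain c where c: "\<exists>i\<in>I-{j}. c i \<noteq> 0"
        "\<forall>y\<in>W. (\<Sum>i\<in>I-{j}. c i * (u i y - u i x / u j x * u j y)) = 0"
      using insert.IH[of "I - {j}" "\<lambda>i y. u i y - u i x / u j x * u j y"] insert.prems by auto
    define d where "d = (\<Sum>i\<in>I-{j}. c i * (u i x / u j x))"
    define c' where "c' = c(j := - d)"
    have s: "(\<Sum>i\<in>I. c' i * u i y) = (\<Sum>i\<in>I-{j}. c i * (u i y - u i x / u j x * u j y))" for y
    proof -
      have "(\<Sum>i\<in>I. c' i * u i y) = c' j * u j y + (\<Sum>i\<in>I-{j}. c' i * u i y)"
        using insert.prems j by (intro sum.remove) auto
      also have "(\<Sum>i\<in>I-{j}. c' i * u i y) = (\<Sum>i\<in>I-{j}. c i * u i y)"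
        by (intro sum.cong) (auto simp: c'_def)
      also have "c' j * u j y = - (\<Sum>i\<in>I-{j}. c i * (u i x / u j x * u j y))"
        by (simp add: c'_def d_def sum_distrib_right mult.assoc)
      finally show ?thesis by (simp add: sum_subtractf right_diff_distrib)
    qed
    have "\<forall>y\<in>insert x W. (\<Sum>i\<in>I. c' i * u i y) = 0"
      using c(2) j(2) by (simp add: s)
    moreover have "\<exists>i\<in>I. c' i \<noteq> 0" using c(1) by (auto simp: c'_def)
    ultimately show ?thesis by blast
  qed
qed

text \<open>Functions on \<open>W\<close> are modelled by functions on the whole type.
  \<open>T_supp\<close> constrains only the image of \<open>T\<close>, so support of the argument is
  assumed separately where norms on \<open>W\<close> must determine a function.\<close>

locale finite_symmetric_operator =
  fixes W :: "'a set" and T :: "('a \<Rightarrow> real) \<Rightarrow> 'a \<Rightarrow> real"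
  assumes finite_W: "finite W"
    and T_add: "T (\<lambda>x. u x + v x) = (\<lambda>x. T u x + T v x)"
    and T_scale: "T (\<lambda>x. c * u x) = (\<lambda>x. c * T u x)"
    and T_supp: "x \<notin> W \<Longrightarrow> T u x = 0"
    and T_sym: "(\<Sum>x\<in>W. T u x * v x) = (\<Sum>x\<in>W. u x * T v x)"
begin

lemma T_zero: "T (\<lambda>_. 0) = (\<lambda>_. 0)"
  using T_scale[of 0 "\<lambda>_. 0"] by simp

lemma T_diff: "T (\<lambda>x. u x - v x) = (\<lambda>x. T u x - T v x)"
  using T_add[of u "\<lambda>x. (-1) * v x"] T_scale[of "-1" v] by simp

lemma T_sum: "finite J \<Longrightarrow> T (\<lambda>x. \<Sum>j\<in>J. u j x) = (\<lambda>x. \<Sum>j\<in>J. T (u j) x)"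
  by (induction J rule: finite_induct) (simp_all add: T_zero T_add)

lemma Tn_supp: "(\<And>x. x \<notin> W \<Longrightarrow> u x = 0) \<Longrightarrow> x \<notin> W \<Longrightarrow> (T ^^ n) u x = 0"
  by (cases n) (auto simp: T_supp)

definition poly_op :: "real poly \<Rightarrow> ('a \<Rightarrow> real) \<Rightarrow> 'a \<Rightarrow> real" where
  "poly_op q u x = (\<Sum>i\<le>degree q. coeff q i * (T ^^ i) u x)"

lemma poly_op_bound: "degree q \<le> n \<Longrightarrow> poly_op q u x = (\<Sum>i\<le>n. coeff q i * (T ^^ i) u x)"
  unfolding poly_op_def by (intro sum.mono_neutral_left) (auto simp: coeff_eq_0)

lemma poly_op_0 [simp]: "poly_op 0 u = (\<lambda>_. 0)"
  by (simp add: poly_op_def fun_eq_iff)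

lemma poly_op_pCons: "poly_op (pCons c q) u = (\<lambda>x. c * u x + T (poly_op q u) x)"
proof
  fix x
  have "poly_op (pCons c q) u x = (\<Sum>i\<le>Suc (degree q). coeff (pCons c q) i * (T ^^ i) u x)"
    by (rule poly_op_bound) (simp add: degree_pCons_le)
  also have "\<dots> = c * u x + (\<Sum>i\<le>degree q. coeff q i * T ((T ^^ i) u) x)"
    by (simp add: sum.atMost_Suc_shift del: sum.atMost_Suc)
  also have "(\<Sum>i\<le>degree q. coeff q i * T ((T ^^ i) u) x) = T (poly_op q u) x"
    unfolding poly_op_def using T_sum[of "{..degree q}" "\<lambda>i x. coeff q i * (T ^^ i) u x"] by (simp add: T_scale)
  finally show "poly_op (pCons c q) u x = c * u x + T (poly_op q u) x" .
qed

lemma poly_op_supp: "(\<And>x. x \<notin> W \<Longrightarrow> u x = 0) \<Longrightarrow> x \<notin> W \<Longrightarrow> poly_op q u x = 0"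
  by (simp add: poly_op_def Tn_supp)

lemma poly_op_add: "poly_op (q + r) u = (\<lambda>x. poly_op q u x + poly_op r u x)"
proof
  fix x
  let ?n = "max (degree q) (degree r)"
  show "poly_op (q + r) u x = poly_op q u x + poly_op r u x"
    by (subst (1 2 3) poly_op_bound[of _ ?n]) (auto simp: degree_add_le sum.distrib distrib_right)
qed

lemma poly_op_smult: "poly_op (smult c q) u = (\<lambda>x. c * poly_op q u x)"
  by (rule ext, subst poly_op_bound[of _ "degree q"])
     (auto simp: poly_op_def sum_distrib_left mult.assoc degree_smult_le)

lemma poly_op_mult: "poly_op (q * r) u = poly_op q (poly_op r u)"
  by (induction q) (simp_all add: poly_op_add poly_op_smult poly_op_pCons)

lemma poly_op_scale: "poly_op q (\<lambda>x. c * u x) = (\<lambda>x. c * poly_op q u x)"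
  by (induction q) (simp_all add: poly_op_pCons T_scale algebra_simps)

lemma poly_op_diff: "poly_op q (\<lambda>x. u x - v x) = (\<lambda>x. poly_op q u x - poly_op q v x)"
  by (induction q) (simp_all add: poly_op_pCons T_diff algebra_simps)

lemma poly_op_eigen: "T w = (\<lambda>x. a * w x) \<Longrightarrow> poly_op q w = (\<lambda>x. poly q a * w x)"
proof (induction q)
  case (pCons c q)
  then show ?case by (simp only: poly_op_pCons T_scale) (simp add: algebra_simps)
qed simp

lemma norm_zero_imp:
  fixes u :: "'a \<Rightarrow> real"
  assumes "(\<Sum>x\<in>W. (u x)\<^sup>2) = 0" "\<And>x. x \<notin> W \<Longrightarrow> u x = 0"
  shows "u = (\<lambda>_. 0)"
proof
  fix x
  show "u x = 0"
    using assms finite_W sum_nonneg_eq_0_iff[of W "\<lambda>x. (u x)\<^sup>2"] by (cases "x \<in> W") auto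
qed

text \<open>The polynomial is (X - a)^2 + b^2, and symmetry moves one factor T - a to the other
  side. Positivity of both summands then excludes non-real roots (b nonzero) and makes repeated real
  roots redundant (b = 0), which is all that diagonalisation needs.\<close>

lemma square_identity:
  "(\<Sum>x\<in>W. u x * poly_op [:a\<^sup>2 + b\<^sup>2, - 2 * a, 1:] u x)
     = (\<Sum>x\<in>W. (T u x - a * u x)\<^sup>2) + b\<^sup>2 * (\<Sum>x\<in>W. (u x)\<^sup>2)"
proof -
  let ?D = "\<lambda>x. T u x - a * u x"
  have D: "T ?D = (\<lambda>x. T (T u) x - a * T u x)"
    by (simp add: T_diff T_scale)
  have "poly_op [:a\<^sup>2 + b\<^sup>2, - 2 * a, 1:] u = (\<lambda>x. (T ?D x - a * ?D x) + b\<^sup>2 * u x)"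
    by (simp only: poly_op_pCons poly_op_0 T_zero add_0_right mult_1 T_add T_scale D)
       (simp add: fun_eq_iff power2_eq_square algebra_simps)
  then have "(\<Sum>x\<in>W. u x * poly_op [:a\<^sup>2 + b\<^sup>2, - 2 * a, 1:] u x)
      = (\<Sum>x\<in>W. u x * T ?D x) - (\<Sum>x\<in>W. a * u x * ?D x) + b\<^sup>2 * (\<Sum>x\<in>W. (u x)\<^sup>2)"
    by (simp add: sum.distrib[symmetric] sum_subtractf[symmetric] sum_distrib_left
        power2_eq_square algebra_simps)
  also have "(\<Sum>x\<in>W. u x * T ?D x) = (\<Sum>x\<in>W. T u x * ?D x)"
    by (simp add: T_sym)
  also have "(\<Sum>x\<in>W. T u x * ?D x) - (\<Sum>x\<in>W. a * u x * ?D x) = (\<Sum>x\<in>W. (?D x)\<^sup>2)"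
    by (simp add: sum_subtractf[symmetric] power2_eq_square algebra_simps)
  finally show ?thesis .
qed

lemma poly_op_complex_root:
  assumes "b \<noteq> 0" "\<And>x. x \<notin> W \<Longrightarrow> u x = 0" "poly_op [:a\<^sup>2 + b\<^sup>2, - 2 * a, 1:] u = (\<lambda>_. 0)"
  shows "u = (\<lambda>_. 0)"
proof (rule norm_zero_imp[OF _ assms(2)])
  have "(\<Sum>x\<in>W. (T u x - a * u x)\<^sup>2) + b\<^sup>2 * (\<Sum>x\<in>W. (u x)\<^sup>2) = 0"
    using square_identity[of u a b] assms(3) by simp
  moreover have "(\<Sum>x\<in>W. (T u x - a * u x)\<^sup>2) \<ge> 0" "b\<^sup>2 * (\<Sum>x\<in>W. (u x)\<^sup>2) \<ge> 0"
    by (simp_all add: sum_nonneg)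
  ultimately have "b\<^sup>2 * (\<Sum>x\<in>W. (u x)\<^sup>2) = 0" by linarith
  then show "(\<Sum>x\<in>W. (u x)\<^sup>2) = 0" using assms(1) by simp
qed auto

lemma poly_op_double_root:
  assumes supp: "\<And>x. x \<notin> W \<Longrightarrow> u x = 0" and z: "poly_op ([:-a, 1:] * [:-a, 1:]) u = (\<lambda>_. 0)"
  shows "poly_op [:-a, 1:] u = (\<lambda>_. 0)"
proof (rule norm_zero_imp)
  have "(\<Sum>x\<in>W. (T u x - a * u x)\<^sup>2) = 0"
    using square_identity[of u a 0] z by (simp add: power2_eq_square)
  then show "(\<Sum>x\<in>W. (poly_op [:- a, 1:] u x)\<^sup>2) = 0"
    by (simp add: poly_op_pCons T_zero)
qed (use supp poly_op_supp in auto)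

lemma poly_map_poly_of_real:
  "poly (map_poly complex_of_real q) (complex_of_real a) = complex_of_real (poly q a)"
  by (induction q) (simp_all add: map_poly_pCons)

text \<open>The divisor is (X - z)(X - cnj z). The remainder is linear with real coefficients and
  vanishes at the non-real point z, hence is zero.\<close>

lemma quadratic_factor:
  fixes q :: "real poly"
  assumes "poly (map_poly complex_of_real q) z = 0" "Im z \<noteq> 0"
  shows "[:(Re z)\<^sup>2 + (Im z)\<^sup>2, - 2 * Re z, 1:] dvd q"
proof -
  let ?d = "[:(Re z)\<^sup>2 + (Im z)\<^sup>2, - 2 * Re z, 1:]"
  let ?c = "map_poly complex_of_real"
  define r where "r = q mod ?d"
  have q: "q = q div ?d * ?d + r"
    unfolding r_def by (rule div_mult_mod_eq[symmetric])
  have hm: "?c (s * t) = ?c s * ?c t" "?c (s + t) = ?c s + ?c t" for s t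
    by (simp_all add: poly_eq_iff coeff_map_poly coeff_mult)
  have "z * z = complex_of_real (2 * Re z) * z - complex_of_real ((Re z)\<^sup>2 + (Im z)\<^sup>2)"
    by (simp add: complex_eq_iff power2_eq_square algebra_simps)
  then have d0: "poly (?c ?d) z = 0"
    by (simp add: map_poly_pCons algebra_simps)
  have "?c q = ?c (q div ?d) * ?c ?d + ?c r"
    using arg_cong[OF q, of ?c] by (simp only: hm)
  then have rz: "poly (?c r) z = 0"
    using assms(1) d0 by simp
  have "degree r < 2"
    using degree_mod_less'[of ?d q] by (cases "r = 0") (auto simp: r_def)
  then have r: "r = [:coeff r 0, coeff r 1:]"
    by (auto simp: poly_eq_iff coeff_pCons coeff_eq_0 split: nat.split)
  have "poly (?c [:coeff r 0, coeff r 1:]) z = 0" using rz r by simp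
  then have "complex_of_real (coeff r 0) + z * complex_of_real (coeff r 1) = 0"
    by (simp add: map_poly_pCons)
  then have "coeff r 1 = 0" "coeff r 0 = 0"
    using assms(2) by (auto simp: complex_eq_iff)
  with r have "r = 0" by simp
  then show ?thesis using q by (metis add.right_neutral dvd_triv_right)
qed

text \<open>Induction on the degree of an annihilating polynomial. A pair of conjugate roots or a
  repeated real root can be cancelled by positivity; a simple real root splits off one eigenvector.
  Eigenvectors are indexed by their eigenvalue, so distinct indices are automatically
  orthogonal.\<close>

lemma eigen_decomposition_poly:
  assumes "q \<noteq> 0" "\<And>x. x \<notin> W \<Longrightarrow> v x = 0" "poly_op q v = (\<lambda>_. 0)"
  shows "\<exists>J u. finite J \<and> (\<forall>a\<in>J. T (u a) = (\<lambda>x. a * u a x) \<and> (\<forall>x. x \<notin> W \<longrightarrow> u a x = 0)) \<and>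
            v = (\<lambda>x. \<Sum>a\<in>J. u a x)"
  using assms
proof (induction "degree q" arbitrary: q v rule: less_induct)
  case less
  let ?thm = "\<lambda>v. \<exists>J u. finite J \<and>
      (\<forall>a\<in>J. T (u a) = (\<lambda>x. a * u a x) \<and> (\<forall>x. x \<notin> W \<longrightarrow> u a x = 0)) \<and>
      v = (\<lambda>x. \<Sum>a\<in>J. u a x)"
  show "?thm v"
  proof (cases "degree q = 0")
    case True
    then obtain c where "q = [:c:]" "c \<noteq> 0" using less.prems(1) by (metis degree_eq_zeroE pCons_0_0)
    then have "v = (\<lambda>_. 0)" using less.prems(3) by (auto simp: poly_op_pCons T_zero fun_eq_iff)
    then show ?thesis by (intro exI[of _ "{}"]) auto
  next
    case False
    then have "\<not> constant (poly (map_poly complex_of_real q))"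
      by (simp add: constant_degree degree_map_poly)
    then obtain z where z: "poly (map_poly complex_of_real q) z = 0"
      using fundamental_theorem_of_algebra by blast
    show ?thesis
    proof (cases "Im z = 0")
      case False
      then obtain r where r: "q = [:(Re z)\<^sup>2 + (Im z)\<^sup>2, - 2 * Re z, 1:] * r"
        using quadratic_factor[OF z] by (auto simp: dvd_def)
      have "poly_op [:(Re z)\<^sup>2 + (Im z)\<^sup>2, - 2 * Re z, 1:] (poly_op r v) = (\<lambda>_. 0)"
        using less.prems(3) unfolding r poly_op_mult .
      then have "poly_op r v = (\<lambda>_. 0)"
        using poly_op_supp[of v _ r] less.prems(2) by (rule_tac poly_op_complex_root[OF False]) auto
      moreover have "r \<noteq> 0" using less.prems r by auto
      moreover from this have "degree q = 2 + degree r"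
        unfolding r by (subst degree_mult_eq) auto
      ultimately show ?thesis by (intro less.hyps[of r] less.prems(2)) simp_all
    next
      case True
      define a where "a = Re z"
      have za: "z = complex_of_real a" using True by (simp add: a_def complex_eq_iff)
      have "poly q a = 0"
        using z unfolding za poly_map_poly_of_real by simp
      then obtain r where r: "q = [:-a, 1:] * r" unfolding poly_eq_0_iff_dvd by (elim dvdE)
      have r0: "r \<noteq> 0" using less.prems r by auto
      then have dr: "degree q = 1 + degree r" unfolding r by (subst degree_mult_eq) auto
      define w where "w = poly_op r v"
      have wsupp: "\<And>x. x \<notin> W \<Longrightarrow> w x = 0" using less.prems(2) by (auto simp: w_def poly_op_supp)
      have "poly_op [:-a, 1:] w = (\<lambda>_. 0)" using less.prems(3) unfolding r w_def poly_op_mult .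
      then have ew: "T w = (\<lambda>x. a * w x)"
        by (auto simp: poly_op_pCons T_zero fun_eq_iff)
      show ?thesis
      proof (cases "poly r a = 0")
        case True
        then obtain s where s: "r = [:-a, 1:] * s" unfolding poly_eq_0_iff_dvd by (elim dvdE)
        have "poly_op ([:-a, 1:] * [:-a, 1:]) (poly_op s v) = (\<lambda>_. 0)"
          using less.prems(3) unfolding r s poly_op_mult .
        then have "poly_op [:-a, 1:] (poly_op s v) = (\<lambda>_. 0)"
          using poly_op_supp[of v _ s] less.prems(2) by (intro poly_op_double_root) auto
        then have "poly_op r v = (\<lambda>_. 0)" unfolding s poly_op_mult .
        then show ?thesis using r0 dr by (intro less.hyps[of r] less.prems(2)) simp_all
      next
        case False
        \<comment> \<open>Since \<open>T w = a w\<close>, applying r(T) to w multiplies it by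
          \<open>poly r a\<close>; this multiple of w is exactly what makes r(T) annihilate the
          rest.\<close>
        define v' where "v' = (\<lambda>x. v x - 1 / poly r a * w x)"
        have "poly_op r v' = (\<lambda>x. poly_op r v x - 1 / poly r a * poly_op r w x)"
          unfolding v'_def by (subst poly_op_diff, subst poly_op_scale) simp
        also have "\<dots> = (\<lambda>_. 0)"
          using False by (simp add: poly_op_eigen[OF ew] w_def[symmetric])
        finally have "poly_op r v' = (\<lambda>_. 0)" .
        moreover have "v' x = 0" if "x \<notin> W" for x
          using that less.prems(2) wsupp by (simp add: v'_def)
        ultimately have "?thm v'" using r0 dr by (intro less.hyps[of r]) simp_all
        then obtain J u where J: "finite J" "v' = (\<lambda>x. \<Sum>a\<in>J. u a x)"
          and u: "\<And>a. a \<in> J \<Longrightarrow> T (u a) = (\<lambda>x. a * u a x)" "\<And>a x. a \<in> J \<Longrightarrow> x \<notin> W \<Longrightarrow> u a x = 0"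
          by blast
        \<comment> \<open>The induction hypothesis does not exclude \<open>a \<in> J\<close>; in
          that case the new multiple of \<open>w\<close> is merged into the existing eigenvector for
          \<open>a\<close>.\<close>
        define u' where "u' = (\<lambda>b x. (if b \<in> J then u b x else 0) + (if b = a then 1 / poly r a * w x else 0))"
        have "v x = (\<Sum>b\<in>insert a J. u' b x)" for x
        proof -
          have "(\<Sum>b\<in>insert a J. u' b x) = (\<Sum>b\<in>insert a J. if b \<in> J then u b x else 0)
              + (\<Sum>b\<in>insert a J. if b = a then 1 / poly r a * w x else 0)"
            unfolding u'_def by (simp add: sum.distrib)
          also have "(\<Sum>b\<in>insert a J. if b \<in> J then u b x else 0) = (\<Sum>b\<in>J. u b x)"
            using J(1) by (intro sum.mono_neutral_cong_right) auto
          also have "(\<Sum>b\<in>insert a J. if b = a then 1 / poly r a * w x else 0) = 1 / poly r a * w x"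
            using J(1) by simp
          finally show ?thesis using fun_cong[OF J(2), of x] by (simp add: v'_def)
        qed
        moreover have "T (u' b) = (\<lambda>x. b * u' b x)" if "b \<in> insert a J" for b
        proof -
          let ?k = "1 / poly r a"
          have "T (\<lambda>x. u b x + ?k * w x) = (\<lambda>x. b * (u b x + ?k * w x))" if "b \<in> J" "b = a"
            using u(1)[OF that(1)] ew that(2) by (simp only: T_add T_scale) (simp add: algebra_simps)
          moreover have "T (\<lambda>x. ?k * w x) = (\<lambda>x. b * (?k * w x))" if "b = a"
            using ew that by (simp only: T_scale) (simp add: algebra_simps)
          ultimately show ?thesis
            using that u(1)[of b] by (cases "b \<in> J"; cases "b = a") (simp_all add: u'_def)
        qed
        moreover have "u' b x = 0" if "x \<notin> W" for b x
          using that u(2) wsupp by (auto simp: u'_def)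
        moreover have "finite (insert a J)" using J(1) by simp
        ultimately show ?thesis by (intro exI[of _ "insert a J"] exI[of _ u']) blast
      qed
    qed
  qed
qed

text \<open>The \<open>card W + 1\<close> vectors v, T v, ..., T^(card W) v have only
  \<open>card W\<close> coordinates, so a linear relation among them is an annihilating polynomial
  of v.\<close>

lemma eigen_decomposition:
  assumes supp: "\<And>x. x \<notin> W \<Longrightarrow> v x = 0"
  obtains J u where "finite J" "\<And>a. a \<in> J \<Longrightarrow> T (u a) = (\<lambda>x. a * u a x)"
    "\<And>a x. a \<in> J \<Longrightarrow> x \<notin> W \<Longrightarrow> u a x = 0" "v = (\<lambda>x. \<Sum>a\<in>J. u a x)"
proof -
  obtain c where c: "\<exists>i\<in>{..card W}. c i \<noteq> 0" "\<forall>x\<in>W. (\<Sum>i\<in>{..card W}. c i * (T ^^ i) v x) = 0"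
    using nontrivial_dependence[OF finite_W, of "{..card W}" "\<lambda>i. (T ^^ i) v"] by auto
  define q where "q = (\<Sum>i\<le>card W. monom (c i) i)"
  have cq: "coeff q i = (if i \<le> card W then c i else 0)" for i
    by (simp add: q_def coeff_sum)
  have "q \<noteq> 0" using c(1) cq by (metis atMost_iff coeff_0)
  moreover have "degree q \<le> card W" by (rule degree_le) (simp add: cq)
  then have "poly_op q v x = 0" for x
    using c(2) supp poly_op_supp[of v x q] by (cases "x \<in> W") (auto simp: poly_op_bound cq)
  then have "poly_op q v = (\<lambda>_. 0)" ..
  ultimately have "\<exists>J u. finite J \<and> (\<forall>a\<in>J. T (u a) = (\<lambda>x. a * u a x) \<and> (\<forall>x. x \<notin> W \<longrightarrow> u a x = 0)) \<and>
      v = (\<lambda>x. \<Sum>a\<in>J. u a x)"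
    by (intro eigen_decomposition_poly[of q] supp)
  then obtain J u where "finite J" "v = (\<lambda>x. \<Sum>a\<in>J. u a x)"
    "\<forall>a\<in>J. T (u a) = (\<lambda>x. a * u a x) \<and> (\<forall>x. x \<notin> W \<longrightarrow> u a x = 0)"
    by (elim exE conjE)
  then show ?thesis by (intro that[of J u]) blast+
qed

lemma eigenvectors_orthogonal:
  assumes "T u = (\<lambda>x. a * u x)" "T v = (\<lambda>x. b * v x)" "a \<noteq> b"
  shows "(\<Sum>x\<in>W. u x * v x) = 0"
proof -
  have "a * (\<Sum>x\<in>W. u x * v x) = b * (\<Sum>x\<in>W. u x * v x)"
    using T_sym[of u v] assms by (simp add: sum_distrib_left algebra_simps)
  then show ?thesis using assms(3) by simp
qed

text \<open>Decompose the unit vector at \<open>v0\<close> into eigenvectors \<open>u a\<close>. By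
  orthogonality \<open>u a v0\<close> is the inner product of \<open>u a\<close> with the unit
  vector, hence the squared norm of \<open>u a\<close>; these squared norms are the weights of the
  spectral measure.\<close>

lemma moment_representation:
  assumes "v0 \<in> W"
  obtains J w where "finite J" "\<And>a. a \<in> J \<Longrightarrow> 0 \<le> w a"
    "\<And>n. (T ^^ n) (\<lambda>x. if x = v0 then 1 else 0) v0 = (\<Sum>a\<in>J. w a * a ^ n)"
    "\<And>a. a \<in> J \<Longrightarrow> w a \<noteq> 0 \<Longrightarrow>
       \<exists>u. (\<forall>x. x \<notin> W \<longrightarrow> u x = 0) \<and> u \<noteq> (\<lambda>_. 0) \<and> T u = (\<lambda>x. a * u x)"
proof -
  let ?d = "\<lambda>x. if x = v0 then 1 else (0::real)"
  obtain J u where J: "finite J" and u: "\<And>a. a \<in> J \<Longrightarrow> T (u a) = (\<lambda>x. a * u a x)"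
    and us: "\<And>a x. a \<in> J \<Longrightarrow> x \<notin> W \<Longrightarrow> u a x = 0" and d: "?d = (\<lambda>x. \<Sum>a\<in>J. u a x)"
    using assms by (rule_tac eigen_decomposition[of ?d]) auto
  define w where "w a = (\<Sum>x\<in>W. (u a x)\<^sup>2)" for a
  have Tn: "(T ^^ n) ?d = (\<lambda>x. \<Sum>a\<in>J. a ^ n * u a x)" for n
  proof (induction n)
    case 0
    then show ?case using d by simp
  next
    case (Suc n)
    have "T (\<lambda>x. \<Sum>a\<in>J. a ^ n * u a x) = (\<lambda>x. \<Sum>a\<in>J. a ^ Suc n * u a x)"
      by (subst T_sum[OF J]) (auto simp: T_scale u fun_eq_iff mult_ac intro!: sum.cong)
    with Suc show ?case by simp
  qed
  have at0: "u a v0 = w a" if "a \<in> J" for a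
  proof -
    have "u a v0 = (\<Sum>x\<in>W. u a x * ?d x)"
      using assms finite_W by (subst sum.mono_neutral_cong_right[of W "{v0}"]) auto
    also have "\<dots> = (\<Sum>x\<in>W. \<Sum>b\<in>J. u a x * u b x)"
      by (simp only: fun_cong[OF d] sum_distrib_left)
    also have "\<dots> = (\<Sum>b\<in>J. \<Sum>x\<in>W. u a x * u b x)" by (rule sum.swap)
    also have "\<dots> = (\<Sum>b\<in>J. if b = a then w a else 0)"
      using u that by (intro sum.cong) (auto simp: w_def power2_eq_square intro!: eigenvectors_orthogonal)
    finally show ?thesis using J that by simp
  qed
  show ?thesis
  proof (rule that[of J w])
    show "(T ^^ n) ?d v0 = (\<Sum>a\<in>J. w a * a ^ n)" for n
      by (simp add: Tn at0 mult.commute cong: sum.cong)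
    show "\<exists>u. (\<forall>x. x \<notin> W \<longrightarrow> u x = 0) \<and> u \<noteq> (\<lambda>_. 0) \<and> T u = (\<lambda>x. a * u x)"
      if "a \<in> J" "w a \<noteq> 0" for a
      using that u us by (intro exI[of _ "u a"]) (auto simp: w_def)
  qed (auto simp: J w_def sum_nonneg)
qed

text \<open>Eigenvectors for \<open>card W + 1\<close> distinct eigenvalues would be orthogonal yet
  dependent. Finiteness is what gives \<open>Min\<close> in \<open>lowest_nonzero_eigenvalue\<close>
  its meaning.\<close>

lemma finite_eigenvalues:
  "finite {a. \<exists>u. (\<forall>x. x \<notin> W \<longrightarrow> u x = 0) \<and> u \<noteq> (\<lambda>_. 0) \<and> T u = (\<lambda>x. a * u x)}" (is "finite ?E")
proof (rule ccontr)
  assume "infinite ?E"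
  then obtain I where I: "I \<subseteq> ?E" "finite I" "card I = Suc (card W)"
    using infinite_arbitrarily_large[of ?E "Suc (card W)"] by auto
  have "\<forall>a\<in>I. \<exists>u. (\<forall>x. x \<notin> W \<longrightarrow> u x = 0) \<and> u \<noteq> (\<lambda>_. 0) \<and> T u = (\<lambda>x. a * u x)"
    using I(1) by blast
  from bchoice[OF this] obtain u where u: "\<And>a. a \<in> I \<Longrightarrow> (\<forall>x. x \<notin> W \<longrightarrow> u a x = 0) \<and> u a \<noteq> (\<lambda>_. 0) \<and> T (u a) = (\<lambda>x. a * u a x)"
    by blast
  obtain c i where c: "i \<in> I" "c i \<noteq> 0" "\<forall>x\<in>W. (\<Sum>a\<in>I. c a * u a x) = 0"
    using nontrivial_dependence[OF finite_W I(2), of u] I(3) by auto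
  have "0 = (\<Sum>x\<in>W. u i x * (\<Sum>a\<in>I. c a * u a x))" using c by simp
  also have "\<dots> = (\<Sum>a\<in>I. c a * (\<Sum>x\<in>W. u i x * u a x))"
    unfolding sum_distrib_left by (subst sum.swap) (simp add: mult_ac)
  also have "\<dots> = (\<Sum>a\<in>I. if a = i then c i * (\<Sum>x\<in>W. (u i x)\<^sup>2) else 0)"
    using u c(1) by (intro sum.cong) (auto simp: power2_eq_square eigenvectors_orthogonal)
  finally have "(\<Sum>x\<in>W. (u i x)\<^sup>2) = 0" using c(1,2) I(2) by simp
  then show False using norm_zero_imp[of "u i"] u[OF c(1)] by auto
qed

end

section \<open>Spectral measures from moments\<close>

lemma AE_bounded_support:
  fixes R :: real
  assumes "sets \<mu> = sets borel" "emeasure \<mu> (- {-R..R}) = 0"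
  shows "AE x in \<mu>. \<bar>x\<bar> \<le> R"
proof (rule AE_I[where N = "- {-R..R}"])
  show "- {- R..R} \<in> sets \<mu>" using assms(1) by simp
qed (use assms in auto)

lemma integrable_power_bounded_support:
  fixes R :: real
  assumes "finite_measure \<mu>" "sets \<mu> = sets borel" "emeasure \<mu> (- {-R..R}) = 0"
  shows "integrable \<mu> (\<lambda>x. x ^ n)"
proof (rule finite_measure.integrable_const_bound[OF assms(1), where B = "\<bar>R\<bar> ^ n"])
  show "AE x in \<mu>. norm (x ^ n) \<le> \<bar>R\<bar> ^ n"
    using AE_bounded_support[OF assms(2,3)]
    by eventually_elim (auto simp: power_abs intro!: power_mono)
  show "(\<lambda>x. x ^ n) \<in> borel_measurable \<mu>"
    using assms(2) by (simp cong: measurable_cong_sets)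
qed

text \<open>The coefficients depend on R and E only. That uniformity serves twice: two measures with
  the same moments have the same distribution function, and the distribution function of a random
  measure is measurable as soon as its moments are.\<close>

lemma cdf_limit_of_moments:
  fixes R E :: real
  obtains c :: "nat \<Rightarrow> nat \<Rightarrow> real" and d :: "nat \<Rightarrow> nat" where
    "\<And>\<mu>. \<lbrakk>finite_measure \<mu>; sets \<mu> = sets borel; emeasure \<mu> (- {-R..R}) = 0\<rbrakk> \<Longrightarrow>
       (\<lambda>j. \<Sum>i\<le>d j. c j i * (\<integral>x. x ^ i \<partial>\<mu>)) \<longlonglongrightarrow> measure \<mu> {..E}"
proof -
  \<comment> \<open>A continuous ramp, equal to 1 up to E and to 0 from E + 1/j on; it tends to the
    indicator of \<open>{..E}\<close> and is approximated on [-R, R] by polynomials within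
    1/(j+1).\<close>
  define g where "g j x = max 0 (min 1 (1 - real j * (x - E)))" for j x
  have "\<exists>c d. \<forall>x\<in>{-R..R}. \<bar>g j x - (\<Sum>i\<le>d. c i * x ^ i)\<bar> < 1 / real (Suc j)" for j
  proof -
    have "continuous_on {-R..R} (g j)" unfolding g_def by (intro continuous_intros)
    then obtain p where p: "real_polynomial_function p" "\<And>x. x \<in> {-R..R} \<Longrightarrow> \<bar>g j x - p x\<bar> < 1 / real (Suc j)"
      using Stone_Weierstrass_real_polynomial_function[of "{-R..R}" "g j" "1 / real (Suc j)"] by auto
    then show ?thesis unfolding real_polynomial_function_iff_sum by blast
  qed
  then obtain c d where cd: "\<And>j x. x \<in> {-R..R} \<Longrightarrow> \<bar>g j x - (\<Sum>i\<le>d j. c j i * x ^ i)\<bar> < 1 / real (Suc j)"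
    by metis
  have "(\<lambda>j. \<Sum>i\<le>d j. c j i * (\<integral>x. x ^ i \<partial>\<mu>)) \<longlonglongrightarrow> measure \<mu> {..E}"
    if fin: "finite_measure \<mu>" and bor: "sets \<mu> = sets borel" and supp: "emeasure \<mu> (- {-R..R}) = 0" for \<mu>
  proof -
    interpret finite_measure \<mu> by fact
    have sp: "space \<mu> = UNIV" using sets_eq_imp_space_eq[OF bor] by simp
    have meas: "h \<in> borel_measurable \<mu>" if "h \<in> borel_measurable borel" for h :: "real \<Rightarrow> real"
      using that bor by (simp cong: measurable_cong_sets)
    have int: "integrable \<mu> (\<lambda>x. x ^ i)" for i
      by (rule integrable_power_bounded_support[OF fin bor supp])
    have AE: "AE x in \<mu>. x \<in> {-R..R}"
      using AE_bounded_support[OF bor supp] by eventually_elim auto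
    let ?f = "\<lambda>j x. \<Sum>i\<le>d j. c j i * x ^ i"
    have "(\<lambda>j. \<integral>x. ?f j x \<partial>\<mu>) \<longlonglongrightarrow> (\<integral>x. indicator {..E} x \<partial>\<mu>)"
    proof (rule integral_dominated_convergence[where w = "\<lambda>_. 2"])
      show "AE x in \<mu>. (\<lambda>j. ?f j x) \<longlonglongrightarrow> indicator {..E} x"
        using AE
      proof eventually_elim
        case (elim x)
        have "(\<lambda>j. g j x) \<longlonglongrightarrow> indicator {..E} x"
        proof (cases "x \<le> E")
          case True
          then have "g j x = 1" for j by (simp add: g_def mult_nonneg_nonpos)
          then show ?thesis using True by simp
        next
          case False
          obtain N where N: "1 / (x - E) < real N" using reals_Archimedean2 by blast
          have "g j x = 0" if "j \<ge> N" for j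
          proof -
            have "1 / (x - E) < real j" using N that by linarith
            then have "1 < real j * (x - E)" using False by (simp add: field_simps)
            then show ?thesis by (simp add: g_def)
          qed
          then have "\<forall>\<^sub>F j in sequentially. g j x = 0" unfolding eventually_sequentially by blast
          then show ?thesis using False by (simp add: tendsto_eventually)
        qed
        moreover have "(\<lambda>j. g j x - ?f j x) \<longlonglongrightarrow> 0"
        proof (rule Lim_null_comparison)
          show "\<forall>\<^sub>F j in sequentially. norm (g j x - ?f j x) \<le> 1 / real (Suc j)"
            using cd[OF elim] by (intro always_eventually allI) (auto simp: less_imp_le)
          show "(\<lambda>j. 1 / real (Suc j)) \<longlonglongrightarrow> 0" by (rule lim_1_over_n[THEN LIMSEQ_Suc])
        qed
        ultimately have "(\<lambda>j. g j x - (g j x - ?f j x)) \<longlonglongrightarrow> indicator {..E} x - 0"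
          by (intro tendsto_diff)
        then show ?case by simp
      qed
      show "AE x in \<mu>. norm (?f j x) \<le> 2" for j
        using AE
      proof eventually_elim
        case (elim x)
        have "0 \<le> g j x" "g j x \<le> 1" by (auto simp: g_def)
        moreover have "1 / real (Suc j) \<le> 1" by simp
        ultimately have "\<bar>?f j x\<bar> \<le> 2" using cd[OF elim, of j] by linarith
        then show ?case by simp
      qed
      have "(indicator {..E} :: real \<Rightarrow> real) \<in> borel_measurable borel" by simp
      then show "(\<lambda>x. indicator {..E} x :: real) \<in> borel_measurable \<mu>" by (rule meas)
      show "?f j \<in> borel_measurable \<mu>" for j by (rule meas) simp
    qed simp
    moreover have "(\<integral>x. ?f j x \<partial>\<mu>) = (\<Sum>i\<le>d j. c j i * (\<integral>x. x ^ i \<partial>\<mu>))" for j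
      by (simp add: int)
    ultimately show ?thesis using sp by simp
  qed
  with that show ?thesis by blast
qed

text \<open>The predicate under \<open>THE\<close> in \<open>spectral_measure\<close>, with the
  moment sequence abstracted, so that the definition can be folded to it.\<close>

definition has_moments :: "real measure \<Rightarrow> (nat \<Rightarrow> real) \<Rightarrow> bool" where
  "has_moments \<mu> m \<longleftrightarrow> sets \<mu> = sets borel \<and> finite_measure \<mu> \<and>
      (\<exists>R. emeasure \<mu> (- {-R..R}) = 0) \<and>
      (\<forall>n. integrable \<mu> (\<lambda>x. x ^ n) \<and> (\<integral>x. x ^ n \<partial>\<mu>) = m n)"

lemma emeasure_support_mono:
  fixes R R' :: real
  assumes "sets \<mu> = sets borel" "emeasure \<mu> (- {-R..R}) = 0" "R \<le> R'"
  shows "emeasure \<mu> (- {-R'..R'}) = 0"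
proof -
  have "emeasure \<mu> (- {-R'..R'}) \<le> emeasure \<mu> (- {-R..R})"
    using assms(1,3) by (intro emeasure_mono) auto
  with assms(2) show ?thesis by simp
qed

lemma has_moments_unique:
  assumes "has_moments \<mu> m" "has_moments \<nu> m"
  shows "\<mu> = \<nu>"
proof (rule cdf_unique')
  show "finite_borel_measure \<mu>" "finite_borel_measure \<nu>"
    using assms by (auto simp: has_moments_def finite_borel_measure_def finite_borel_measure_axioms_def)
  obtain R1 R2 where R: "emeasure \<mu> (- {-R1..R1}) = 0" "emeasure \<nu> (- {-R2..R2}) = 0"
    using assms by (auto simp: has_moments_def)
  define R where "R = max R1 R2"
  have supp: "emeasure \<mu> (- {-R..R}) = 0" "emeasure \<nu> (- {-R..R}) = 0"
    using assms R emeasure_support_mono[of \<mu> R1 R] emeasure_support_mono[of \<nu> R2 R]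
    by (auto simp: has_moments_def R_def)
  show "cdf \<mu> = cdf \<nu>"
  proof
    fix E
    obtain c d where lim: "\<And>\<mu>. \<lbrakk>finite_measure \<mu>; sets \<mu> = sets borel; emeasure \<mu> (- {-R..R}) = 0\<rbrakk> \<Longrightarrow>
       (\<lambda>j. \<Sum>i\<le>d j. c j i * (\<integral>x. x ^ i \<partial>\<mu>)) \<longlonglongrightarrow> measure \<mu> {..E}"
      by (rule cdf_limit_of_moments[of R E]) blast
    have "(\<lambda>j. \<Sum>i\<le>d j. c j i * m i) \<longlonglongrightarrow> measure \<mu> {..E}"
      "(\<lambda>j. \<Sum>i\<le>d j. c j i * m i) \<longlonglongrightarrow> measure \<nu> {..E}"
      using lim[of \<mu>] lim[of \<nu>] supp assms by (auto simp: has_moments_def)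
    then show "cdf \<mu> E = cdf \<nu> E" unfolding cdf_def by (rule LIMSEQ_unique)
  qed
qed

lemma spectral_measure_eqI:
  assumes "has_moments \<mu> (moment t k V Adj v0)"
  shows "spectral_measure t k V Adj v0 = \<mu>"
  unfolding spectral_measure_def has_moments_def[symmetric]
  using assms has_moments_unique[OF _ assms] by (rule the_equality)

text \<open>A common compact support gives tightness, hence a weak limit along a subsequence. Weak
  convergence tests only bounded continuous functions, so powers are cut off outside [-R, R], which
  changes no integral once the limit is known to live there.\<close>

lemma real_distribution_moment_limit:
  fixes R :: real
  assumes R: "R \<ge> 0" and \<mu>: "\<And>n. real_distribution (\<mu> n)"
    and supp: "\<And>n. emeasure (\<mu> n) (- {-R..R}) = 0"
    and lim: "\<And>i. (\<lambda>n. \<integral>x. x ^ i \<partial>\<mu> n) \<longlonglongrightarrow> m i"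
  obtains M where "real_distribution M" "emeasure M (- {-R..R}) = 0" "\<And>i. (\<integral>x. x ^ i \<partial>M) = m i"
proof -
  interpret \<mu>: real_distribution "\<mu> n" for n by (rule \<mu>)
  have AE\<mu>: "AE x in \<mu> n. \<bar>x\<bar> \<le> R" for n
    by (rule AE_bounded_support) (use supp in auto)
  have "measure (\<mu> n) {-R - 1<..R + 1} = 1" for n
    using AE\<mu>[of n] by (subst \<mu>.prob_eq_1) (auto elim!: eventually_mono)
  then have "tight \<mu>"
    unfolding tight_def using \<mu> R
    by (intro conjI allI impI exI[of _ "-R - 1"] exI[of _ "R + 1"]) simp_all
  then obtain r M where r: "strict_mono (r :: nat \<Rightarrow> nat)" and M: "real_distribution M"
    and wc: "weak_conv_m (\<mu> \<circ> id \<circ> r) M"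
    using tight_imp_convergent_subsubsequence[of \<mu> id] by (auto simp: strict_mono_id)
  interpret M: real_distribution M by fact
  have conv: "(\<lambda>n. \<integral>x. g x \<partial>\<mu> (r n)) \<longlonglongrightarrow> (\<integral>x. g x \<partial>M)"
    if "\<And>x. isCont g x" "\<And>x. norm (g x) \<le> B" for g :: "real \<Rightarrow> real" and B
    using weak_conv_imp_integral_bdd_continuous_conv[of "\<mu> \<circ> id \<circ> r" M g B] \<mu> M wc that by simp
  \<comment> \<open>Bounded, continuous, and zero exactly on [-R, R]; its vanishing integral passes
    to the limit and confines M to that interval.\<close>
  define h where "h x = min 1 (max 0 (\<bar>x\<bar> - R))" for x :: real
  have h: "isCont h x" "norm (h x) \<le> 1" "0 \<le> h x" for x
    unfolding h_def by (auto intro!: continuous_intros)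
  have "(\<integral>x. h x \<partial>\<mu> n) = 0" for n
    using AE\<mu>[of n] by (intro integral_eq_zero_AE) (auto simp: h_def elim!: eventually_mono)
  then have h0: "(\<integral>x. h x \<partial>M) = 0"
    using conv[of h 1] h by (simp add: LIMSEQ_const_iff)
  have "h \<in> borel_measurable borel"
    by (intro borel_measurable_continuous_onI continuous_at_imp_continuous_on ballI h(1))
  then have hm: "h \<in> borel_measurable M" by (simp cong: measurable_cong_sets)
  have "integrable M h"
    by (rule M.integrable_const_bound[where B = 1]) (use h hm in auto)
  then have "AE x in M. h x = 0"
    using h0 h(3) by (subst (asm) integral_nonneg_eq_0_iff_AE) auto
  then have AEM: "AE x in M. \<bar>x\<bar> \<le> R"
    by eventually_elim (auto simp: h_def min_def max_def split: if_splits)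
  have suppM: "emeasure M (- {-R..R}) = 0"
  proof -
    have "AE x in M. x \<notin> - {-R..R}" using AEM by eventually_elim auto
    then show ?thesis by (subst (asm) AE_iff_measurable[of "- {-R..R}"]) auto
  qed
  have "(\<integral>x. x ^ i \<partial>M) = m i" for i
  proof -
    define g where "g x = (max (-R) (min R x)) ^ i" for x :: real
    have g: "isCont g x" for x unfolding g_def by (intro continuous_intros)
    have gb: "norm (g x) \<le> R ^ i" for x
    proof -
      have "\<bar>max (-R) (min R x)\<bar> \<le> R" using R by auto
      then show ?thesis unfolding g_def by (simp add: power_abs power_mono)
    qed
    have gm: "g \<in> borel_measurable borel"
      by (intro borel_measurable_continuous_onI continuous_at_imp_continuous_on ballI g)
    have eq: "(\<integral>x. g x \<partial>N) = (\<integral>x. x ^ i \<partial>N)" if "AE x in N. \<bar>x\<bar> \<le> R" "sets N = sets borel" for N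
      using that gm by (intro integral_cong_AE) (auto simp: g_def cong: measurable_cong_sets elim!: eventually_mono)
    have "(\<lambda>n. \<integral>x. x ^ i \<partial>\<mu> (r n)) \<longlonglongrightarrow> (\<integral>x. x ^ i \<partial>M)"
      using conv[of g "R ^ i"] g gb AE\<mu> AEM by (simp add: eq)
    moreover have "(\<lambda>n. \<integral>x. x ^ i \<partial>\<mu> (r n)) \<longlonglongrightarrow> m i"
      using LIMSEQ_subseq_LIMSEQ[OF lim r] by (simp add: o_def)
    ultimately show ?thesis by (rule LIMSEQ_unique)
  qed
  with that M suppM show ?thesis by blast
qed

lemma atomic_distribution:
  fixes J :: "real set"
  assumes "finite J" "\<And>a. a \<in> J \<Longrightarrow> 0 \<le> w a" "(\<Sum>a\<in>J. w a) = 1" "\<And>a. a \<in> J \<Longrightarrow> w a \<noteq> 0 \<Longrightarrow> \<bar>a\<bar> \<le> R"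
  obtains M where "real_distribution M" "emeasure M (- {-R..R}) = 0"
    "\<And>n. (\<integral>x. x ^ n \<partial>M) = (\<Sum>a\<in>J. w a * a ^ n)"
    "\<And>A. A \<in> sets borel \<Longrightarrow> measure M A \<noteq> 0 \<Longrightarrow> \<exists>a\<in>J \<inter> A. w a \<noteq> 0"
proof -
  \<comment> \<open>\<open>point_measure\<close> lives on the discrete space \<open>J\<close>; the
    push-forward turns it into a Borel measure on the line.\<close>
  define P where "P = point_measure J (\<lambda>a. ennreal (w a))"
  define M where "M = distr P borel (\<lambda>x. x)"
  have meas[measurable]: "(\<lambda>x. x) \<in> measurable P borel"
    by (auto simp: P_def measurable_def space_point_measure sets_point_measure)
  have em: "emeasure M A = ennreal (\<Sum>a\<in>J \<inter> A. w a)" if "A \<in> sets borel" for A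
  proof -
    have "emeasure M A = emeasure P (J \<inter> A)"
      unfolding M_def using that by (subst emeasure_distr)
        (auto simp: P_def space_point_measure intro!: arg_cong2[where f = emeasure])
    also have "\<dots> = ennreal (\<Sum>a\<in>J \<inter> A. w a)"
      unfolding P_def using assms by (subst emeasure_point_measure_finite) (auto intro!: sum_ennreal)
    finally show ?thesis .
  qed
  show ?thesis
  proof (rule that)
    have "prob_space M"
      using em[of UNIV] assms(3) by (intro prob_spaceI) (simp add: M_def)
    then show "real_distribution M"
      by (simp add: real_distribution_def real_distribution_axioms_def M_def)
    have "(\<Sum>a\<in>J \<inter> - {-R..R}. w a) = 0"
      by (intro sum.neutral) (use assms(4) in force)
    then show "emeasure M (- {-R..R}) = 0" by (subst em) auto
    show "(\<integral>x. x ^ n \<partial>M) = (\<Sum>a\<in>J. w a * a ^ n)" for n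
      unfolding M_def using assms(1,2)
      by (subst integral_distr) (auto simp: P_def lebesgue_integral_point_measure_finite)
    show "\<exists>a\<in>J \<inter> A. w a \<noteq> 0" if "A \<in> sets borel" "measure M A \<noteq> 0" for A
    proof (rule ccontr)
      assume "\<not> (\<exists>a\<in>J \<inter> A. w a \<noteq> 0)"
      then have "emeasure M A = 0" using em[OF that(1)] by (simp add: sum.neutral)
      then show False using that(2) by (simp add: measure_def)
    qed
  qed
qed

text \<open>The diagonal \<open>D\<close> is independent of \<open>W\<close>: truncation to a ball
  must shorten the neighbour sum but keep the degrees of the full graph, which for
  \<open>LapD\<close> and \<open>LapN\<close> sit on the diagonal.\<close>

definition schroedinger :: "('a \<Rightarrow> real) \<Rightarrow> ('a \<Rightarrow> 'a \<Rightarrow> bool) \<Rightarrow> 'a set \<Rightarrow> ('a \<Rightarrow> real) \<Rightarrow> 'a \<Rightarrow> real" where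
  "schroedinger D Adj W u x = (if x \<in> W then D x * u x - (\<Sum>y\<in>nbrs W Adj x. u y) else 0)"

lemma finite_symmetric_operator_schroedinger:
  assumes "finite W" "\<And>x y. Adj x y \<Longrightarrow> Adj y x"
  shows "finite_symmetric_operator W (schroedinger D Adj W)"
proof
  fix u v :: "'a \<Rightarrow> real"
  have e: "(\<Sum>y\<in>nbrs W Adj x. w y) = (\<Sum>y\<in>W. if Adj x y then w y else 0)" for w :: "'a \<Rightarrow> real" and x
    unfolding nbrs_def using assms(1) by (simp add: sum.inter_filter)
  have "(\<Sum>x\<in>W. (\<Sum>y\<in>nbrs W Adj x. u y) * v x) = (\<Sum>x\<in>W. \<Sum>y\<in>W. if Adj x y then u y * v x else 0)"
    unfolding e sum_distrib_right by (intro sum.cong) auto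
  also have "\<dots> = (\<Sum>x\<in>W. \<Sum>y\<in>W. if Adj x y then u x * v y else 0)"
    by (subst sum.swap) (use assms(2) in \<open>auto intro!: sum.cong\<close>)
  also have "\<dots> = (\<Sum>x\<in>W. u x * (\<Sum>y\<in>nbrs W Adj x. v y))"
    unfolding e sum_distrib_left by (intro sum.cong) auto
  finally show "(\<Sum>x\<in>W. schroedinger D Adj W u x * v x) = (\<Sum>x\<in>W. u x * schroedinger D Adj W v x)"
    by (simp add: schroedinger_def left_diff_distrib right_diff_distrib sum_subtractf mult_ac)
qed (auto simp: schroedinger_def fun_eq_iff assms sum.distrib sum_distrib_left algebra_simps)

text \<open>Evaluate the eigenvalue equation at a vertex where the absolute value of the eigenvector
  is maximal.\<close>

lemma schroedinger_eigenvalue_bound: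
  assumes "finite W" "\<And>x. x \<in> W \<Longrightarrow> \<bar>D x\<bar> + real (card (nbrs W Adj x)) \<le> R"
    and u: "\<forall>x. x \<notin> W \<longrightarrow> u x = 0" "u \<noteq> (\<lambda>_. 0)" "schroedinger D Adj W u = (\<lambda>x. a * u x)"
  shows "\<bar>a\<bar> \<le> R"
proof -
  have "W \<noteq> {}" using u(1,2) by auto
  then have "Max ((\<lambda>x. \<bar>u x\<bar>) ` W) \<in> (\<lambda>x. \<bar>u x\<bar>) ` W"
    using assms(1) by (intro Max_in) auto
  then obtain x where x: "x \<in> W" and mx: "Max ((\<lambda>x. \<bar>u x\<bar>) ` W) = \<bar>u x\<bar>" by (elim imageE)
  have le: "\<bar>u y\<bar> \<le> \<bar>u x\<bar>" if "y \<in> W" for y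
    unfolding mx[symmetric] using assms(1) that by (intro Max_ge) auto
  have pos: "\<bar>u x\<bar> > 0"
  proof (rule ccontr)
    assume "\<not> \<bar>u x\<bar> > 0"
    then have "u y = 0" for y using le[of y] u(1) by (cases "y \<in> W") auto
    then show False using u(2) by auto
  qed
  have "\<bar>a\<bar> * \<bar>u x\<bar> = \<bar>D x * u x - (\<Sum>y\<in>nbrs W Adj x. u y)\<bar>"
    using fun_cong[OF u(3), of x] x by (simp add: schroedinger_def abs_mult)
  also have "\<dots> \<le> \<bar>D x\<bar> * \<bar>u x\<bar> + (\<Sum>y\<in>nbrs W Adj x. \<bar>u y\<bar>)"
    by (intro order_trans[OF abs_triangle_ineq4] add_mono sum_abs) (simp add: abs_mult)
  also have "(\<Sum>y\<in>nbrs W Adj x. \<bar>u y\<bar>) \<le> real (card (nbrs W Adj x)) * \<bar>u x\<bar>"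
    by (rule sum_bounded_above) (auto simp: nbrs_def le)
  also have "\<bar>D x\<bar> * \<bar>u x\<bar> + real (card (nbrs W Adj x)) * \<bar>u x\<bar> \<le> R * \<bar>u x\<bar>"
    using assms(2)[OF x] by (simp flip: distrib_right add: mult_right_mono)
  finally show ?thesis using pos by simp
qed

section \<open>Spectral distributions of graph operators at a vertex\<close>

abbreviation dirac_fun :: "'a \<Rightarrow> 'a \<Rightarrow> real" where
  "dirac_fun v0 \<equiv> (\<lambda>x. if x = v0 then 1 else 0)"

lemma schroedinger_finite_distribution:
  assumes "finite W" "\<And>x y. Adj x y \<Longrightarrow> Adj y x" "v0 \<in> W"
    and bd: "\<And>x. x \<in> W \<Longrightarrow> \<bar>D x\<bar> + real (card (nbrs W Adj x)) \<le> R"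
  obtains M where "real_distribution M" "emeasure M (- {-R..R}) = 0"
    "\<And>n. (\<integral>x. x ^ n \<partial>M) = (schroedinger D Adj W ^^ n) (dirac_fun v0) v0"
    "\<And>A. A \<in> sets borel \<Longrightarrow> measure M A \<noteq> 0 \<Longrightarrow>
       \<exists>a\<in>A. \<exists>u. (\<forall>x. x \<notin> W \<longrightarrow> u x = 0) \<and> u \<noteq> (\<lambda>_. 0) \<and> schroedinger D Adj W u = (\<lambda>x. a * u x)"
proof -
  interpret finite_symmetric_operator W "schroedinger D Adj W"
    by (rule finite_symmetric_operator_schroedinger) (use assms in auto)
  obtain J w where J: "finite J" "\<And>a. a \<in> J \<Longrightarrow> 0 \<le> w a"
    "\<And>n. (schroedinger D Adj W ^^ n) (dirac_fun v0) v0 = (\<Sum>a\<in>J. w a * a ^ n)"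
    "\<And>a. a \<in> J \<Longrightarrow> w a \<noteq> 0 \<Longrightarrow>
       \<exists>u. (\<forall>x. x \<notin> W \<longrightarrow> u x = 0) \<and> u \<noteq> (\<lambda>_. 0) \<and> schroedinger D Adj W u = (\<lambda>x. a * u x)"
    using moment_representation[OF assms(3)] by blast
  have 1: "(\<Sum>a\<in>J. w a) = 1" using J(3)[of 0] by simp
  have R: "\<bar>a\<bar> \<le> R" if "a \<in> J" "w a \<noteq> 0" for a
    using J(4)[OF that] schroedinger_eigenvalue_bound[OF assms(1) bd] by blast
  obtain M where M: "real_distribution M" "emeasure M (- {-R..R}) = 0"
    "\<And>n. (\<integral>x. x ^ n \<partial>M) = (\<Sum>a\<in>J. w a * a ^ n)"
    "\<And>A. A \<in> sets borel \<Longrightarrow> measure M A \<noteq> 0 \<Longrightarrow> \<exists>a\<in>J \<inter> A. w a \<noteq> 0"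
    using atomic_distribution[OF J(1,2) 1 R] by blast
  show ?thesis
  proof (rule that[OF M(1,2)])
    show "\<exists>a\<in>A. \<exists>u. (\<forall>x. x \<notin> W \<longrightarrow> u x = 0) \<and> u \<noteq> (\<lambda>_. 0) \<and> schroedinger D Adj W u = (\<lambda>x. a * u x)"
      if "A \<in> sets borel" "measure M A \<noteq> 0" for A
      using M(4)[OF that] J(4) by blast
  qed (simp add: M(3) J(3))
qed

fun graph_ball :: "'a set \<Rightarrow> ('a \<Rightarrow> 'a \<Rightarrow> bool) \<Rightarrow> 'a \<Rightarrow> nat \<Rightarrow> 'a set" where
  "graph_ball V Adj v0 0 = {v0}"
| "graph_ball V Adj v0 (Suc n) = graph_ball V Adj v0 n \<union> (\<Union>x\<in>graph_ball V Adj v0 n. nbrs V Adj x)"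

lemma graph_ball_mono: "m \<le> n \<Longrightarrow> graph_ball V Adj v0 m \<subseteq> graph_ball V Adj v0 n"
  by (rule lift_Suc_mono_le[of "graph_ball V Adj v0"]) auto

lemma graph_ball_subset: "v0 \<in> V \<Longrightarrow> graph_ball V Adj v0 n \<subseteq> V"
  by (induction n) (auto simp: nbrs_def)

lemma finite_graph_ball: "(\<And>x. finite (nbrs V Adj x)) \<Longrightarrow> finite (graph_ball V Adj v0 n)"
  by (induction n) auto

text \<open>Finite propagation: n applications of the operator see only the ball of radius n. The
  support statement is carried along because the induction step needs it to drop neighbours outside
  \<open>W\<close>.\<close>

lemma schroedinger_local:
  assumes sym: "\<And>x y. Adj x y \<Longrightarrow> Adj y x" and fin: "\<And>x. finite (nbrs V Adj x)"
    and "W \<subseteq> V" "graph_ball V Adj v0 n \<subseteq> W"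
  shows "(schroedinger D Adj V ^^ n) (dirac_fun v0) = (schroedinger D Adj W ^^ n) (dirac_fun v0) \<and>
    (\<forall>x. x \<notin> graph_ball V Adj v0 n \<longrightarrow> (schroedinger D Adj W ^^ n) (dirac_fun v0) x = 0)"
  using assms(4)
proof (induction n)
  case (Suc n)
  let ?\<phi> = "(schroedinger D Adj W ^^ n) (dirac_fun v0)"
  have IH: "(schroedinger D Adj V ^^ n) (dirac_fun v0) = ?\<phi>" "\<And>x. x \<notin> graph_ball V Adj v0 n \<Longrightarrow> ?\<phi> x = 0"
    using Suc by auto
  \<comment> \<open>By symmetry of \<open>Adj\<close>, a neighbour inside the ball of radius n would
    put x into the ball of radius n + 1.\<close>
  have z: "?\<phi> y = 0" if "x \<in> V" "x \<notin> graph_ball V Adj v0 (Suc n)" "Adj x y" for x y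
    using that sym[of x y] by (intro IH(2)) (auto simp: nbrs_def)
  have "schroedinger D Adj V ?\<phi> x = schroedinger D Adj W ?\<phi> x" for x
  proof (cases "x \<in> W")
    case True
    have "(\<Sum>y\<in>nbrs V Adj x. ?\<phi> y) = (\<Sum>y\<in>nbrs W Adj x. ?\<phi> y)"
      using fin[of x] assms(3) Suc.prems IH(2) by (intro sum.mono_neutral_right) (auto simp: nbrs_def)
    then show ?thesis using True assms(3) by (auto simp: schroedinger_def)
  next
    case False
    then have "x \<notin> graph_ball V Adj v0 (Suc n)" using Suc.prems by blast
    then show ?thesis using False IH(2)[of x] z[of x] by (auto simp: schroedinger_def nbrs_def)
  qed
  moreover have "schroedinger D Adj W ?\<phi> x = 0" if "x \<notin> graph_ball V Adj v0 (Suc n)" for x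
  proof (cases "x \<in> W")
    case True
    then show ?thesis using that IH(2)[of x] z[of x] assms(3) by (auto simp: schroedinger_def nbrs_def subset_iff)
  qed (simp add: schroedinger_def)
  ultimately show ?case using IH(1) by (simp add: fun_eq_iff[of "schroedinger D Adj V ?\<phi>"])
qed simp

text \<open>Truncation to balls gives finite operators whose \<open>n\<close>-th moments are eventually constant; a weak
  limit point of their spectral measures has the required moments.\<close>

lemma schroedinger_distribution:
  assumes sym: "\<And>x y. Adj x y \<Longrightarrow> Adj y x" and fin: "\<And>x. finite (nbrs V Adj x)" and "v0 \<in> V"
    and bd: "\<And>x. x \<in> V \<Longrightarrow> \<bar>D x\<bar> + real (card (nbrs V Adj x)) \<le> R"
  obtains M where "real_distribution M" "emeasure M (- {-R..R}) = 0"
    "\<And>n. (\<integral>x. x ^ n \<partial>M) = (schroedinger D Adj V ^^ n) (dirac_fun v0) v0"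
proof -
  let ?W = "graph_ball V Adj v0"
  have "\<exists>M. real_distribution M \<and> emeasure M (- {-R..R}) = 0 \<and>
      (\<forall>n. (\<integral>x. x ^ n \<partial>M) = (schroedinger D Adj (?W N) ^^ n) (dirac_fun v0) v0)" for N
  proof -
    have "v0 \<in> ?W N" using graph_ball_mono[of 0 N V Adj v0] by auto
    moreover have "\<bar>D x\<bar> + real (card (nbrs (?W N) Adj x)) \<le> R" if "x \<in> ?W N" for x
    proof -
      have "card (nbrs (?W N) Adj x) \<le> card (nbrs V Adj x)"
        using graph_ball_subset[OF assms(3), of Adj N] by (intro card_mono fin) (auto simp: nbrs_def)
      then show ?thesis using bd[of x] that graph_ball_subset[OF assms(3), of Adj N] by fastforce
    qed
    ultimately show ?thesis
      using schroedinger_finite_distribution[of "?W N" Adj v0 D R] finite_graph_ball[of V Adj v0 N, OF fin] sym by metis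
  qed
  then obtain \<mu> where \<mu>: "\<And>N. real_distribution (\<mu> N)" "\<And>N. emeasure (\<mu> N) (- {-R..R}) = 0"
    "\<And>N n. (\<integral>x. x ^ n \<partial>\<mu> N) = (schroedinger D Adj (?W N) ^^ n) (dirac_fun v0) v0"
    by metis
  have "(\<lambda>N. \<integral>x. x ^ n \<partial>\<mu> N) \<longlonglongrightarrow> (schroedinger D Adj V ^^ n) (dirac_fun v0) v0" for n
  proof (rule tendsto_eventually)
    show "\<forall>\<^sub>F N in sequentially. (\<integral>x. x ^ n \<partial>\<mu> N) = (schroedinger D Adj V ^^ n) (dirac_fun v0) v0"
      using eventually_ge_at_top[of n]
    proof eventually_elim
      case (elim N)
      show ?case
        using schroedinger_local[OF sym fin graph_ball_subset[OF assms(3)] graph_ball_mono[OF elim], where D = D] by (simp add: \<mu>(3))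
    qed
  qed
  moreover have "R \<ge> 0" using bd[OF assms(3)] by linarith
  ultimately show ?thesis
    using real_distribution_moment_limit[of R \<mu> "\<lambda>n. (schroedinger D Adj V ^^ n) (dirac_fun v0) v0"] \<mu>(1,2) that
    by metis
qed

section \<open>Percolation on finite sets\<close>

text \<open>Expectation under independent openness with probability p, a configuration being the set
  of its open sites. Written as a finite sum it is a polynomial in p, so Russo's formula and
  conditioning reduce to induction on \<open>B\<close>.\<close>

definition bern_exp :: "real \<Rightarrow> 'v set \<Rightarrow> ('v set \<Rightarrow> real) \<Rightarrow> real" where
  "bern_exp p B F = (\<Sum>\<omega>\<in>Pow B. p ^ card \<omega> * (1 - p) ^ card (B - \<omega>) * F \<omega>)"

lemma bern_exp_empty [simp]: "bern_exp p {} F = F {}"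
  by (simp add: bern_exp_def)

lemma bern_exp_insert:
  assumes "finite B" "b \<notin> B"
  shows "bern_exp p (insert b B) F = p * bern_exp p B (\<lambda>\<omega>. F (insert b \<omega>)) + (1 - p) * bern_exp p B F"
proof -
  have inj: "inj_on (insert b) (Pow B)"
    using assms(2) by (auto simp: inj_on_def)
  have "bern_exp p (insert b B) F
      = (\<Sum>\<omega>\<in>Pow B. p ^ card \<omega> * (1 - p) ^ card (insert b B - \<omega>) * F \<omega>)
      + (\<Sum>\<omega>\<in>insert b ` Pow B. p ^ card \<omega> * (1 - p) ^ card (insert b B - \<omega>) * F \<omega>)"
    unfolding bern_exp_def Pow_insert using assms by (intro sum.union_disjoint) auto
  also have "(\<Sum>\<omega>\<in>insert b ` Pow B. p ^ card \<omega> * (1 - p) ^ card (insert b B - \<omega>) * F \<omega>)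
      = p * bern_exp p B (\<lambda>\<omega>. F (insert b \<omega>))"
    unfolding bern_exp_def sum.reindex[OF inj] sum_distrib_left
  proof (intro sum.cong refl)
    fix \<omega> assume "\<omega> \<in> Pow B"
    then have "finite \<omega>" "b \<notin> \<omega>" "insert b B - insert b \<omega> = B - \<omega>"
      using assms finite_subset by auto
    then show "((\<lambda>\<omega>. p ^ card \<omega> * (1 - p) ^ card (insert b B - \<omega>) * F \<omega>) \<circ> insert b) \<omega>
        = p * (p ^ card \<omega> * (1 - p) ^ card (B - \<omega>) * F (insert b \<omega>))"
      by simp
  qed
  also have "(\<Sum>\<omega>\<in>Pow B. p ^ card \<omega> * (1 - p) ^ card (insert b B - \<omega>) * F \<omega>) = (1 - p) * bern_exp p B F"
    unfolding bern_exp_def sum_distrib_left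
  proof (intro sum.cong refl)
    fix \<omega> assume w: "\<omega> \<in> Pow B"
    then have "insert b B - \<omega> = insert b (B - \<omega>)" using assms by auto
    then have "card (insert b B - \<omega>) = Suc (card (B - \<omega>))" using assms by simp
    then show "p ^ card \<omega> * (1 - p) ^ card (insert b B - \<omega>) * F \<omega>
        = (1 - p) * (p ^ card \<omega> * (1 - p) ^ card (B - \<omega>) * F \<omega>)" by simp
  qed
  finally show ?thesis by simp
qed

lemma bern_exp_cong: "(\<And>\<omega>. \<omega> \<subseteq> B \<Longrightarrow> F \<omega> = G \<omega>) \<Longrightarrow> bern_exp p B F = bern_exp p B G"
  by (auto simp: bern_exp_def intro!: sum.cong)

lemma bern_exp_mono:
  assumes "0 \<le> p" "p \<le> 1" "\<And>\<omega>. \<omega> \<subseteq> B \<Longrightarrow> F \<omega> \<le> G \<omega>"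
  shows "bern_exp p B F \<le> bern_exp p B G"
  unfolding bern_exp_def using assms by (intro sum_mono mult_left_mono) auto

lemma bern_exp_diff: "bern_exp p B (\<lambda>\<omega>. F \<omega> - G \<omega>) = bern_exp p B F - bern_exp p B G"
  by (simp add: bern_exp_def sum_subtractf right_diff_distrib)

lemma bern_exp_cmult: "bern_exp p B (\<lambda>\<omega>. c * F \<omega>) = c * bern_exp p B F"
  by (simp add: bern_exp_def sum_distrib_left mult_ac)

lemma bern_exp_sum: "bern_exp p B (\<lambda>\<omega>. \<Sum>i\<in>I. F i \<omega>) = (\<Sum>i\<in>I. bern_exp p B (F i))"
  unfolding bern_exp_def sum_distrib_left by (rule sum.swap)

lemma bern_exp_const: "finite B \<Longrightarrow> bern_exp p B (\<lambda>_. c) = c"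
  by (induction B rule: finite_induct) (simp_all add: bern_exp_insert algebra_simps)

lemma bern_exp_split:
  assumes "finite B" "finite C" "B \<inter> C = {}"
  shows "bern_exp p (B \<union> C) F = bern_exp p B (\<lambda>\<eta>. bern_exp p C (\<lambda>\<zeta>. F (\<eta> \<union> \<zeta>)))"
  using assms(1,3)
proof (induction B arbitrary: F rule: finite_induct)
  case (insert b B)
  then have "b \<notin> B \<union> C" "finite (B \<union> C)" "B \<inter> C = {}" using assms(2) by auto
  with insert show ?case by (simp add: bern_exp_insert)
qed simp

lemma bern_exp_restrict:
  assumes "finite B" "C \<subseteq> B"
  shows "bern_exp p B (\<lambda>\<omega>. F (\<omega> \<inter> C)) = bern_exp p C F"
proof -
  have fin: "finite C" "finite (B - C)" using assms finite_subset by auto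
  have B: "B = C \<union> (B - C)" using assms(2) by auto
  have "bern_exp p B (\<lambda>\<omega>. F (\<omega> \<inter> C)) = bern_exp p C (\<lambda>\<eta>. bern_exp p (B - C) (\<lambda>\<zeta>. F ((\<eta> \<union> \<zeta>) \<inter> C)))"
    by (subst B, subst bern_exp_split) (use fin in auto)
  also have "\<dots> = bern_exp p C (\<lambda>\<eta>. bern_exp p (B - C) (\<lambda>\<zeta>. F \<eta>))"
    by (intro bern_exp_cong arg_cong[where f = F]) auto
  finally show ?thesis using fin by (simp add: bern_exp_const)
qed

lemma bern_exp_image:
  assumes "inj f" "finite B"
  shows "bern_exp p (f ` B) F = bern_exp p B (\<lambda>\<omega>. F (f ` \<omega>))"
  using assms(2)
proof (induction B arbitrary: F rule: finite_induct)
  case (insert b B)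
  then have "f b \<notin> f ` B" using assms(1) by (auto simp: inj_def)
  with insert show ?case by (simp add: bern_exp_insert)
qed simp

text \<open>One site at a time: for increasing \<open>F\<close> the open value of the site dominates
  the closed one, so moving weight from closed to open raises the convex combination.\<close>

lemma bern_exp_mono_p:
  assumes "finite B" "0 \<le> p" "p \<le> q" "q \<le> 1"
    "\<And>\<omega> \<omega>'. \<omega> \<subseteq> \<omega>' \<Longrightarrow> \<omega>' \<subseteq> B \<Longrightarrow> F \<omega> \<le> F \<omega>'"
  shows "bern_exp p B F \<le> bern_exp q B F"
  using assms(1,5)
proof (induction B arbitrary: F rule: finite_induct)
  case (insert b B)
  have mono: "bern_exp p B (\<lambda>\<omega>. F (insert b \<omega>)) \<le> bern_exp q B (\<lambda>\<omega>. F (insert b \<omega>))"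
    by (rule insert.IH, rule insert.prems) auto
  have mono': "bern_exp p B F \<le> bern_exp q B F"
    by (rule insert.IH, rule insert.prems) auto
  have le: "bern_exp q B F \<le> bern_exp q B (\<lambda>\<omega>. F (insert b \<omega>))"
    using assms by (intro bern_exp_mono insert.prems) auto
  have "p * bern_exp p B (\<lambda>\<omega>. F (insert b \<omega>)) + (1 - p) * bern_exp p B F
      \<le> p * bern_exp q B (\<lambda>\<omega>. F (insert b \<omega>)) + (1 - p) * bern_exp q B F"
    using mono mono' assms by (intro add_mono mult_left_mono) auto
  also have "\<dots> \<le> q * bern_exp q B (\<lambda>\<omega>. F (insert b \<omega>)) + (1 - q) * bern_exp q B F"
    using mult_mono[of p q "bern_exp q B (\<lambda>\<omega>. F (insert b \<omega>)) - bern_exp q B F" "bern_exp q B (\<lambda>\<omega>. F (insert b \<omega>)) - bern_exp q B F"]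
      le assms by (simp add: algebra_simps)
  finally show ?case using insert by (simp add: bern_exp_insert)
qed simp

text \<open>For arbitrary F: the discrete gradient in b does not look at the state of b. The product
  rule applied to \<open>bern_exp_insert\<close> yields the gradient in the new site plus, by
  induction, those in the old ones.\<close>

lemma Russo_formula:
  assumes "finite B"
  shows "((\<lambda>q. bern_exp q B F) has_real_derivative
      (\<Sum>b\<in>B. bern_exp q B (\<lambda>\<omega>. F (insert b \<omega>) - F (\<omega> - {b})))) (at q)"
  using assms
proof (induction B arbitrary: F rule: finite_induct)
  case (insert b B)
  have Fb: "bern_exp q B (\<lambda>\<omega>. F (insert b (insert b \<omega>)) - F (insert b \<omega> - {b}))
      = bern_exp q B (\<lambda>\<omega>. F (insert b \<omega>)) - bern_exp q B F"
    "bern_exp q B (\<lambda>\<omega>. F (insert b \<omega>) - F (\<omega> - {b})) = bern_exp q B (\<lambda>\<omega>. F (insert b \<omega>)) - bern_exp q B F"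
    unfolding bern_exp_diff[symmetric] using insert.hyps(2)
    by (auto intro!: bern_exp_cong arg_cong2[where f = "(-)"] arg_cong[where f = F])
  have Fc: "bern_exp q B (\<lambda>\<omega>. F (insert c (insert b \<omega>)) - F (insert b \<omega> - {c}))
      = bern_exp q B (\<lambda>\<omega>. F (insert b (insert c \<omega>)) - F (insert b (\<omega> - {c})))" if "c \<in> B" for c
    using that insert.hyps(2)
    by (auto intro!: bern_exp_cong arg_cong2[where f = "(-)"] arg_cong[where f = F])
  have "((\<lambda>q. q * bern_exp q B (\<lambda>\<omega>. F (insert b \<omega>)) + (1 - q) * bern_exp q B F) has_real_derivative
     (bern_exp q B (\<lambda>\<omega>. F (insert b \<omega>)) - bern_exp q B F)
     + (q * (\<Sum>c\<in>B. bern_exp q B (\<lambda>\<omega>. F (insert b (insert c \<omega>)) - F (insert b (\<omega> - {c}))))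
     + (1 - q) * (\<Sum>c\<in>B. bern_exp q B (\<lambda>\<omega>. F (insert c \<omega>) - F (\<omega> - {c}))))) (at q)"
    by (rule derivative_eq_intros insert.IH refl)+ (simp add: algebra_simps)
  also have "(bern_exp q B (\<lambda>\<omega>. F (insert b \<omega>)) - bern_exp q B F)
     + (q * (\<Sum>c\<in>B. bern_exp q B (\<lambda>\<omega>. F (insert b (insert c \<omega>)) - F (insert b (\<omega> - {c}))))
     + (1 - q) * (\<Sum>c\<in>B. bern_exp q B (\<lambda>\<omega>. F (insert c \<omega>) - F (\<omega> - {c}))))
    = (\<Sum>c\<in>insert b B. bern_exp q (insert b B) (\<lambda>\<omega>. F (insert c \<omega>) - F (\<omega> - {c})))"
    using insert.hyps Fb Fc
    by (simp add: bern_exp_insert sum.distrib sum_subtractf sum_distrib_left algebra_simps)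
  finally show ?case using insert.hyps by (simp add: bern_exp_insert)
qed simp

text \<open>\<open>T\<close> is an exploration that only looks at the states inside \<open>T \<omega>\<close>, so the states outside are
  independent of it.\<close>

lemma bern_exp_stopping:
  assumes fin: "finite \<Lambda>" and sub: "\<And>\<omega>. \<omega> \<subseteq> \<Lambda> \<Longrightarrow> T \<omega> \<subseteq> \<Lambda>"
    and stop: "\<And>\<omega> \<omega>'. \<omega> \<subseteq> \<Lambda> \<Longrightarrow> \<omega>' \<subseteq> \<Lambda> \<Longrightarrow> \<omega> \<inter> T \<omega> = \<omega>' \<inter> T \<omega> \<Longrightarrow> T \<omega>' = T \<omega>"
  shows "bern_exp p \<Lambda> F = bern_exp p \<Lambda> (\<lambda>\<omega>. bern_exp p (\<Lambda> - T \<omega>) (\<lambda>\<zeta>. F (\<omega> \<inter> T \<omega> \<union> \<zeta>)))"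
proof -
  have part: "bern_exp p \<Lambda> G = (\<Sum>D\<in>Pow \<Lambda>. bern_exp p \<Lambda> (\<lambda>\<omega>. if T \<omega> = D then G \<omega> else 0))" for G
    unfolding bern_exp_sum[symmetric] using fin sub by (intro bern_exp_cong) (simp add: sum.delta')
  have "bern_exp p \<Lambda> (\<lambda>\<omega>. if T \<omega> = D then F \<omega> else 0) =
      bern_exp p \<Lambda> (\<lambda>\<omega>. if T \<omega> = D then bern_exp p (\<Lambda> - T \<omega>) (\<lambda>\<zeta>. F (\<omega> \<inter> T \<omega> \<union> \<zeta>)) else 0)"
    if D: "D \<subseteq> \<Lambda>" for D
  proof -
    have finD: "finite D" "finite (\<Lambda> - D)" using fin D finite_subset by auto
    have \<Lambda>: "\<Lambda> = D \<union> (\<Lambda> - D)" using D by auto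
    \<comment> \<open>The event T = D is decided by the states inside D, because the stopping
      property can be applied in both directions.\<close>
    have T: "T (\<eta> \<union> \<zeta>) = D \<longleftrightarrow> T \<eta> = D" if "\<eta> \<subseteq> D" "\<zeta> \<subseteq> \<Lambda> - D" for \<eta> \<zeta>
    proof -
      have "\<eta> \<inter> D = (\<eta> \<union> \<zeta>) \<inter> D" "\<eta> \<subseteq> \<Lambda>" "\<eta> \<union> \<zeta> \<subseteq> \<Lambda>" using that D by auto
      then have "T \<eta> = D \<Longrightarrow> T (\<eta> \<union> \<zeta>) = T \<eta>" "T (\<eta> \<union> \<zeta>) = D \<Longrightarrow> T \<eta> = T (\<eta> \<union> \<zeta>)"
        using stop[of \<eta> "\<eta> \<union> \<zeta>"] stop[of "\<eta> \<union> \<zeta>" \<eta>] by simp_all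
      then show ?thesis by metis
    qed
    have split: "bern_exp p \<Lambda> G = bern_exp p D (\<lambda>\<eta>. bern_exp p (\<Lambda> - D) (\<lambda>\<zeta>. G (\<eta> \<union> \<zeta>)))" for G
      by (subst \<Lambda>, subst bern_exp_split) (use finD in auto)
    have "bern_exp p \<Lambda> (\<lambda>\<omega>. if T \<omega> = D then F \<omega> else 0)
        = bern_exp p D (\<lambda>\<eta>. bern_exp p (\<Lambda> - D) (\<lambda>\<zeta>. if T \<eta> = D then F (\<eta> \<union> \<zeta>) else 0))"
      unfolding split by (intro bern_exp_cong) (simp add: T)
    also have "\<dots> = bern_exp p D (\<lambda>\<eta>. if T \<eta> = D then bern_exp p (\<Lambda> - D) (\<lambda>\<zeta>. F (\<eta> \<union> \<zeta>)) else 0)"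
      using finD by (intro bern_exp_cong) (simp add: bern_exp_const)
    also have "\<dots> = bern_exp p D (\<lambda>\<eta>. bern_exp p (\<Lambda> - D) (\<lambda>\<zeta>. if T (\<eta> \<union> \<zeta>) = D
        then bern_exp p (\<Lambda> - T (\<eta> \<union> \<zeta>)) (\<lambda>\<zeta>'. F ((\<eta> \<union> \<zeta>) \<inter> T (\<eta> \<union> \<zeta>) \<union> \<zeta>')) else 0))"
    proof (intro bern_exp_cong)
      fix \<eta> assume \<eta>: "\<eta> \<subseteq> D"
      have "bern_exp p (\<Lambda> - D) (\<lambda>\<zeta>. if T (\<eta> \<union> \<zeta>) = D
          then bern_exp p (\<Lambda> - T (\<eta> \<union> \<zeta>)) (\<lambda>\<zeta>'. F ((\<eta> \<union> \<zeta>) \<inter> T (\<eta> \<union> \<zeta>) \<union> \<zeta>')) else 0)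
        = bern_exp p (\<Lambda> - D) (\<lambda>\<zeta>. if T \<eta> = D then bern_exp p (\<Lambda> - D) (\<lambda>\<zeta>. F (\<eta> \<union> \<zeta>)) else 0)"
      proof (intro bern_exp_cong)
        fix \<zeta> assume \<zeta>: "\<zeta> \<subseteq> \<Lambda> - D"
        have "(\<eta> \<union> \<zeta>) \<inter> D = \<eta>" using \<eta> \<zeta> by auto
        then show "(if T (\<eta> \<union> \<zeta>) = D
          then bern_exp p (\<Lambda> - T (\<eta> \<union> \<zeta>)) (\<lambda>\<zeta>'. F ((\<eta> \<union> \<zeta>) \<inter> T (\<eta> \<union> \<zeta>) \<union> \<zeta>')) else 0)
          = (if T \<eta> = D then bern_exp p (\<Lambda> - D) (\<lambda>\<zeta>. F (\<eta> \<union> \<zeta>)) else 0)"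
          using T[OF \<eta> \<zeta>] by auto
      qed
      then show "(if T \<eta> = D then bern_exp p (\<Lambda> - D) (\<lambda>\<zeta>. F (\<eta> \<union> \<zeta>)) else 0)
        = bern_exp p (\<Lambda> - D) (\<lambda>\<zeta>. if T (\<eta> \<union> \<zeta>) = D
          then bern_exp p (\<Lambda> - T (\<eta> \<union> \<zeta>)) (\<lambda>\<zeta>'. F ((\<eta> \<union> \<zeta>) \<inter> T (\<eta> \<union> \<zeta>) \<union> \<zeta>')) else 0)"
        using finD by (simp add: bern_exp_const)
    qed
    also have "\<dots> = bern_exp p \<Lambda> (\<lambda>\<omega>. if T \<omega> = D then bern_exp p (\<Lambda> - T \<omega>) (\<lambda>\<zeta>. F (\<omega> \<inter> T \<omega> \<union> \<zeta>)) else 0)"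
      by (rule split[symmetric])
    finally show ?thesis .
  qed
  then show ?thesis by (subst (1 2) part) auto
qed

text \<open>Empty when x is closed. The relation checks only the end point of each step, since x is
  tested separately and later sites are end points.\<close>

definition site_cluster :: "('v \<Rightarrow> 'v \<Rightarrow> bool) \<Rightarrow> 'v set \<Rightarrow> 'v \<Rightarrow> 'v set" where
  "site_cluster nb \<omega> x = {y. x \<in> \<omega> \<and> (x, y) \<in> {(a, b). nb a b \<and> b \<in> \<omega>}\<^sup>*}"

text \<open>The state of y is not consulted: exits are counted before it is revealed, so each can
  start an independent further exploration.\<close>

definition exits :: "('v \<Rightarrow> 'v \<Rightarrow> bool) \<Rightarrow> 'v set \<Rightarrow> 'v set \<Rightarrow> 'v \<Rightarrow> 'v set" where
  "exits nb S \<omega> x = {y. y \<notin> S \<and> (\<exists>z\<in>site_cluster nb \<omega> x. nb z y)}"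

lemma site_cluster_self: "x \<in> \<omega> \<Longrightarrow> x \<in> site_cluster nb \<omega> x"
  by (simp add: site_cluster_def)

lemma site_cluster_step: "y \<in> site_cluster nb \<omega> x \<Longrightarrow> nb y z \<Longrightarrow> z \<in> \<omega> \<Longrightarrow> z \<in> site_cluster nb \<omega> x"
  by (auto simp: site_cluster_def intro: rtrancl_into_rtrancl)

lemma site_cluster_induct [consumes 1, case_names self step]:
  assumes "y \<in> site_cluster nb \<omega> x"
    and "x \<in> \<omega> \<Longrightarrow> P x"
    and "\<And>y z. y \<in> site_cluster nb \<omega> x \<Longrightarrow> P y \<Longrightarrow> nb y z \<Longrightarrow> z \<in> \<omega> \<Longrightarrow> P z"
  shows "P y"
proof -
  have x: "x \<in> \<omega>" and "(x, y) \<in> {(a, b). nb a b \<and> b \<in> \<omega>}\<^sup>*" using assms(1) by (auto simp: site_cluster_def)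
  from this(2) show ?thesis
  proof (induction rule: rtrancl_induct)
    case base
    show ?case using x by (rule assms(2))
  next
    case (step y z)
    then show ?case using x by (intro assms(3)[of y z]) (auto simp: site_cluster_def)
  qed
qed

lemma site_cluster_subset: "site_cluster nb \<omega> x \<subseteq> \<omega>"
proof
  fix y assume "y \<in> site_cluster nb \<omega> x"
  then show "y \<in> \<omega>" by (induction rule: site_cluster_induct) auto
qed

lemma site_cluster_mono: "\<omega> \<subseteq> \<omega>' \<Longrightarrow> site_cluster nb \<omega> x \<subseteq> site_cluster nb \<omega>' x"
proof
  fix y assume "y \<in> site_cluster nb \<omega> x" "\<omega> \<subseteq> \<omega>'"
  then show "y \<in> site_cluster nb \<omega>' x"
    by (induction rule: site_cluster_induct) (auto intro: site_cluster_self site_cluster_step)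
qed

lemma exits_mono: "\<omega> \<subseteq> \<omega>' \<Longrightarrow> exits nb S \<omega> x \<subseteq> exits nb S \<omega>' x"
  using site_cluster_mono[of \<omega> \<omega>' nb x] by (auto simp: exits_def)

lemma finite_exits:
  assumes "\<And>x. finite {y. nb x y}" "finite \<omega>"
  shows "finite (exits nb S \<omega> x)"
proof (rule finite_subset)
  show "exits nb S \<omega> x \<subseteq> (\<Union>z\<in>\<omega>. {y. nb z y})"
    using site_cluster_subset[of nb \<omega> x] by (auto simp: exits_def)
qed (use assms in auto)

text \<open>\<open>outer\<close> is the set of open sites connected to the complement of \<open>\<Lambda>\<close>. The sites of \<open>\<Lambda>\<close> outside it
  that are adjacent to it or to the complement are closed; \<open>enclosed\<close> is what remains. Given the
  enclosed set \<open>B\<close>, the states inside \<open>B\<close> are still independent, and every exit of the cluster of \<open>x\<close>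
  in \<open>B\<close> is pivotal for \<open>x\<close> being connected to the complement.\<close>

inductive_set outer :: "('v \<Rightarrow> 'v \<Rightarrow> bool) \<Rightarrow> 'v set \<Rightarrow> 'v set \<Rightarrow> 'v set"
  for nb \<Lambda> \<omega> where
    boundary: "x \<in> \<omega> \<Longrightarrow> nb x y \<Longrightarrow> y \<notin> \<Lambda> \<Longrightarrow> x \<in> outer nb \<Lambda> \<omega>"
  | inward: "x \<in> \<omega> \<Longrightarrow> nb x y \<Longrightarrow> y \<in> outer nb \<Lambda> \<omega> \<Longrightarrow> x \<in> outer nb \<Lambda> \<omega>"

definition enclosed :: "('v \<Rightarrow> 'v \<Rightarrow> bool) \<Rightarrow> 'v set \<Rightarrow> 'v set \<Rightarrow> 'v set" where
  "enclosed nb \<Lambda> \<omega> = {x \<in> \<Lambda>. x \<notin> outer nb \<Lambda> \<omega> \<and> (\<forall>y. nb x y \<longrightarrow> y \<in> \<Lambda> \<and> y \<notin> outer nb \<Lambda> \<omega>)}"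

lemma outer_mono: "\<omega> \<subseteq> \<omega>' \<Longrightarrow> outer nb \<Lambda> \<omega> \<subseteq> outer nb \<Lambda> \<omega>'"
proof
  fix x assume "x \<in> outer nb \<Lambda> \<omega>" "\<omega> \<subseteq> \<omega>'"
  then show "x \<in> outer nb \<Lambda> \<omega>'"
    by (induction rule: outer.induct) (auto intro: outer.intros)
qed

lemma outer_stopping:
  assumes agree: "\<omega> - enclosed nb \<Lambda> \<omega> = \<omega>' - enclosed nb \<Lambda> \<omega>"
  shows "outer nb \<Lambda> \<omega>' = outer nb \<Lambda> \<omega>"
proof
  show "outer nb \<Lambda> \<omega> \<subseteq> outer nb \<Lambda> \<omega>'"
  proof
    fix x assume "x \<in> outer nb \<Lambda> \<omega>"
    then show "x \<in> outer nb \<Lambda> \<omega>'"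
    proof (induction rule: outer.induct)
      case (boundary x y)
      then have "x \<notin> enclosed nb \<Lambda> \<omega>" by (auto simp: enclosed_def)
      then show ?case using boundary agree by (auto intro: outer.boundary)
    next
      case (inward x y)
      then have "x \<notin> enclosed nb \<Lambda> \<omega>" by (auto simp: enclosed_def)
      then show ?case using inward agree by (auto intro: outer.inward)
    qed
  qed
  show "outer nb \<Lambda> \<omega>' \<subseteq> outer nb \<Lambda> \<omega>"
  proof
    fix x assume "x \<in> outer nb \<Lambda> \<omega>'"
    then show "x \<in> outer nb \<Lambda> \<omega>"
    proof (induction rule: outer.induct)
      case (boundary x y)
      then have "x \<notin> enclosed nb \<Lambda> \<omega>" by (auto simp: enclosed_def)
      then show ?case using boundary agree by (auto intro: outer.boundary)
    next
      case (inward x y)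
      then have "x \<notin> enclosed nb \<Lambda> \<omega>" by (auto simp: enclosed_def)
      then show ?case using inward agree by (auto intro: outer.inward)
    qed
  qed
qed

text \<open>An exit y is adjacent to an enclosed site, so it is in \<Lambda> and not outer; not
  being enclosed itself, it has a neighbour that is outer or outside \<Lambda>. Opening y makes it
  outer, and the cluster path hands this back to x.\<close>

lemma exit_pivotal:
  assumes y: "y \<in> exits nb (enclosed nb \<Lambda> \<omega>) (\<omega> \<inter> enclosed nb \<Lambda> \<omega>) x"
  shows "y \<in> \<Lambda>" "x \<in> outer nb \<Lambda> (insert y \<omega>)"
proof -
  let ?S = "enclosed nb \<Lambda> \<omega>"
  obtain z where z: "z \<in> site_cluster nb (\<omega> \<inter> ?S) x" "nb z y" and yS: "y \<notin> ?S"
    using y by (auto simp: exits_def)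
  have "z \<in> ?S" using z(1) site_cluster_subset[of nb "\<omega> \<inter> ?S" x] by auto
  then show y\<Lambda>: "y \<in> \<Lambda>" using z(2) by (auto simp: enclosed_def)
  have "y \<notin> outer nb \<Lambda> \<omega>" using z(2) \<open>z \<in> ?S\<close> by (auto simp: enclosed_def)
  then obtain w where "nb y w" "w \<notin> \<Lambda> \<or> w \<in> outer nb \<Lambda> \<omega>" using yS y\<Lambda> by (auto simp: enclosed_def)
  then have y_out: "y \<in> outer nb \<Lambda> (insert y \<omega>)"
    using outer_mono[of \<omega> "insert y \<omega>" nb \<Lambda>] by (auto intro: outer.intros)
  \<comment> \<open>An implication, because the induction walks from x towards z while the
    connection is propagated from z back to x.\<close>
  have path: "z \<in> outer nb \<Lambda> (insert y \<omega>) \<longrightarrow> x \<in> outer nb \<Lambda> (insert y \<omega>)"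
    using z(1)
  proof (induction rule: site_cluster_induct)
    case (step u v)
    then have "u \<in> \<omega>" using site_cluster_subset[of nb "\<omega> \<inter> ?S" x] by auto
    then show ?case using step by (auto intro: outer.inward)
  qed simp
  have "z \<in> insert y \<omega>" using z(1) site_cluster_subset[of nb "\<omega> \<inter> ?S" x] by auto
  then show "x \<in> outer nb \<Lambda> (insert y \<omega>)"
    using path z(2) y_out by (auto intro: outer.inward)
qed

lemma closed_boundary_pivotal:
  assumes "x \<in> \<Lambda>" "x \<notin> enclosed nb \<Lambda> \<omega>" "x \<notin> outer nb \<Lambda> \<omega>"
  shows "x \<in> outer nb \<Lambda> (insert x \<omega>)"
proof -
  obtain w where "nb x w" "w \<notin> \<Lambda> \<or> w \<in> outer nb \<Lambda> \<omega>" using assms by (auto simp: enclosed_def)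
  then show ?thesis
    using outer_mono[of \<omega> "insert x \<omega>" nb \<Lambda>] by (auto intro: outer.intros)
qed

text \<open>Combined with \<open>Russo_formula\<close> this is the differential inequality \<theta>'
  \<ge> 1 - \<theta>: when x is not connected to the complement, the conditional mean number of
  pivotal sites given the enclosed set is at least 1.\<close>

lemma pivotal_sum_ge:
  assumes fin: "\<And>x. finite {y. nb x y}" "finite \<Lambda>" and "x \<in> \<Lambda>" and q: "0 \<le> q" "q \<le> 1"
    and ge1: "\<And>S. S \<subseteq> \<Lambda> \<Longrightarrow> x \<in> S \<Longrightarrow> 1 \<le> bern_exp q S (\<lambda>\<omega>. real (card (exits nb S \<omega> x)))"
  shows "1 - bern_exp q \<Lambda> (\<lambda>\<omega>. of_bool (x \<in> outer nb \<Lambda> \<omega>)) \<le>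
    (\<Sum>b\<in>\<Lambda>. bern_exp q \<Lambda> (\<lambda>\<omega>. of_bool (x \<in> outer nb \<Lambda> (insert b \<omega>)) - of_bool (x \<in> outer nb \<Lambda> (\<omega> - {b}))))"
proof -
  let ?S = "enclosed nb \<Lambda>" and ?U = "outer nb \<Lambda>"
  let ?A = "\<lambda>\<omega>. of_bool (x \<in> outer nb \<Lambda> \<omega>) :: real"
  \<comment> \<open>A lower bound for the number of pivotal sites when x is not outer. If x is
    enclosed, all its exits are pivotal; otherwise x is a closed site on the boundary of the
    enclosed set and is itself pivotal, whence the value 1.\<close>
  define G where "G \<omega> = (if x \<in> ?U \<omega> then 0 else if x \<in> ?S \<omega>
      then real (card (exits nb (?S \<omega>) (\<omega> \<inter> ?S \<omega>) x)) else 1)" for \<omega>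
  have S\<Lambda>: "?S \<omega> \<subseteq> \<Lambda>" for \<omega> by (auto simp: enclosed_def)
  have "1 - bern_exp q \<Lambda> ?A = bern_exp q \<Lambda> (\<lambda>\<omega>. 1 - ?A \<omega>)"
    using fin by (simp add: bern_exp_diff bern_exp_const)
  also have "\<dots> \<le> bern_exp q \<Lambda> (\<lambda>\<omega>. bern_exp q (\<Lambda> - (\<Lambda> - ?S \<omega>)) (\<lambda>\<zeta>. G (\<omega> \<inter> (\<Lambda> - ?S \<omega>) \<union> \<zeta>)))"
  proof (intro bern_exp_mono q)
    fix \<omega> assume \<omega>: "\<omega> \<subseteq> \<Lambda>"
    have e: "\<Lambda> - (\<Lambda> - ?S \<omega>) = ?S \<omega>" using S\<Lambda> by auto
    have G: "G (\<omega> \<inter> (\<Lambda> - ?S \<omega>) \<union> \<zeta>) = (if x \<in> ?U \<omega> then 0 else if x \<in> ?S \<omega>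
      then real (card (exits nb (?S \<omega>) \<zeta> x)) else 1)" if \<zeta>: "\<zeta> \<subseteq> ?S \<omega>" for \<zeta>
    proof -
      let ?\<omega>' = "\<omega> \<inter> (\<Lambda> - ?S \<omega>) \<union> \<zeta>"
      have "?U ?\<omega>' = ?U \<omega>" by (rule outer_stopping) (use \<omega> \<zeta> in auto)
      moreover from this have "?S ?\<omega>' = ?S \<omega>" by (simp add: enclosed_def)
      moreover have "?\<omega>' \<inter> ?S \<omega> = \<zeta>" using \<zeta> by auto
      ultimately show ?thesis by (simp add: G_def)
    qed
    have "bern_exp q (?S \<omega>) (\<lambda>\<zeta>. G (\<omega> \<inter> (\<Lambda> - ?S \<omega>) \<union> \<zeta>)) = bern_exp q (?S \<omega>) (\<lambda>\<zeta>. if x \<in> ?U \<omega> then 0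
      else if x \<in> ?S \<omega> then real (card (exits nb (?S \<omega>) \<zeta> x)) else 1)"
      by (intro bern_exp_cong G)
    moreover have "finite (?S \<omega>)" using S\<Lambda> fin(2) finite_subset by blast
    ultimately show "1 - ?A \<omega> \<le> bern_exp q (\<Lambda> - (\<Lambda> - ?S \<omega>)) (\<lambda>\<zeta>. G (\<omega> \<inter> (\<Lambda> - ?S \<omega>) \<union> \<zeta>))"
      using ge1[OF S\<Lambda>[of \<omega>]] unfolding e
      by (cases "x \<in> ?U \<omega>"; cases "x \<in> ?S \<omega>") (simp_all add: bern_exp_const)
  qed
  also have "\<dots> = bern_exp q \<Lambda> G"
  \<comment> \<open>The revealed region is the complement of the enclosed set; given it, the states
    inside are fresh and the hypothesis on \<open>exits\<close> applies to them.\<close>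
  proof (rule bern_exp_stopping[symmetric])
    fix \<omega> \<omega>' assume w: "\<omega> \<subseteq> \<Lambda>" "\<omega>' \<subseteq> \<Lambda>" "\<omega> \<inter> (\<Lambda> - ?S \<omega>) = \<omega>' \<inter> (\<Lambda> - ?S \<omega>)"
    have "\<omega> - ?S \<omega> = \<omega>' - ?S \<omega>" using w by blast
    then have "?U \<omega>' = ?U \<omega>" by (rule outer_stopping)
    then show "\<Lambda> - ?S \<omega>' = \<Lambda> - ?S \<omega>" by (simp add: enclosed_def)
  qed (use fin in auto)
  also have "\<dots> \<le> bern_exp q \<Lambda> (\<lambda>\<omega>. \<Sum>b\<in>\<Lambda>. ?A (insert b \<omega>) - ?A (\<omega> - {b}))"
  proof (intro bern_exp_mono q)
    fix \<omega> assume \<omega>: "\<omega> \<subseteq> \<Lambda>"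
    have nonneg: "?A (insert b \<omega>) - ?A (\<omega> - {b}) \<ge> 0" for b
      using outer_mono[of "\<omega> - {b}" "insert b \<omega>" nb \<Lambda>] by auto
    show "G \<omega> \<le> (\<Sum>b\<in>\<Lambda>. ?A (insert b \<omega>) - ?A (\<omega> - {b}))"
    proof (cases "x \<in> ?U \<omega>")
      case True
      then show ?thesis by (simp add: G_def) (intro sum_nonneg nonneg)
    next
      case False
      have z: "?A (\<omega> - {b}) = 0" for b
        using False outer_mono[of "\<omega> - {b}" \<omega> nb \<Lambda>] by auto
      have "(\<Sum>b\<in>\<Lambda>. ?A (insert b \<omega>) - ?A (\<omega> - {b})) = real (card {b\<in>\<Lambda>. x \<in> ?U (insert b \<omega>)})"
        using fin(2) by (simp add: z) (simp add: of_bool_def sum.If_cases Int_def)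
      moreover have "G \<omega> \<le> real (card {b\<in>\<Lambda>. x \<in> ?U (insert b \<omega>)})"
      proof (cases "x \<in> ?S \<omega>")
        case True
        have "card (exits nb (?S \<omega>) (\<omega> \<inter> ?S \<omega>) x) \<le> card {b\<in>\<Lambda>. x \<in> ?U (insert b \<omega>)}"
          using fin(2) exit_pivotal[of _ nb \<Lambda> \<omega> x] by (intro card_mono) auto
        then show ?thesis using False True by (simp add: G_def)
      next
        case xS: False
        have "card {x} \<le> card {b\<in>\<Lambda>. x \<in> ?U (insert b \<omega>)}"
          using fin(2) closed_boundary_pivotal[OF \<open>x \<in> \<Lambda>\<close> xS False] \<open>x \<in> \<Lambda>\<close> by (intro card_mono) auto
        then show ?thesis using False xS by (simp add: G_def)
      qed
      ultimately show ?thesis by simp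
    qed
  qed
  finally show ?thesis by (simp only: bern_exp_sum)
qed

text \<open>Integration of \<theta>' \<ge> 1 - \<theta>: the function (1 - \<theta> r) exp r is
  nonincreasing on [p, q] and at most exp p at the left end. The lower bound on exits is assumed at
  p only; it persists for larger parameters because exits increase with the configuration.\<close>

lemma outer_probability_ge:
  assumes fin: "\<And>x. finite {y. nb x y}" "finite \<Lambda>" and "x \<in> \<Lambda>" and pq: "0 \<le> p" "p \<le> q" "q \<le> 1"
    and ge1: "\<And>S. finite S \<Longrightarrow> x \<in> S \<Longrightarrow> 1 \<le> bern_exp p S (\<lambda>\<omega>. real (card (exits nb S \<omega> x)))"
  shows "1 - exp (p - q) \<le> bern_exp q \<Lambda> (\<lambda>\<omega>. of_bool (x \<in> outer nb \<Lambda> \<omega>))"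
proof -
  let ?A = "\<lambda>\<omega>. of_bool (x \<in> outer nb \<Lambda> \<omega>) :: real"
  define g where "g r = (1 - bern_exp r \<Lambda> ?A) * exp r" for r
  have ge1': "1 \<le> bern_exp r S (\<lambda>\<omega>. real (card (exits nb S \<omega> x)))"
    if "S \<subseteq> \<Lambda>" "x \<in> S" "p \<le> r" "r \<le> 1" for S r
  proof -
    have "finite S" using that fin(2) finite_subset by blast
    moreover have "card (exits nb S \<omega> x) \<le> card (exits nb S \<omega>' x)" if "\<omega> \<subseteq> \<omega>'" "\<omega>' \<subseteq> S" for \<omega> \<omega>'
      using that \<open>finite S\<close> by (intro card_mono finite_exits fin(1) exits_mono) (auto intro: finite_subset)
    ultimately show ?thesis
      using ge1[of S] bern_exp_mono_p[of S p r "\<lambda>\<omega>. real (card (exits nb S \<omega> x))"] that pq by force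
  qed
  have "g q \<le> g p"
  proof (rule DERIV_nonpos_imp_nonincreasing[OF pq(2)])
    fix r assume r: "p \<le> r" "r \<le> q"
    let ?d = "\<Sum>b\<in>\<Lambda>. bern_exp r \<Lambda> (\<lambda>\<omega>. ?A (insert b \<omega>) - ?A (\<omega> - {b}))"
    have "(g has_real_derivative (1 - bern_exp r \<Lambda> ?A) * exp r - ?d * exp r) (at r)"
      unfolding g_def by (rule derivative_eq_intros Russo_formula fin(2) refl)+ simp
    moreover have "1 - bern_exp r \<Lambda> ?A \<le> ?d"
      using r pq by (intro pivotal_sum_ge fin \<open>x \<in> \<Lambda>\<close> ge1') auto
    then have "(1 - bern_exp r \<Lambda> ?A) * exp r - ?d * exp r \<le> 0"
      by (simp flip: left_diff_distrib add: mult_nonpos_nonneg)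
    ultimately show "\<exists>y. (g has_real_derivative y) (at r) \<and> y \<le> 0" by blast
  qed
  moreover have "0 \<le> bern_exp p \<Lambda> ?A"
    using bern_exp_mono[of p \<Lambda> "\<lambda>_. 0" ?A] pq fin(2) by (simp add: bern_exp_const)
  then have "g p \<le> exp p" by (simp add: g_def)
  ultimately have "1 - bern_exp q \<Lambda> ?A \<le> exp p / exp q" by (simp add: g_def field_simps)
  then show ?thesis by (simp add: exp_diff)
qed

lemma outer_imp_site_cluster_boundary:
  assumes "x \<in> outer nb \<Lambda> \<omega>"
  shows "\<exists>y z. y \<in> site_cluster nb \<omega> x \<and> nb y z \<and> z \<notin> \<Lambda>"
  using assms
proof (induction rule: outer.induct)
  case (boundary x y)
  then show ?case by (auto intro: site_cluster_self)
next
  case (inward x y)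
  then obtain u v where uv: "u \<in> site_cluster nb \<omega> y" "nb u v" "v \<notin> \<Lambda>" by blast
  have "u \<in> site_cluster nb \<omega> x"
    using uv(1) inward by (induction rule: site_cluster_induct) (auto intro: site_cluster_self site_cluster_step)
  with uv show ?case by blast
qed

section \<open>Exponential decay from a subcritical block\<close>

text \<open>\<open>T \<omega>\<close> is what a search for the cluster of x inside S inspects: x,
  the cluster, and its neighbours in S. The site x is included even if closed, so each exploration
  uses up at least one site.\<close>

lemma exploration_stopping:
  fixes nb S x
  defines "C \<equiv> \<lambda>\<omega>. site_cluster nb (\<omega> \<inter> S) x"
  defines "T \<equiv> \<lambda>\<omega>. insert x {z \<in> S. z \<in> C \<omega> \<or> (\<exists>w\<in>C \<omega>. nb w z)}"
  assumes "x \<in> S" and agree: "\<omega> \<inter> T \<omega> = \<omega>' \<inter> T \<omega>"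
  shows "C \<omega>' = C \<omega>"
proof
  have CT: "C \<omega> \<subseteq> \<omega> \<inter> T \<omega>"
    using site_cluster_subset[of nb "\<omega> \<inter> S" x] by (auto simp: C_def T_def)
  show "C \<omega> \<subseteq> C \<omega>'"
  proof
    fix y assume "y \<in> C \<omega>"
    then show "y \<in> C \<omega>'"
      unfolding C_def
    proof (induction rule: site_cluster_induct)
      case self
      then have "x \<in> \<omega>'" using agree by (auto simp: T_def)
      then show ?case using \<open>x \<in> S\<close> by (intro site_cluster_self) auto
    next
      case (step y z)
      then have "z \<in> C \<omega>" unfolding C_def by (rule_tac site_cluster_step[of y])
      then have "z \<in> \<omega>'" using CT agree by auto
      then show ?case using step by (rule_tac site_cluster_step[of y]) auto
    qed
  qed
  show "C \<omega>' \<subseteq> C \<omega>"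
  proof
    fix y assume "y \<in> C \<omega>'"
    then show "y \<in> C \<omega>"
      unfolding C_def
    proof (induction rule: site_cluster_induct)
      case self
      then have "x \<in> \<omega>" using agree by (auto simp: T_def)
      then show ?case using \<open>x \<in> S\<close> by (intro site_cluster_self) auto
    next
      case (step y z)
      then have "z \<in> T \<omega>" by (auto simp: T_def C_def)
      then have "z \<in> \<omega>" using step agree by auto
      then show ?case using step by (rule_tac site_cluster_step[of y]) auto
    qed
  qed
qed

text \<open>After exploring from x, whatever is reachable from Y is either already in C or reachable
  through unexplored sites from the remaining starting points and the exits of C.\<close>

lemma exploration_cover:
  fixes nb S x \<omega>
  defines "C \<equiv> site_cluster nb (\<omega> \<inter> S) x"
  defines "T \<equiv> insert x {z \<in> S. z \<in> C \<or> (\<exists>w\<in>C. nb w z)}"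
  assumes "x \<in> S" "S \<subseteq> \<Lambda>" "\<omega> \<subseteq> \<Lambda>" and \<zeta>: "\<zeta> \<subseteq> \<Lambda> - T"
  shows "(\<Union>y\<in>Y. site_cluster nb (\<omega> \<inter> T \<union> \<zeta>) y) \<subseteq>
    C \<union> (\<Union>y\<in>(Y - {x}) \<union> {y \<in> \<Lambda>. y \<notin> S \<and> (\<exists>z\<in>C. nb z y)}. site_cluster nb \<zeta> y)"
proof -
  let ?E = "{y \<in> \<Lambda>. y \<notin> S \<and> (\<exists>z\<in>C. nb z y)}"
  \<comment> \<open>Inspected open sites belong to C: an open neighbour of C inside S would have
    joined it.\<close>
  have \<omega>T: "\<omega> \<inter> T \<subseteq> C"
  proof
    fix z assume z: "z \<in> \<omega> \<inter> T"
    show "z \<in> C"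
    proof (cases "z = x")
      case True
      then have "x \<in> \<omega> \<inter> S" using z \<open>x \<in> S\<close> by auto
      then show ?thesis unfolding C_def True by (rule site_cluster_self)
    next
      case False
      then show ?thesis using z unfolding T_def C_def by (auto intro: site_cluster_step)
    qed
  qed
  have "u \<in> C \<union> (\<Union>y\<in>(Y - {x}) \<union> ?E. site_cluster nb \<zeta> y)"
    if u: "u \<in> site_cluster nb (\<omega> \<inter> T \<union> \<zeta>) y" and y: "y \<in> Y" for u y
    using u
  proof (induction rule: site_cluster_induct)
    case self
    show ?case
    proof (cases "y \<in> \<zeta>")
      case True
      then have "y \<noteq> x" using \<zeta> by (auto simp: T_def)
      then show ?thesis using True y site_cluster_self[of y \<zeta> nb] by auto
    next
      case False
      then show ?thesis using self \<omega>T by auto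
    qed
  next
    case (step v w)
    show ?case
    proof (cases "w \<in> \<zeta>")
      case True
      show ?thesis
      proof (cases "v \<in> C")
        case True
        have "w \<notin> S" using \<open>w \<in> \<zeta>\<close> \<zeta> True \<open>nb v w\<close> by (auto simp: T_def)
        then have "w \<in> ?E" using \<open>w \<in> \<zeta>\<close> \<zeta> True \<open>nb v w\<close> by auto
        then show ?thesis using site_cluster_self[OF \<open>w \<in> \<zeta>\<close>, of nb] by blast
      next
        case False
        then obtain y' where "y' \<in> (Y - {x}) \<union> ?E" "v \<in> site_cluster nb \<zeta> y'" using step by blast
        then show ?thesis using site_cluster_step[of v nb \<zeta> y' w] \<open>nb v w\<close> \<open>w \<in> \<zeta>\<close> by blast
      qed
    next
      case False
      then show ?thesis using step \<omega>T by auto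
    qed
  qed
  then show ?thesis by blast
qed

text \<open>Comparison with a branching process: x is traded for the exits of its block, each later
  costing a factor m, while the explored part costs at most exp (h * card (block x)).
  \<open>bound\<close> says that the trade does not raise the expectation. A union over a set Y of
  starting points keeps overlapping clusters from mattering, and induction runs on the unexplored
  region.\<close>

lemma exp_cluster_bound:
  fixes X :: "'v set" and block :: "'v \<Rightarrow> 'v set" and p m h :: real
  assumes nbfin: "\<And>x. finite {y. nb x y}"
    and p: "0 \<le> p" "p \<le> 1" and m: "1 \<le> m" and h: "0 \<le> h"
    and block: "\<And>x. x \<in> X \<Longrightarrow> finite (block x)" "\<And>x. x \<in> X \<Longrightarrow> x \<in> block x"
    and bound: "\<And>x. x \<in> X \<Longrightarrow>
      exp (h * card (block x)) * bern_exp p (block x) (\<lambda>\<omega>. m ^ card (exits nb (block x) \<omega> x)) \<le> m"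
  shows "finite \<Lambda> \<Longrightarrow> \<Lambda> \<subseteq> X \<Longrightarrow> finite Y \<Longrightarrow>
    bern_exp p \<Lambda> (\<lambda>\<omega>. exp (h * card (\<Union>y\<in>Y. site_cluster nb \<omega> y))) \<le> m ^ card Y"
proof (induction "card \<Lambda>" arbitrary: \<Lambda> Y rule: less_induct)
  case less
  note fin = less.prems(1,3)
  show ?case
  proof (cases "Y \<inter> \<Lambda> = {}")
    case True
    have "bern_exp p \<Lambda> (\<lambda>\<omega>. exp (h * card (\<Union>y\<in>Y. site_cluster nb \<omega> y))) = bern_exp p \<Lambda> (\<lambda>\<omega>. 1)"
    proof (rule bern_exp_cong)
      fix \<omega> assume "\<omega> \<subseteq> \<Lambda>"
      then have "site_cluster nb \<omega> y = {}" if "y \<in> Y" for y using True that by (auto simp: site_cluster_def)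
      then have "(\<Union>y\<in>Y. site_cluster nb \<omega> y) = {}" by blast
      then show "exp (h * card (\<Union>y\<in>Y. site_cluster nb \<omega> y)) = 1" by simp
    qed
    then show ?thesis using fin m by (simp add: bern_exp_const one_le_power)
  next
    case False
    then obtain x where x: "x \<in> Y" "x \<in> \<Lambda>" by auto
    then have xX: "x \<in> X" using less.prems by auto
    \<comment> \<open>Only the part of the block not yet explored is available; the comparison with
      the full block, where \<open>bound\<close> holds, is made at the end by monotonicity.\<close>
    define S where "S = block x \<inter> \<Lambda>"
    have S: "x \<in> S" "S \<subseteq> \<Lambda>" using x block(2)[OF xX] by (auto simp: S_def)
    define C where "C \<omega> = site_cluster nb (\<omega> \<inter> S) x" for \<omega>
    define T where "T \<omega> = insert x {z \<in> S. z \<in> C \<omega> \<or> (\<exists>w\<in>C \<omega>. nb w z)}" for \<omega>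
    define E where "E \<omega> = {y \<in> \<Lambda>. y \<notin> S \<and> (\<exists>z\<in>C \<omega>. nb z y)}" for \<omega>
    let ?F = "\<lambda>\<omega>. exp (h * card (\<Union>y\<in>Y. site_cluster nb \<omega> y))"
    let ?K = "exp (h * card (block x)) * m ^ (card Y - 1)"
    let ?g = "\<lambda>\<omega>. m ^ card (exits nb (block x) \<omega> x)"
    have T\<Lambda>: "T \<omega> \<subseteq> \<Lambda>" for \<omega> using S by (auto simp: T_def)
    have "bern_exp p \<Lambda> ?F = bern_exp p \<Lambda> (\<lambda>\<omega>. bern_exp p (\<Lambda> - T \<omega>) (\<lambda>\<zeta>. ?F (\<omega> \<inter> T \<omega> \<union> \<zeta>)))"
    proof (rule bern_exp_stopping[OF fin(1) T\<Lambda>])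
      fix \<omega> \<omega>' assume "\<omega> \<inter> T \<omega> = \<omega>' \<inter> T \<omega>"
      then have "C \<omega>' = C \<omega>"
        unfolding C_def T_def using exploration_stopping[OF S(1), of \<omega> nb \<omega>'] by simp
      then show "T \<omega>' = T \<omega>" by (simp add: T_def)
    qed
    also have "\<dots> \<le> bern_exp p \<Lambda> (\<lambda>\<omega>. ?K * ?g (\<omega> \<inter> block x \<inter> \<Lambda>))"
    proof (intro bern_exp_mono p)
      fix \<omega> assume \<omega>: "\<omega> \<subseteq> \<Lambda>"
      let ?Y = "(Y - {x}) \<union> E \<omega>"
      have finC: "finite (C \<omega>)" and CS: "C \<omega> \<subseteq> block x"
        using site_cluster_subset[of nb "\<omega> \<inter> S" x] block(1)[OF xX] S_def by (auto simp: C_def intro: finite_subset)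
      have finY: "finite ?Y" using fin by (auto simp: E_def)
      have "bern_exp p (\<Lambda> - T \<omega>) (\<lambda>\<zeta>. ?F (\<omega> \<inter> T \<omega> \<union> \<zeta>))
          \<le> bern_exp p (\<Lambda> - T \<omega>) (\<lambda>\<zeta>. exp (h * card (block x)) * exp (h * card (\<Union>y\<in>?Y. site_cluster nb \<zeta> y)))"
      proof (intro bern_exp_mono p)
        fix \<zeta> assume \<zeta>: "\<zeta> \<subseteq> \<Lambda> - T \<omega>"
        have fz: "finite (\<Union>y\<in>?Y. site_cluster nb \<zeta> y)"
          using \<zeta> fin(1) site_cluster_subset[of nb \<zeta>] by (auto intro!: finite_subset[of _ \<Lambda>])
        have "(\<Union>y\<in>Y. site_cluster nb (\<omega> \<inter> T \<omega> \<union> \<zeta>) y) \<subseteq> C \<omega> \<union> (\<Union>y\<in>?Y. site_cluster nb \<zeta> y)"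
          unfolding C_def T_def E_def
          by (rule exploration_cover) (use S \<omega> \<zeta> in \<open>auto simp: C_def T_def\<close>)
        then have "card (\<Union>y\<in>Y. site_cluster nb (\<omega> \<inter> T \<omega> \<union> \<zeta>) y) \<le> card (C \<omega> \<union> (\<Union>y\<in>?Y. site_cluster nb \<zeta> y))"
          using fz finC by (intro card_mono) auto
        also have "\<dots> \<le> card (C \<omega>) + card (\<Union>y\<in>?Y. site_cluster nb \<zeta> y)" by (rule card_Un_le)
        also have "card (C \<omega>) \<le> card (block x)" using CS block(1)[OF xX] by (rule card_mono[rotated])
        finally have "h * card (\<Union>y\<in>Y. site_cluster nb (\<omega> \<inter> T \<omega> \<union> \<zeta>) y)
            \<le> h * real (card (block x) + card (\<Union>y\<in>?Y. site_cluster nb \<zeta> y))"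
          using h by (intro mult_left_mono) linarith+
        then show "?F (\<omega> \<inter> T \<omega> \<union> \<zeta>) \<le> exp (h * card (block x)) * exp (h * card (\<Union>y\<in>?Y. site_cluster nb \<zeta> y))"
          by (simp add: distrib_left flip: exp_add)
      qed
      also have "\<dots> \<le> exp (h * card (block x)) * m ^ card ?Y"
        unfolding bern_exp_cmult
      proof (intro mult_left_mono less.hyps finY)
        show "card (\<Lambda> - T \<omega>) < card \<Lambda>"
          using fin(1) x(2) by (intro psubset_card_mono) (auto simp: T_def)
      qed (use less.prems in auto)
      also have "m ^ card ?Y \<le> m ^ ((card Y - 1) + card (exits nb (block x) (\<omega> \<inter> block x \<inter> \<Lambda>) x))"
      proof (rule power_increasing[OF _ m])
        \<comment> \<open>A site of \<Lambda> outside S is outside the whole block, so new starting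
          points are genuine exits of \<open>block x\<close>.\<close>
        have "E \<omega> \<subseteq> exits nb (block x) (\<omega> \<inter> block x \<inter> \<Lambda>) x"
          using site_cluster_mono[of "\<omega> \<inter> S" "\<omega> \<inter> block x \<inter> \<Lambda>" nb x] by (auto simp: E_def exits_def C_def S_def)
        then have "card (E \<omega>) \<le> card (exits nb (block x) (\<omega> \<inter> block x \<inter> \<Lambda>) x)"
          using block(1)[OF xX] by (intro card_mono finite_exits nbfin) auto
        moreover have "card ?Y \<le> card (Y - {x}) + card (E \<omega>)" by (rule card_Un_le)
        moreover have "card (Y - {x}) = card Y - 1" using x fin by simp
        ultimately show "card ?Y \<le> (card Y - 1) + card (exits nb (block x) (\<omega> \<inter> block x \<inter> \<Lambda>) x)" by simp
      qed
      finally show "bern_exp p (\<Lambda> - T \<omega>) (\<lambda>\<zeta>. ?F (\<omega> \<inter> T \<omega> \<union> \<zeta>)) \<le> ?K * ?g (\<omega> \<inter> block x \<inter> \<Lambda>)"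
        by (simp add: power_add mult.assoc)
    qed
    also have "\<dots> = ?K * bern_exp p S ?g"
    proof -
      have "bern_exp p \<Lambda> (\<lambda>\<omega>. ?g (\<omega> \<inter> block x \<inter> \<Lambda>)) = bern_exp p \<Lambda> (\<lambda>\<omega>. ?g (\<omega> \<inter> S))"
        by (simp add: S_def Int_assoc)
      then show ?thesis using bern_exp_restrict[OF fin(1) S(2), of p ?g] by (simp only: bern_exp_cmult)
    qed
    also have "bern_exp p S ?g \<le> bern_exp p (block x) ?g"
    proof -
      have "bern_exp p S ?g = bern_exp p (block x) (\<lambda>\<omega>. ?g (\<omega> \<inter> S))"
        using bern_exp_restrict[OF block(1)[OF xX], of S p ?g] by (simp add: S_def)
      also have "\<dots> \<le> bern_exp p (block x) ?g"
        using block(1)[OF xX] by (intro bern_exp_mono p power_increasing[OF _ m] card_mono finite_exits nbfin exits_mono)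
          (auto intro: finite_subset)
      finally show ?thesis .
    qed
    then have "?K * bern_exp p S ?g \<le> ?K * bern_exp p (block x) ?g"
      using m by (intro mult_left_mono) auto
    also have "\<dots> = m ^ (card Y - 1) * (exp (h * card (block x)) * bern_exp p (block x) ?g)" by simp
    also have "\<dots> \<le> m ^ (card Y - 1) * m"
      using m by (intro mult_left_mono bound xX) auto
    also have "\<dots> = m ^ card Y"
    proof -
      have "card Y = Suc (card Y - 1)" using x fin card_gt_0_iff[of Y] by auto
      then show ?thesis by (metis power_Suc2)
    qed
    finally show ?thesis .
  qed
qed

text \<open>The function E(m^N) - m vanishes at m = 1 with derivative E(N) - 1 < 0, so it is
  negative slightly to the right of 1. The strict inequality leaves room for a small h by
  continuity, and finiteness of \<open>R\<close> lets one pair (m, h) serve all r.\<close>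

lemma exists_growth_parameters:
  fixes R :: "'v set" and p :: real
  assumes "finite R" and S: "\<And>r. r \<in> R \<Longrightarrow> finite (S r)"
    and lt1: "\<And>r. r \<in> R \<Longrightarrow> bern_exp p (S r) (\<lambda>\<omega>. real (N r \<omega>)) < 1"
  obtains m h :: real where "1 < m" "0 < h"
    "\<And>r. r \<in> R \<Longrightarrow> exp (h * card (S r)) * bern_exp p (S r) (\<lambda>\<omega>. m ^ N r \<omega>) \<le> m"
proof -
  have "\<forall>\<^sub>F m in at_right 1. \<forall>r\<in>R. bern_exp p (S r) (\<lambda>\<omega>. m ^ N r \<omega>) < m"
  proof (subst eventually_ball_finite_distrib[OF assms(1)], intro ballI)
    fix r assume r: "r \<in> R"
    define g where "g m = bern_exp p (S r) (\<lambda>\<omega>. m ^ N r \<omega>) - m" for m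
    have "(g has_real_derivative bern_exp p (S r) (\<lambda>\<omega>. real (N r \<omega>)) - 1) (at 1)"
      unfolding g_def bern_exp_def
      by (auto intro!: derivative_eq_intros sum.cong)
    then have "\<exists>d>0. \<forall>h>0. h < d \<longrightarrow> g (1 + h) < g 1"
      by (rule DERIV_neg_dec_right) (use lt1[OF r] in simp)
    then obtain d where d: "d > 0" "\<And>h. h > 0 \<Longrightarrow> h < d \<Longrightarrow> g (1 + h) < g 1"
      by blast
    have "g 1 = 0" using S[OF r] by (simp add: g_def bern_exp_const)
    then have "bern_exp p (S r) (\<lambda>\<omega>. m ^ N r \<omega>) < m" if "1 < m" "m < 1 + d" for m
      using d(2)[of "m - 1"] that by (simp add: g_def)
    then show "\<forall>\<^sub>F m in at_right 1. bern_exp p (S r) (\<lambda>\<omega>. m ^ N r \<omega>) < m"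
      using d(1) by (auto simp: eventually_at_right_field intro!: exI[of _ "1 + d"])
  qed
  then have "\<forall>\<^sub>F m in at_right 1. (\<forall>r\<in>R. bern_exp p (S r) (\<lambda>\<omega>. m ^ N r \<omega>) < m) \<and> 1 < m"
    using eventually_at_right_less by (rule eventually_conj)
  from eventually_happens'[OF trivial_limit_at_right_real this] obtain m :: real where m: "1 < m" "\<And>r. r \<in> R \<Longrightarrow> bern_exp p (S r) (\<lambda>\<omega>. m ^ N r \<omega>) < m"
    by blast
  have "\<forall>\<^sub>F h in at_right (0::real). \<forall>r\<in>R. exp (h * card (S r)) * bern_exp p (S r) (\<lambda>\<omega>. m ^ N r \<omega>) < m"
  proof (subst eventually_ball_finite_distrib[OF assms(1)], intro ballI)
    fix r assume r: "r \<in> R"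
    have "((\<lambda>h::real. exp (h * card (S r)) * bern_exp p (S r) (\<lambda>\<omega>. m ^ N r \<omega>)) \<longlongrightarrow>
        exp ((0::real) * card (S r)) * bern_exp p (S r) (\<lambda>\<omega>. m ^ N r \<omega>)) (at_right 0)"
      by (intro tendsto_intros)
    then show "\<forall>\<^sub>F h in at_right (0::real). exp (h * card (S r)) * bern_exp p (S r) (\<lambda>\<omega>. m ^ N r \<omega>) < m"
      by (rule order_tendstoD(2)) (use m(2)[OF r] in simp)
  qed
  then have "\<forall>\<^sub>F h in at_right (0::real). (\<forall>r\<in>R. exp (h * card (S r)) * bern_exp p (S r) (\<lambda>\<omega>. m ^ N r \<omega>) < m) \<and> 0 < h"
    using eventually_at_right_less by (rule eventually_conj)
  from eventually_happens'[OF trivial_limit_at_right_real this] obtain h :: real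
    where "0 < h" "\<And>r. r \<in> R \<Longrightarrow> exp (h * card (S r)) * bern_exp p (S r) (\<lambda>\<omega>. m ^ N r \<omega>) < m"
    by blast
  with m that show ?thesis by (metis less_imp_le)
qed

lemma site_cluster_image:
  assumes f: "bij f" and nb: "\<And>a b. nb (f a) (f b) \<longleftrightarrow> nb a b"
  shows "site_cluster nb (f ` \<omega>) (f x) = f ` site_cluster nb \<omega> x"
proof
  have inj: "inj f" using f by (rule bij_is_inj)
  show "site_cluster nb (f ` \<omega>) (f x) \<subseteq> f ` site_cluster nb \<omega> x"
  proof
    fix y assume "y \<in> site_cluster nb (f ` \<omega>) (f x)"
    then show "y \<in> f ` site_cluster nb \<omega> x"
    proof (induction rule: site_cluster_induct)
      case self
      then show ?case using inj by (auto intro!: site_cluster_self simp: inj_image_mem_iff)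
    next
      case (step y z)
      then show ?case using nb by (auto intro: site_cluster_step)
    qed
  qed
  show "f ` site_cluster nb \<omega> x \<subseteq> site_cluster nb (f ` \<omega>) (f x)"
  proof
    fix y assume "y \<in> f ` site_cluster nb \<omega> x"
    then obtain z where z: "z \<in> site_cluster nb \<omega> x" "y = f z" by auto
    from z(1) have "f z \<in> site_cluster nb (f ` \<omega>) (f x)"
      by (induction rule: site_cluster_induct) (auto simp: nb intro: site_cluster_self site_cluster_step)
    then show "y \<in> site_cluster nb (f ` \<omega>) (f x)" using z by simp
  qed
qed

lemma exits_image:
  assumes f: "bij f" and nb: "\<And>a b. nb (f a) (f b) \<longleftrightarrow> nb a b"
  shows "exits nb (f ` S) (f ` \<omega>) (f x) = f ` exits nb S \<omega> x"
proof -
  have inj: "inj f" and surj: "surj f" using f by (auto simp: bij_def)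
  show ?thesis
  proof (intro set_eqI)
    fix y
    obtain y' where "y = f y'" using surj by auto
    then show "y \<in> exits nb (f ` S) (f ` \<omega>) (f x) \<longleftrightarrow> y \<in> f ` exits nb S \<omega> x"
      by (auto simp: exits_def site_cluster_image[of f nb, OF f nb] nb inj_image_mem_iff[OF inj])
  qed
qed

text \<open>Blocks are chosen at the finitely many representatives and carried to all of
  \<open>X\<close> by automorphisms, which preserve both block size and the law of the number of
  exits.\<close>

lemma exponential_cluster_decay:
  fixes X R :: "'v set" and p :: real
  assumes nbfin: "\<And>x. finite {y. nb x y}" and p: "0 \<le> p" "p \<le> 1" and "finite R"
    and trans: "\<And>x. x \<in> X \<Longrightarrow> \<exists>r\<in>R. \<exists>f. bij f \<and> f r = x \<and> (\<forall>a b. nb (f a) (f b) \<longleftrightarrow> nb a b)"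
    and lt1: "\<And>r. r \<in> R \<Longrightarrow> \<exists>S. finite S \<and> r \<in> S \<and> bern_exp p S (\<lambda>\<omega>. real (card (exits nb S \<omega> r))) < 1"
  obtains m h :: real where "1 < m" "0 < h"
    "\<And>\<Lambda> Y. finite \<Lambda> \<Longrightarrow> \<Lambda> \<subseteq> X \<Longrightarrow> finite Y \<Longrightarrow>
       bern_exp p \<Lambda> (\<lambda>\<omega>. exp (h * card (\<Union>y\<in>Y. site_cluster nb \<omega> y))) \<le> m ^ card Y"
proof -
  obtain S where S: "\<And>r. r \<in> R \<Longrightarrow> finite (S r) \<and> r \<in> S r \<and>
      bern_exp p (S r) (\<lambda>\<omega>. real (card (exits nb (S r) \<omega> r))) < 1"
    using lt1 by metis
  obtain m h :: real where mh: "1 < m" "0 < h"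
    "\<And>r. r \<in> R \<Longrightarrow> exp (h * card (S r)) * bern_exp p (S r) (\<lambda>\<omega>. m ^ card (exits nb (S r) \<omega> r)) \<le> m"
    using exists_growth_parameters[OF \<open>finite R\<close>, of S p "\<lambda>r \<omega>. card (exits nb (S r) \<omega> r)"] S by metis
  have "\<exists>A. finite A \<and> x \<in> A \<and> exp (h * card A) * bern_exp p A (\<lambda>\<omega>. m ^ card (exits nb A \<omega> x)) \<le> m"
    if x: "x \<in> X" for x
  proof -
    obtain r f where rf: "r \<in> R" "bij f" "f r = x" "\<And>a b. nb (f a) (f b) \<longleftrightarrow> nb a b"
      using trans[OF x] by blast
    have inj: "inj f" using rf(2) by (rule bij_is_inj)
    have "bern_exp p (f ` S r) (\<lambda>\<omega>. m ^ card (exits nb (f ` S r) \<omega> x))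
        = bern_exp p (S r) (\<lambda>\<omega>. m ^ card (exits nb (S r) \<omega> r))"
      using S[OF rf(1)] unfolding rf(3)[symmetric]
      by (subst bern_exp_image[OF inj]) (auto simp: exits_image[of f nb, OF rf(2,4)] card_image[OF inj_on_subset[OF inj]])
    moreover have "card (f ` S r) = card (S r)" using inj by (simp add: card_image inj_on_subset)
    ultimately show ?thesis using mh(3)[OF rf(1)] S[OF rf(1)] rf(3) by (intro exI[of _ "f ` S r"]) auto
  qed
  then obtain block where block: "\<And>x. x \<in> X \<Longrightarrow> finite (block x) \<and> x \<in> block x \<and>
      exp (h * card (block x)) * bern_exp p (block x) (\<lambda>\<omega>. m ^ card (exits nb (block x) \<omega> x)) \<le> m"
    by metis
  have "bern_exp p \<Lambda> (\<lambda>\<omega>. exp (h * card (\<Union>y\<in>Y. site_cluster nb \<omega> y))) \<le> m ^ card Y"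
    if "finite \<Lambda>" "\<Lambda> \<subseteq> X" "finite Y" for \<Lambda> Y
    using that mh block by (intro exp_cluster_bound[where X = X and block = block] nbfin p) auto
  with mh that show ?thesis by blast
qed

section \<open>Percolation on Cayley graphs\<close>

definition bernoulli_product :: "'v set \<Rightarrow> real \<Rightarrow> ('v \<Rightarrow> bool) measure" where
  "bernoulli_product X p = PiM X (\<lambda>_. measure_pmf (bernoulli_pmf p))"

lemma prob_space_bernoulli_product: "prob_space (bernoulli_product X p)"
  unfolding bernoulli_product_def by (intro prob_space_PiM measure_pmf.prob_space_axioms)

lemma measurable_coordinate [measurable (raw)]:
  "e \<in> X \<Longrightarrow> Measurable.pred (bernoulli_product X p) (\<lambda>\<omega>. \<omega> e)"
  using measurable_component_singleton[of e X "\<lambda>_. measure_pmf (bernoulli_pmf p)"]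
  unfolding bernoulli_product_def measurable_cong_sets[OF refl sets_measure_pmf_count_space] .

lemma bernoulli_product_cylinder:
  assumes "0 \<le> p" "p \<le> 1" "finite B" "B \<subseteq> X" "\<eta> \<subseteq> B"
  shows "measure (bernoulli_product X p) {\<omega> \<in> space (bernoulli_product X p). {e \<in> B. \<omega> e} = \<eta>}
    = p ^ card \<eta> * (1 - p) ^ card (B - \<eta>)"
proof -
  interpret product_prob_space "\<lambda>_. measure_pmf (bernoulli_pmf p)" X
    by (intro product_prob_spaceI measure_pmf.prob_space_axioms)
  have "{\<omega> \<in> space (bernoulli_product X p). {e \<in> B. \<omega> e} = \<eta>}
      = {\<omega> \<in> space (bernoulli_product X p). \<forall>e\<in>B. \<omega> e \<in> {e \<in> \<eta>}}"
    using assms(5) by auto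
  then have "emeasure (bernoulli_product X p) {\<omega> \<in> space (bernoulli_product X p). {e \<in> B. \<omega> e} = \<eta>}
      = (\<Prod>e\<in>B. emeasure (measure_pmf (bernoulli_pmf p)) {e \<in> \<eta>})"
    unfolding bernoulli_product_def using assms(3,4) emeasure_PiM_Collect[of B "\<lambda>e. {e \<in> \<eta>}"] by simp
  also have "\<dots> = (\<Prod>e\<in>B. ennreal (if e \<in> \<eta> then p else 1 - p))"
    using assms(1,2) by (intro prod.cong) (auto simp: emeasure_pmf_single)
  also have "\<dots> = ennreal (\<Prod>e\<in>B. if e \<in> \<eta> then p else 1 - p)"
    using assms(1,2) by (intro prod_ennreal) auto
  also have "(\<Prod>e\<in>B. if e \<in> \<eta> then p else 1 - p) = p ^ card \<eta> * (1 - p) ^ card (B - \<eta>)"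
    using assms(3,5) by (simp add: prod.If_cases Int_absorb1 Diff_eq[symmetric] Int_def[symmetric] flip: Collect_neg_eq)
  finally show ?thesis
    using assms(1,2) by (intro measure_eq_emeasure_eq_ennreal) auto
qed

lemma
  assumes p: "0 \<le> p" "p \<le> 1" and B: "finite B" "B \<subseteq> X"
  shows integrable_bernoulli_cylinder: "integrable (bernoulli_product X p) (\<lambda>\<omega>. F {e \<in> B. \<omega> e})"
    and integral_bernoulli_cylinder: "(\<integral>\<omega>. F {e \<in> B. \<omega> e} \<partial>bernoulli_product X p) = bern_exp p B F"
proof -
  let ?M = "bernoulli_product X p"
  interpret prob_space ?M by (rule prob_space_bernoulli_product)
  let ?A = "\<lambda>\<eta>. {\<omega> \<in> space ?M. {e \<in> B. \<omega> e} = \<eta>}"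
  have A: "?A \<eta> \<in> sets ?M" if "\<eta> \<subseteq> B" for \<eta>
  proof -
    have "?A \<eta> = {\<omega> \<in> space ?M. \<forall>e\<in>B. \<omega> e = (e \<in> \<eta>)}" using that by auto
    moreover have "Measurable.pred ?M (\<lambda>\<omega>. \<forall>e\<in>B. \<omega> e = (e \<in> \<eta>))"
      using B by (intro pred_intros_finite pred_intros_logic measurable_coordinate) auto
    then have "{\<omega> \<in> space ?M. \<forall>e\<in>B. \<omega> e = (e \<in> \<eta>)} \<in> sets ?M" by (simp add: pred_def)
    ultimately show ?thesis by simp
  qed
  have eq: "F {e \<in> B. \<omega> e} = (\<Sum>\<eta>\<in>Pow B. F \<eta> * indicator (?A \<eta>) \<omega>)" if "\<omega> \<in> space ?M" for \<omega>
  proof -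
    have "(\<Sum>\<eta>\<in>Pow B. F \<eta> * indicator (?A \<eta>) \<omega>) = (\<Sum>\<eta>\<in>Pow B. if {e \<in> B. \<omega> e} = \<eta> then F \<eta> else 0)"
      using that by (intro sum.cong) auto
    then show ?thesis using B(1) by (simp add: sum.delta')
  qed
  have int: "integrable ?M (\<lambda>\<omega>. \<Sum>\<eta>\<in>Pow B. F \<eta> * indicator (?A \<eta>) \<omega>)"
    using A by (intro Bochner_Integration.integrable_sum integrable_mult_right integrable_real_indicator) (auto simp: less_top[symmetric])
  show "integrable ?M (\<lambda>\<omega>. F {e \<in> B. \<omega> e})"
    using int by (rule Bochner_Integration.integrable_cong[THEN iffD1, rotated -1]) (simp_all add: eq)
  have "(\<integral>\<omega>. F {e \<in> B. \<omega> e} \<partial>?M) = (\<integral>\<omega>. (\<Sum>\<eta>\<in>Pow B. F \<eta> * indicator (?A \<eta>) \<omega>) \<partial>?M)"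
    by (rule Bochner_Integration.integral_cong) (simp_all add: eq)
  also have "\<dots> = (\<Sum>\<eta>\<in>Pow B. F \<eta> * measure ?M (?A \<eta>))"
    using A by (subst Bochner_Integration.integral_sum) (auto simp: less_top[symmetric] intro!: sum.cong)
  also have "\<dots> = bern_exp p B F"
    unfolding bern_exp_def using bernoulli_product_cylinder[OF p B] by (intro sum.cong) auto
  finally show "(\<integral>\<omega>. F {e \<in> B. \<omega> e} \<partial>?M) = bern_exp p B F" .
qed

text \<open>In the bond case every edge is adjacent to itself, which changes neither clusters nor exits.\<close>

definition elem_nb :: "'g::group_add set \<Rightarrow> perc_kind \<Rightarrow> 'g set \<Rightarrow> 'g set \<Rightarrow> bool" where
  "elem_nb S t e e' = (case t of
      Site \<Rightarrow> \<exists>x y. e = {x} \<and> e' = {y} \<and> cayley_adj S x y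
    | Bond \<Rightarrow> e \<in> perc_index S Bond \<and> e' \<in> perc_index S Bond \<and> e \<inter> e' \<noteq> {})"

text \<open>Used in two roles: representatives of the elements under translation, and the elements
  containing the origin, through which its cluster must start.\<close>

definition elem_roots :: "'g::group_add set \<Rightarrow> perc_kind \<Rightarrow> 'g set set" where
  "elem_roots S t = (case t of Site \<Rightarrow> {{0}} | Bond \<Rightarrow> (\<lambda>s. {0, s}) ` S)"

locale cayley_percolation =
  fixes S :: "'g::group_add set" and t :: perc_kind
  assumes gen: "gen_set S"
begin

abbreviation "X \<equiv> perc_index S t"

lemma finite_S: "finite S" and neg_S: "s \<in> S \<Longrightarrow> - s \<in> S"
  using gen by (auto simp: gen_set_def)

lemma cayley_adj_sym: "cayley_adj S x y \<Longrightarrow> cayley_adj S y x"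
  unfolding cayley_adj_def using neg_S by (metis add.assoc add.right_neutral right_minus)

lemma cayley_adj_translate: "cayley_adj S (g + x) (g + y) \<longleftrightarrow> cayley_adj S x y"
  by (simp add: cayley_adj_def add.assoc)

lemma countable_group: "countable (UNIV :: 'g set)"
proof -
  have "UNIV \<subseteq> sum_list ` lists S" using gen by (fastforce simp: gen_set_def)
  moreover have "countable (lists S)" using finite_S by (intro countable_lists countable_finite)
  ultimately show ?thesis by (metis countable_image countable_subset)
qed

lemma countable_X: "countable X"
proof -
  have "X \<subseteq> (\<lambda>(x, y). {x, y}) ` (UNIV \<times> UNIV)"
    by (cases t) (auto simp: perc_index_def image_iff)
  moreover have "countable ((\<lambda>(x, y). {x, y}) ` (UNIV \<times> UNIV :: ('g \<times> 'g) set))"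
    using countable_group by (intro countable_image countable_SIGMA)
  ultimately show ?thesis by (rule countable_subset)
qed

text \<open>An exhaustion taken from an enumeration of \<open>X\<close>, without geometric shape;
  the arguments use only that boxes are finite and eventually contain each element.\<close>

definition box :: "nat \<Rightarrow> 'g set set" where
  "box n = {e \<in> X. to_nat_on X e \<le> n}"

lemma finite_box: "finite (box n)"
proof (rule finite_imageD)
  show "finite (to_nat_on X ` box n)" by (rule finite_subset[of _ "{..n}"]) (auto simp: box_def)
  show "inj_on (to_nat_on X) (box n)"
    using inj_on_to_nat_on[OF countable_X] by (rule inj_on_subset) (auto simp: box_def)
qed

lemma box_subset: "box n \<subseteq> X"
  by (auto simp: box_def)

lemma eventually_in_box: "e \<in> X \<Longrightarrow> \<forall>\<^sub>F n in sequentially. e \<in> box n"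
  unfolding box_def by (auto intro: eventually_ge_at_top)

abbreviation "nb \<equiv> elem_nb S t"
abbreviation "roots \<equiv> elem_roots S t"

lemma nb_in_X: "nb e e' \<Longrightarrow> e' \<in> X"
  by (cases t) (auto simp: elem_nb_def perc_index_def)

lemma finite_nb: "finite {e'. nb e e'}"
proof (cases t)
  case Site
  have "{e'. nb e e'} \<subseteq> (\<Union>x\<in>{x. e = {x}}. (\<lambda>s. {x + s}) ` S)"
    using Site by (auto simp: elem_nb_def cayley_adj_def image_iff)
  moreover have "finite {x. e = {x}}" by (rule finite_subset[of _ "{the_elem e}"]) auto
  ultimately show ?thesis using finite_S by (meson finite_UN finite_imageI finite_subset)
next
  case Bond
  show ?thesis
  proof (cases "e \<in> X")
    case True
    then have "finite e" using Bond by (auto simp: perc_index_def)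
    moreover have "{e'. nb e e'} \<subseteq> (\<Union>x\<in>e. (\<lambda>s. {x, x + s}) ` S)"
    proof
      fix e' assume "e' \<in> {e'. nb e e'}"
      then obtain u v z where uv: "e' = {u, v}" "cayley_adj S u v" "z \<in> e" "z \<in> e'"
        using Bond by (auto simp: elem_nb_def perc_index_def)
      then obtain w where "e' = {z, w}" "cayley_adj S z w" using cayley_adj_sym by blast
      then show "e' \<in> (\<Union>x\<in>e. (\<lambda>s. {x, x + s}) ` S)" using uv(3) by (auto simp: cayley_adj_def)
    qed
    ultimately show ?thesis using finite_S by (meson finite_UN finite_imageI finite_subset)
  next
    case False
    then show ?thesis using Bond by (simp add: elem_nb_def)
  qed
qed

abbreviation translate :: "'g \<Rightarrow> 'g set \<Rightarrow> 'g set" where "translate g \<equiv> image ((+) g)"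

lemma translate_inverse: "translate g (translate (- g) e) = e" "translate (- g) (translate g e) = e"
  by (auto simp: image_iff simp flip: add.assoc)

lemma bij_translate: "bij (translate g)"
  by (rule o_bij[of "translate (- g)"]) (auto simp: fun_eq_iff translate_inverse)

lemma translate_X: "translate g e \<in> X \<longleftrightarrow> e \<in> X"
proof -
  have *: "e \<in> X \<Longrightarrow> translate g e \<in> X" for e g
    using cayley_adj_translate by (cases t) (fastforce simp: perc_index_def)+
  show ?thesis using *[of e g] *[of "translate g e" "- g"] by (auto simp: translate_inverse)
qed

lemma nb_translate: "nb (translate g a) (translate g b) \<longleftrightarrow> nb a b"
proof (cases t)
  case Site
  have *: "nb a b \<Longrightarrow> nb (translate g a) (translate g b)" for a b g
    using Site cayley_adj_translate[of g] by (auto simp: elem_nb_def)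
  show ?thesis using *[of a b g] *[of "translate g a" "translate g b" "- g"] by (auto simp: translate_inverse)
next
  case Bond
  have "translate g a \<inter> translate g b = translate g (a \<inter> b)" by (auto simp: image_iff)
  then show ?thesis using Bond translate_X[of g a] translate_X[of g b] by (simp add: elem_nb_def)
qed

lemma finite_roots: "finite roots"
  using finite_S by (cases t) (auto simp: elem_roots_def)

lemma roots_subset: "roots \<subseteq> X"
  by (cases t) (auto simp: elem_roots_def perc_index_def cayley_adj_def, metis add.left_neutral)

lemma transitive:
  assumes "e \<in> X"
  shows "\<exists>r\<in>roots. \<exists>f. bij f \<and> f r = e \<and> (\<forall>a b. nb (f a) (f b) \<longleftrightarrow> nb a b)"
proof -
  obtain g r where "r \<in> roots" "translate g r = e"
  proof (cases t)
    case Site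
    then obtain x where "e = {x}" using assms by (auto simp: perc_index_def)
    then show thesis using that[of "{0}" x] Site by (simp add: elem_roots_def)
  next
    case Bond
    then obtain x s where "e = {x, x + s}" "s \<in> S" using assms by (auto simp: perc_index_def cayley_adj_def)
    then show thesis using that[of "{0, s}" x] Bond by (simp add: elem_roots_def)
  qed
  then show ?thesis using bij_translate nb_translate by blast
qed

section \<open>Clusters of vertices versus clusters of open elements\<close>

abbreviation "V \<equiv> perc_verts S t"
abbreviation "A \<equiv> perc_adj S t"
abbreviation "open_elems \<omega> \<equiv> {e \<in> X. \<omega> e}"

lemma A_sym: "A \<omega> x y \<Longrightarrow> A \<omega> y x"
  using cayley_adj_sym by (cases t) (auto simp: perc_adj_def insert_commute)

lemma A_cayley: "A \<omega> x y \<Longrightarrow> cayley_adj S x y"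
  by (cases t) (auto simp: perc_adj_def)

lemma A_in_V: "A \<omega> x y \<Longrightarrow> x \<in> V \<omega>" "A \<omega> x y \<Longrightarrow> y \<in> V \<omega>"
  using A_sym[of \<omega> x y] by (cases t; force simp: perc_adj_def perc_verts_def)+

lemma nbrs_V: "nbrs (V \<omega>) (A \<omega>) x = {y \<in> (+) x ` S. A \<omega> x y}"
  using A_cayley[of \<omega> x] A_in_V(2)[of \<omega> x] by (auto simp: nbrs_def cayley_adj_def image_iff)

lemma open_element_connected:
  assumes "e \<in> open_elems \<omega>" "u \<in> e" "v \<in> e"
  shows "v \<in> cluster (A \<omega>) u"
proof (cases t)
  case Site
  then show ?thesis using assms by (auto simp: perc_index_def cluster_def)
next
  case Bond
  then obtain x y where xy: "e = {x, y}" "cayley_adj S x y" using assms by (auto simp: perc_index_def)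
  then have "A \<omega> x y" using assms(1) Bond by (simp add: perc_adj_def)
  then show ?thesis using assms xy A_sym by (auto simp: cluster_def)
qed

lemma site_cluster_subset_cluster:
  assumes "e \<in> site_cluster nb (open_elems \<omega>) r" "x \<in> r"
  shows "e \<subseteq> cluster (A \<omega>) x"
  using assms(1)
proof (induction rule: site_cluster_induct)
  case self
  then show ?case using open_element_connected[of r \<omega> x] assms(2) by blast
next
  case (step e e')
  have eop: "e \<in> open_elems \<omega>" using step(1) site_cluster_subset by fast
  obtain u v where uv: "u \<in> e" "v \<in> e'" "v \<in> cluster (A \<omega>) u"
  proof (cases t)
    case Site
    then obtain u v where e: "e = {u}" "e' = {v}" "cayley_adj S u v" using step(2) by (auto simp: elem_nb_def)
    then have "A \<omega> u v" using Site eop step(3) by (simp add: perc_adj_def)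
    then show thesis using that[of u v] e by (auto simp: cluster_def)
  next
    case Bond
    then obtain u where "u \<in> e" "u \<in> e'" using step(2) by (auto simp: elem_nb_def)
    then show thesis using that[of u u] by (auto simp: cluster_def)
  qed
  show ?case
  proof
    fix w assume "w \<in> e'"
    then have "w \<in> cluster (A \<omega>) v" using open_element_connected[of e' \<omega> v w] uv(2) step(3) by blast
    moreover have "u \<in> cluster (A \<omega>) x" using step(4) uv(1) by blast
    ultimately show "w \<in> cluster (A \<omega>) x" using uv(3) by (auto simp: cluster_def)
  qed
qed

text \<open>Each vertex of the cluster lies in an open element reachable from a root. This lets
  element counts bound vertex counts, up to the factor 2 of \<open>card_element\<close>.\<close>

lemma cluster_covered:
  assumes "0 \<in> V \<omega>"
  shows "cluster (A \<omega>) 0 \<subseteq> \<Union>(\<Union>r\<in>roots. site_cluster nb (open_elems \<omega>) r)"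
proof
  fix y assume "y \<in> cluster (A \<omega>) 0"
  then have "(0, y) \<in> {(a, b). A \<omega> a b}\<^sup>*" by (simp add: cluster_def)
  then show "y \<in> \<Union>(\<Union>r\<in>roots. site_cluster nb (open_elems \<omega>) r)"
  proof (induction rule: rtrancl_induct)
    case base
    show ?case
    proof (cases t)
      case Site
      then have "{0} \<in> open_elems \<omega>" "{0} \<in> roots" using assms by (auto simp: perc_verts_def perc_index_def elem_roots_def)
      then show ?thesis using site_cluster_self[of "{0}" "open_elems \<omega>" nb] by blast
    next
      case Bond
      then obtain s where s: "s \<in> S" "\<omega> {0, s}"
        using assms by (auto simp: perc_verts_def perc_adj_def cayley_adj_def)
      then have "{0, s} \<in> roots" using Bond by (auto simp: elem_roots_def)
      moreover from this have "{0, s} \<in> open_elems \<omega>" using roots_subset s(2) by auto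
      ultimately show ?thesis using site_cluster_self[of "{0, s}" "open_elems \<omega>" nb] by blast
    qed
  next
    case (step v w)
    then obtain e r where e: "v \<in> e" "r \<in> roots" "e \<in> site_cluster nb (open_elems \<omega>) r" by blast
    have eX: "e \<in> X" using e(3) site_cluster_subset[of nb "open_elems \<omega>" r] by blast
    have A: "A \<omega> v w" using step by simp
    obtain e' where e': "w \<in> e'" "e' \<in> open_elems \<omega>" "nb e e'"
    proof (cases t)
      case Site
      then have "e = {v}" "{w} \<in> open_elems \<omega>" "cayley_adj S v w"
        using eX e(1) A by (auto simp: perc_index_def perc_adj_def)
      then show thesis using that[of "{w}"] Site by (auto simp: elem_nb_def)
    next
      case Bond
      then have "{v, w} \<in> open_elems \<omega>" using A by (auto simp: perc_index_def perc_adj_def)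
      then show thesis using that[of "{v, w}"] Bond e(1) eX by (auto simp: elem_nb_def)
    qed
    then show ?case using site_cluster_step[OF e(3) e'(3,2)] e(2) by blast
  qed
qed

lemma card_element: "e \<in> X \<Longrightarrow> finite e \<and> card e \<le> 2"
  by (cases t) (auto simp: perc_index_def card_insert_le_m1)

lemma eventually_in_box_cluster:
  assumes "e \<in> site_cluster nb (open_elems \<omega>) r"
  shows "\<forall>\<^sub>F n in sequentially. e \<in> site_cluster nb {e \<in> box n. \<omega> e} r"
  using assms
proof (induction rule: site_cluster_induct)
  case self
  then have "\<forall>\<^sub>F n in sequentially. r \<in> box n" by (intro eventually_in_box) auto
  then show ?case
  proof eventually_elim
    case (elim n)
    then show ?case using self by (intro site_cluster_self) auto
  qed
next
  case (step e e')
  have "\<forall>\<^sub>F n in sequentially. e' \<in> box n" using step(3) by (intro eventually_in_box) auto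
  then show ?case using step(4)
  proof eventually_elim
    case (elim n)
    then show ?case using step by (intro site_cluster_step[OF elim(2) step(2)]) auto
  qed
qed

lemma finite_site_cluster:
  assumes "\<not> has_infinite_cluster (V \<omega>) (A \<omega>)" "r \<in> X"
  shows "finite (site_cluster nb (open_elems \<omega>) r)"
proof (cases "r \<in> open_elems \<omega>")
  case True
  obtain x where x: "x \<in> r" "x \<in> V \<omega>"
  proof (cases t)
    case Site
    then show thesis using that True by (auto simp: perc_index_def perc_verts_def)
  next
    case Bond
    then obtain x y where "r = {x, y}" "A \<omega> x y" using True by (auto simp: perc_index_def perc_adj_def)
    then show thesis using that[of x] A_in_V by auto
  qed
  then have "finite (cluster (A \<omega>) x)" using assms(1) by (auto simp: has_infinite_cluster_def)
  moreover have "site_cluster nb (open_elems \<omega>) r \<subseteq> Pow (cluster (A \<omega>) x)" using site_cluster_subset_cluster x(1) by blast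
  ultimately show ?thesis by (meson finite_Pow_iff finite_subset)
next
  case False
  then have "site_cluster nb (open_elems \<omega>) r = {}" unfolding site_cluster_def by blast
  then show ?thesis by simp
qed

lemma perc_measure_eq_bernoulli_product: "perc_measure S t p = bernoulli_product X p"
  by (simp add: perc_measure_def bernoulli_product_def)

text \<open>If all blocks had expectation at least 1 at p, the probability at q of reaching the
  boundary of a box containing r would be at least 1 - exp (p - q). Finiteness of the cluster at q
  makes this probability tend to 0 by dominated convergence.\<close>

lemma subcritical_block:
  assumes pq: "0 \<le> p" "p < q" "q \<le> 1" and "r \<in> X"
    and AE: "AE \<omega> in bernoulli_product X q. \<not> has_infinite_cluster (V \<omega>) (A \<omega>)"
  shows "\<exists>B. finite B \<and> r \<in> B \<and> bern_exp p B (\<lambda>\<omega>. real (card (exits nb B \<omega> r))) < 1"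
proof (rule ccontr)
  assume "\<not> ?thesis"
  then have ge1: "1 \<le> bern_exp p B (\<lambda>\<omega>. real (card (exits nb B \<omega> r)))" if "finite B" "r \<in> B" for B
    using that by force
  interpret prob_space "bernoulli_product X q" by (rule prob_space_bernoulli_product)
  let ?I = "\<lambda>n \<omega>. of_bool (r \<in> outer nb (box n) {e \<in> box n. \<omega> e}) :: real"
  have q: "0 \<le> q" "q \<le> 1" using pq by auto
  have int: "integrable (bernoulli_product X q) (?I n)" for n
    using integrable_bernoulli_cylinder[OF q finite_box box_subset, of "\<lambda>\<eta>. of_bool (r \<in> outer nb (box n) \<eta>)"] .
  have "(\<lambda>n. \<integral>\<omega>. ?I n \<omega> \<partial>bernoulli_product X q) \<longlonglongrightarrow> (\<integral>\<omega>. 0 \<partial>bernoulli_product X q)"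
  proof (rule integral_dominated_convergence[where w = "\<lambda>_. 1"])
    show "AE \<omega> in bernoulli_product X q. (\<lambda>n. ?I n \<omega>) \<longlonglongrightarrow> 0"
      using AE
    proof eventually_elim
      case (elim \<omega>)
      \<comment> \<open>All neighbours of the finite cluster; once a box contains them, no site of
        the cluster has a neighbour outside the box.\<close>
      define Z where "Z = (\<Union>e\<in>site_cluster nb (open_elems \<omega>) r. {e'. nb e e'})"
      have "finite Z" unfolding Z_def using finite_site_cluster[OF elim \<open>r \<in> X\<close>] finite_nb by auto
      moreover have "\<forall>e\<in>Z. \<forall>\<^sub>F n in sequentially. e \<in> box n"
        using nb_in_X by (auto simp: Z_def intro!: eventually_in_box)
      ultimately have "\<forall>\<^sub>F n in sequentially. \<forall>e\<in>Z. e \<in> box n"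
        by (simp add: eventually_ball_finite_distrib)
      then have "\<forall>\<^sub>F n in sequentially. ?I n \<omega> = 0"
      proof eventually_elim
        case (elim n)
        have "r \<notin> outer nb (box n) {e \<in> box n. \<omega> e}"
        proof
          assume "r \<in> outer nb (box n) {e \<in> box n. \<omega> e}"
          then obtain y z where yz: "y \<in> site_cluster nb {e \<in> box n. \<omega> e} r" "nb y z" "z \<notin> box n"
            using outer_imp_site_cluster_boundary[of r nb] by blast
          have "{e \<in> box n. \<omega> e} \<subseteq> open_elems \<omega>" using box_subset by blast
          then have "y \<in> site_cluster nb (open_elems \<omega>) r" using yz(1) site_cluster_mono by fast
          then have "z \<in> Z" using yz(2) by (auto simp: Z_def)
          then show False using elim yz(3) by blast
        qed
        then show ?case by simp
      qed
      then show ?case by (rule tendsto_eventually)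
    qed
    show "?I n \<in> borel_measurable (bernoulli_product X q)" for n using int by (rule borel_measurable_integrable)
  qed auto
  then have lim: "(\<lambda>n. \<integral>\<omega>. ?I n \<omega> \<partial>bernoulli_product X q) \<longlonglongrightarrow> 0" by simp
  have "\<forall>\<^sub>F n in sequentially. 1 - exp (p - q) \<le> (\<integral>\<omega>. ?I n \<omega> \<partial>bernoulli_product X q)"
    using eventually_in_box[OF \<open>r \<in> X\<close>]
  proof eventually_elim
    case (elim n)
    have "(\<integral>\<omega>. ?I n \<omega> \<partial>bernoulli_product X q) = bern_exp q (box n) (\<lambda>\<eta>. of_bool (r \<in> outer nb (box n) \<eta>))"
      by (rule integral_bernoulli_cylinder[OF q finite_box box_subset])
    moreover have "1 - exp (p - q) \<le> bern_exp q (box n) (\<lambda>\<eta>. of_bool (r \<in> outer nb (box n) \<eta>))"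
      using pq by (intro outer_probability_ge finite_nb finite_box elim ge1) auto
    ultimately show ?case by simp
  qed
  with lim have "1 - exp (p - q) \<le> 0" by (rule tendsto_lowerbound) simp
  then show False using pq by simp
qed

text \<open>Makes the set whose \<open>Sup\<close> defines \<open>p_crit\<close> nonempty, so that
  below \<open>p_crit\<close> a larger member q can be extracted.\<close>

lemma no_infinite_cluster_0: "AE \<omega> in perc_measure S t 0. \<not> has_infinite_cluster (V \<omega>) (A \<omega>)"
proof -
  interpret product_prob_space "\<lambda>_. measure_pmf (bernoulli_pmf 0)" X
    by (intro product_prob_spaceI measure_pmf.prob_space_axioms)
  have "AE \<omega> in perc_measure S t 0. \<forall>e\<in>X. \<not> \<omega> e"
    unfolding perc_measure_def
  proof (subst AE_ball_countable[OF countable_X], intro ballI)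
    fix e assume "e \<in> X"
    then show "AE \<omega> in PiM X (\<lambda>_. measure_pmf (bernoulli_pmf 0)). \<not> \<omega> e"
      by (rule AE_component) (auto simp: AE_measure_pmf_iff set_pmf_iff)
  qed
  then show ?thesis
  proof eventually_elim
    case (elim \<omega>)
    have "V \<omega> = {}"
      using elim by (cases t) (auto simp: perc_verts_def perc_adj_def perc_index_def)
    then show ?case by (simp add: has_infinite_cluster_def)
  qed
qed

lemma p_crit_cases:
  assumes "p < p_crit S t"
  obtains q where "p < q" "q \<le> 1" "AE \<omega> in bernoulli_product X q. \<not> has_infinite_cluster (V \<omega>) (A \<omega>)"
proof -
  let ?Q = "{p \<in> {0..1}. AE \<omega> in perc_measure S t p. \<not> has_infinite_cluster (V \<omega>) (A \<omega>)}"
  have "0 \<in> ?Q" using no_infinite_cluster_0 by simp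
  then obtain q where "q \<in> ?Q" "p < q"
    using assms less_cSupE[of p ?Q] unfolding p_crit_def by blast
  with that show ?thesis unfolding perc_measure_eq_bernoulli_product by auto
qed

lemma subcritical_exponential_moment:
  assumes "0 \<le> p" "p < p_crit S t"
  obtains m h :: real where "1 < m" "0 < h" "p \<le> 1"
    "\<And>n. bern_exp p (box n) (\<lambda>\<omega>. exp (h * card (\<Union>r\<in>roots. site_cluster nb \<omega> r))) \<le> m ^ card roots"
proof -
  obtain q where q: "p < q" "q \<le> 1" "AE \<omega> in bernoulli_product X q. \<not> has_infinite_cluster (V \<omega>) (A \<omega>)"
    using p_crit_cases[OF assms(2)] by blast
  have block: "\<exists>B. finite B \<and> r \<in> B \<and> bern_exp p B (\<lambda>\<omega>. real (card (exits nb B \<omega> r))) < 1"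
    if "r \<in> roots" for r
    using that roots_subset by (intro subcritical_block[OF assms(1) q(1,2) _ q(3)]) auto
  have p1: "p \<le> 1" using q by simp
  show ?thesis
  proof (rule exponential_cluster_decay[OF finite_nb assms(1) p1 finite_roots transitive block])
    fix m h :: real
    assume mh: "1 < m" "0 < h"
      and bound: "\<And>\<Lambda> Y. finite \<Lambda> \<Longrightarrow> \<Lambda> \<subseteq> X \<Longrightarrow> finite Y \<Longrightarrow>
        bern_exp p \<Lambda> (\<lambda>\<omega>. exp (h * card (\<Union>y\<in>Y. site_cluster nb \<omega> y))) \<le> m ^ card Y"
    show thesis
      by (rule that[OF mh p1 bound[OF finite_box box_subset finite_roots]])
  qed
qed

end

section \<open>The integrated density of states\<close>

definition diag :: "lap_kind \<Rightarrow> nat \<Rightarrow> 'g set \<Rightarrow> ('g \<Rightarrow> 'g \<Rightarrow> bool) \<Rightarrow> 'g \<Rightarrow> real" where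
  "diag lt k V Adj x = (case lt of LapA \<Rightarrow> real k | LapD \<Rightarrow> 2 * real k - real (deg V Adj x)
      | LapN \<Rightarrow> real (deg V Adj x))"

lemma lap_eq_schroedinger: "lap lt k V Adj = schroedinger (diag lt k V Adj) Adj V"
  by (cases lt) (auto simp: fun_eq_iff lap_def schroedinger_def adj_op_def diag_def algebra_simps)

lemma lap_apply: "lap lt k V Adj u x =
    (if x \<in> V then diag lt k V Adj x * u x - (\<Sum>y\<in>nbrs V Adj x. u y) else 0)"
  by (simp add: lap_eq_schroedinger schroedinger_def)

lemma abs_diag_le: "deg V Adj x \<le> k \<Longrightarrow> \<bar>diag lt k V Adj x\<bar> \<le> 2 * real k"
  by (cases lt) (auto simp: diag_def)

lemma has_moments_spectral:
  assumes M: "real_distribution M" "emeasure M (- {-R..R}) = 0"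
    and mom: "\<And>n. (\<integral>x. x ^ n \<partial>M) = moment lt k V Adj v0 n"
  shows "spectral_measure lt k V Adj v0 = M"
proof (rule spectral_measure_eqI)
  interpret real_distribution M by fact
  have "integrable M (\<lambda>x. x ^ n)" for n
    by (rule integrable_power_bounded_support[OF _ _ M(2)]) (auto intro: finite_measure_axioms)
  then show "has_moments M (moment lt k V Adj v0)"
    unfolding has_moments_def using M mom finite_measure_axioms by auto
qed

context cayley_percolation
begin

section \<open>Spectral measures of the percolation Laplacian\<close>

lemma finite_nbrs_V: "finite (nbrs (V \<omega>) (A \<omega>) x)"
  using finite_S by (simp add: nbrs_V)

lemma card_nbrs_V_le: "card (nbrs (V \<omega>) (A \<omega>) x) \<le> card S"
proof -
  have "card (nbrs (V \<omega>) (A \<omega>) x) \<le> card ((+) x ` S)"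
    using finite_S by (intro card_mono) (auto simp: nbrs_V)
  also have "\<dots> \<le> card S" using finite_S by (rule card_image_le)
  finally show ?thesis .
qed

lemma diag_row_bound:
  "\<bar>diag lt (card S) (V \<omega>) (A \<omega>) x\<bar> + real (card (nbrs (V \<omega>) (A \<omega>) x)) \<le> 3 * real (card S)"
  using abs_diag_le[of "V \<omega>" "A \<omega>" x "card S" lt] card_nbrs_V_le[of \<omega> x] by (simp add: deg_def)

text \<open>Holds for each single configuration with the origin present, not just almost surely;
  this identifies the \<open>THE\<close> term before any measurability is discussed.\<close>

lemma spectral_distribution:
  fixes lt n \<omega>
  assumes "0 \<in> V \<omega>"
  defines "\<mu> \<equiv> spectral_measure lt (card S) (V \<omega>) (A \<omega>) 0"
  shows "real_distribution \<mu>" "emeasure \<mu> (- {- (3 * real (card S))..3 * real (card S)}) = 0"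
    "(\<integral>x. x ^ n \<partial>\<mu>) = moment lt (card S) (V \<omega>) (A \<omega>) 0 n"
proof -
  obtain M where M: "real_distribution M" "emeasure M (- {- (3 * real (card S))..3 * real (card S)}) = 0"
    "\<And>n. (\<integral>x. x ^ n \<partial>M) = (schroedinger (diag lt (card S) (V \<omega>) (A \<omega>)) (A \<omega>) (V \<omega>) ^^ n) (dirac_fun 0) 0"
    by (rule schroedinger_distribution[of "A \<omega>" "V \<omega>" 0 "diag lt (card S) (V \<omega>) (A \<omega>)" "3 * real (card S)"])
       (auto intro: A_sym finite_nbrs_V assms(1) diag_row_bound)
  have mom: "(\<integral>x. x ^ n \<partial>M) = moment lt (card S) (V \<omega>) (A \<omega>) 0 n" for n
    by (simp add: M(3) moment_def lap_eq_schroedinger)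
  have "\<mu> = M" unfolding \<mu>_def by (rule has_moments_spectral[OF M(1,2) mom])
  then show "real_distribution \<mu>" "emeasure \<mu> (- {- (3 * real (card S))..3 * real (card S)}) = 0"
    "(\<integral>x. x ^ n \<partial>\<mu>) = moment lt (card S) (V \<omega>) (A \<omega>) 0 n"
    using M mom by auto
qed

abbreviation "W \<omega> \<equiv> cluster (A \<omega>) 0"
text \<open>Adjacency is cut down to the cluster because \<open>finite_subgraph\<close> demands that
  adjacent points be vertices.\<close>

definition "cluster_adj \<omega> x y \<longleftrightarrow> A \<omega> x y \<and> x \<in> W \<omega> \<and> y \<in> W \<omega>"

lemma W_step: "x \<in> W \<omega> \<Longrightarrow> A \<omega> x y \<Longrightarrow> y \<in> W \<omega>"
  by (auto simp: cluster_def intro: rtrancl_into_rtrancl)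

lemma origin_in_W: "0 \<in> W \<omega>"
  by (simp add: cluster_def)

lemma W_subset_V: "0 \<in> V \<omega> \<Longrightarrow> W \<omega> \<subseteq> V \<omega>"
proof
  fix x assume "x \<in> W \<omega>" "0 \<in> V \<omega>"
  then have "(0, x) \<in> {(a, b). A \<omega> a b}\<^sup>*" by (simp add: cluster_def)
  then show "x \<in> V \<omega>" using \<open>0 \<in> V \<omega>\<close> A_in_V by (cases rule: rtrancl.cases) auto
qed

lemma graph_ball_subset_W: "graph_ball (V \<omega>) (A \<omega>) 0 n \<subseteq> W \<omega>"
  by (induction n) (auto simp: origin_in_W nbrs_def intro: W_step)

lemma finite_subgraph_W: "finite (W \<omega>) \<Longrightarrow> finite_subgraph S (W \<omega>) (cluster_adj \<omega>)"
  unfolding finite_subgraph_def cluster_adj_def using A_cayley A_sym by blast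

text \<open>No edge of the percolation graph leaves the cluster, so degrees computed in the cluster
  and in the full graph agree; for all three kinds the cluster Laplacian is the restriction of the
  full one.\<close>

lemma lap_cluster:
  assumes "0 \<in> V \<omega>"
  shows "lap lt k (W \<omega>) (cluster_adj \<omega>) = schroedinger (diag lt k (V \<omega>) (A \<omega>)) (A \<omega>) (W \<omega>)"
proof -
  have n: "nbrs (W \<omega>) (cluster_adj \<omega>) x = nbrs (W \<omega>) (A \<omega>) x" "nbrs (W \<omega>) (cluster_adj \<omega>) x = nbrs (V \<omega>) (A \<omega>) x"
    if "x \<in> W \<omega>" for x
    using that W_step[of x \<omega>] W_subset_V[OF assms] by (auto simp: nbrs_def cluster_adj_def)
  show ?thesis
  proof (intro ext)
    fix u x
    show "lap lt k (W \<omega>) (cluster_adj \<omega>) u x = schroedinger (diag lt k (V \<omega>) (A \<omega>)) (A \<omega>) (W \<omega>) u x"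
    proof (cases "x \<in> W \<omega>")
      case True
      have "diag lt k (W \<omega>) (cluster_adj \<omega>) x = diag lt k (V \<omega>) (A \<omega>) x"
        using n(2)[OF True] by (cases lt) (simp_all add: diag_def deg_def)
      then show ?thesis using True n(1)[OF True] by (simp add: lap_eq_schroedinger schroedinger_def)
    qed (simp add: lap_eq_schroedinger schroedinger_def)
  qed
qed

lemma finite_nonzero_eigenvalues_W:
  assumes "finite (W \<omega>)"
  shows "finite (nonzero_eigenvalues lt k (W \<omega>) (cluster_adj \<omega>))"
proof -
  interpret finite_symmetric_operator "W \<omega>" "schroedinger (diag lt k (W \<omega>) (cluster_adj \<omega>)) (cluster_adj \<omega>) (W \<omega>)"
    using A_sym by (intro finite_symmetric_operator_schroedinger assms) (auto simp: cluster_adj_def)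
  show ?thesis
    by (rule finite_subset[OF _ finite_eigenvalues])
       (auto simp: nonzero_eigenvalues_def is_eigenvalue_def lap_eq_schroedinger)
qed

text \<open>All balls around the origin stay in its cluster, so the moments, and hence the spectral
  measure, are those of the finite cluster operator. That measure is atomic on eigenvalues, and
  unequal values at E and 0 mean that it charges \<open>{0<..E}\<close>.\<close>

lemma eigenvalue_in_interval:
  assumes V0: "0 \<in> V \<omega>" and fin: "finite (W \<omega>)" and "0 \<le> E"
    and ne: "measure (spectral_measure lt (card S) (V \<omega>) (A \<omega>) 0) {..E}
      \<noteq> measure (spectral_measure lt (card S) (V \<omega>) (A \<omega>) 0) {..0}"
  shows "\<exists>a\<in>nonzero_eigenvalues lt (card S) (W \<omega>) (cluster_adj \<omega>). a \<le> E"
proof -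
  let ?D = "diag lt (card S) (V \<omega>) (A \<omega>)" and ?R = "3 * real (card S)"
  have bd: "\<bar>?D x\<bar> + real (card (nbrs (W \<omega>) (A \<omega>) x)) \<le> ?R" for x
  proof -
    have "card (nbrs (W \<omega>) (A \<omega>) x) \<le> card (nbrs (V \<omega>) (A \<omega>) x)"
      using W_subset_V[OF V0] by (intro card_mono finite_nbrs_V) (auto simp: nbrs_def)
    then show ?thesis using diag_row_bound[of lt \<omega> x] by linarith
  qed
  obtain M where M: "real_distribution M" "emeasure M (- {-?R..?R}) = 0"
    "\<And>n. (\<integral>x. x ^ n \<partial>M) = (schroedinger ?D (A \<omega>) (W \<omega>) ^^ n) (dirac_fun 0) 0"
    "\<And>B. B \<in> sets borel \<Longrightarrow> measure M B \<noteq> 0 \<Longrightarrow> \<exists>a\<in>B. \<exists>u. (\<forall>x. x \<notin> W \<omega> \<longrightarrow> u x = 0) \<and>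
        u \<noteq> (\<lambda>_. 0) \<and> schroedinger ?D (A \<omega>) (W \<omega>) u = (\<lambda>x. a * u x)"
  proof (rule schroedinger_finite_distribution[of "W \<omega>" "A \<omega>" 0 ?D ?R])
    fix M
    assume M: "real_distribution M" "emeasure M (- {-?R..?R}) = 0"
      "\<And>n. (\<integral>x. x ^ n \<partial>M) = (schroedinger ?D (A \<omega>) (W \<omega>) ^^ n) (dirac_fun 0) 0"
      "\<And>B. B \<in> sets borel \<Longrightarrow> measure M B \<noteq> 0 \<Longrightarrow> \<exists>a\<in>B. \<exists>u. (\<forall>x. x \<notin> W \<omega> \<longrightarrow> u x = 0) \<and>
        u \<noteq> (\<lambda>_. 0) \<and> schroedinger ?D (A \<omega>) (W \<omega>) u = (\<lambda>x. a * u x)"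
    show thesis by (rule that) (fact M)+
  qed (auto intro: fin A_sym origin_in_W bd)
  have "(\<integral>x. x ^ n \<partial>M) = moment lt (card S) (V \<omega>) (A \<omega>) 0 n" for n
    using schroedinger_local[OF A_sym finite_nbrs_V W_subset_V[OF V0] graph_ball_subset_W, where D = ?D]
    by (simp add: M(3) moment_def lap_eq_schroedinger)
  then have sm: "spectral_measure lt (card S) (V \<omega>) (A \<omega>) 0 = M"
    by (rule has_moments_spectral[OF M(1,2)])
  interpret M: real_distribution M by fact
  have "{..E} = {..0} \<union> {0<..E}" using \<open>0 \<le> E\<close> by auto
  moreover have "measure M ({..0} \<union> {0<..E}) = measure M {..0} + measure M {0<..E}"
    by (rule M.finite_measure_Union) auto
  ultimately have "measure M {0<..E} \<noteq> 0" using ne unfolding sm by auto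
  then obtain a u where au: "a \<in> {0<..E}" "\<forall>x. x \<notin> W \<omega> \<longrightarrow> u x = 0" "u \<noteq> (\<lambda>_. 0)"
    "schroedinger ?D (A \<omega>) (W \<omega>) u = (\<lambda>x. a * u x)"
    using M(4)[of "{0<..E}"] by auto
  then have "a \<in> nonzero_eigenvalues lt (card S) (W \<omega>) (cluster_adj \<omega>)"
    unfolding nonzero_eigenvalues_def is_eigenvalue_def lap_cluster[OF V0] by auto
  with au(1) show ?thesis by auto
qed

section \<open>Measurability of the density of states\<close>

lemma measurable_A: "Measurable.pred (bernoulli_product X p) (\<lambda>\<omega>. A \<omega> x y)"
proof (cases t)
  case Site
  have "{x} \<in> X" for x using Site by (auto simp: perc_index_def)
  then show ?thesis
    using Site by (simp add: perc_adj_def measurable_coordinate)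
next
  case Bond
  show ?thesis
  proof (cases "cayley_adj S x y")
    case True
    then have "{x, y} \<in> X" using Bond by (auto simp: perc_index_def)
    from measurable_coordinate[OF this] show ?thesis using Bond True by (simp add: perc_adj_def)
  next
    case False
    then show ?thesis using Bond by (simp add: perc_adj_def)
  qed
qed

lemma measurable_V: "Measurable.pred (bernoulli_product X p) (\<lambda>\<omega>. x \<in> V \<omega>)"
proof (cases t)
  case Site
  then have "{x} \<in> X" by (auto simp: perc_index_def)
  from measurable_coordinate[OF this] show ?thesis using Site by (simp add: perc_verts_def)
next
  case Bond
  have "x \<in> V \<omega> \<longleftrightarrow> (\<exists>y\<in>(+) x ` S. A \<omega> x y)" for \<omega>
    using Bond A_cayley[of \<omega> x] by (fastforce simp: perc_verts_def cayley_adj_def)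
  then show ?thesis using finite_S measurable_A by (simp only:) (intro pred_intros_finite; simp)
qed

lemma measurable_lap_power:
  "(\<lambda>\<omega>. (lap lt k (V \<omega>) (A \<omega>) ^^ n) \<phi> x) \<in> borel_measurable (bernoulli_product X p)"
proof (induction n arbitrary: x)
  case (Suc n)
  let ?f = "\<lambda>\<omega>. (lap lt k (V \<omega>) (A \<omega>) ^^ n) \<phi>"
  note [measurable] = measurable_A measurable_V Suc
  have s: "(\<Sum>y\<in>nbrs (V \<omega>) (A \<omega>) x. g y) = (\<Sum>y\<in>(+) x ` S. if A \<omega> x y then g y else 0)"
    for \<omega> and g :: "'g \<Rightarrow> real"
    unfolding nbrs_V using finite_S by (intro sum.inter_filter) auto
  have d: "real (deg (V \<omega>) (A \<omega>) x) = (\<Sum>y\<in>(+) x ` S. if A \<omega> x y then 1 else 0)" for \<omega>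
    using s[of "\<lambda>_. 1"] by (simp add: deg_def)
  have [measurable]: "(\<lambda>\<omega>. diag lt k (V \<omega>) (A \<omega>) x) \<in> borel_measurable (bernoulli_product X p)"
    by (cases lt) (simp_all add: diag_def d)
  have step: "(lap lt k (V \<omega>) (A \<omega>) ^^ Suc n) \<phi> x = (if x \<in> V \<omega> then diag lt k (V \<omega>) (A \<omega>) x * ?f \<omega> x
      - (\<Sum>y\<in>(+) x ` S. if A \<omega> x y then ?f \<omega> y else 0) else 0)" for \<omega>
    unfolding funpow.simps comp_apply by (subst lap_apply) (simp only: s)
  have "(\<lambda>\<omega>. if x \<in> V \<omega> then diag lt k (V \<omega>) (A \<omega>) x * ?f \<omega> x
      - (\<Sum>y\<in>(+) x ` S. if A \<omega> x y then ?f \<omega> y else 0) else 0) \<in> borel_measurable (bernoulli_product X p)"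
    by measurable
  then show ?case by (simp only: step)
qed simp

definition "dos lt E \<omega> = (if 0 \<in> V \<omega>
    then measure (spectral_measure lt (card S) (V \<omega>) (A \<omega>) 0) {..E} else 0)"

lemma measurable_dos: "dos lt E \<in> borel_measurable (bernoulli_product X p)"
proof -
  let ?R = "3 * real (card S)"
  obtain c d where lim: "\<And>\<mu>. \<lbrakk>finite_measure \<mu>; sets \<mu> = sets borel; emeasure \<mu> (- {-?R..?R}) = 0\<rbrakk> \<Longrightarrow>
       (\<lambda>j. \<Sum>i\<le>d j. c j i * (\<integral>x. x ^ i \<partial>\<mu>)) \<longlonglongrightarrow> measure \<mu> {..E}"
    by (rule cdf_limit_of_moments[of ?R E]) blast
  let ?u = "\<lambda>j \<omega>. if 0 \<in> V \<omega> then \<Sum>i\<le>d j. c j i * moment lt (card S) (V \<omega>) (A \<omega>) 0 i else 0"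
  show ?thesis
  proof (rule borel_measurable_LIMSEQ_real)
    show "(\<lambda>j. ?u j \<omega>) \<longlonglongrightarrow> dos lt E \<omega>" for \<omega>
    proof (cases "0 \<in> V \<omega>")
      case True
      note sd = spectral_distribution[OF True, of lt]
      interpret M: real_distribution "spectral_measure lt (card S) (V \<omega>) (A \<omega>) 0" by (rule sd(1))
      show ?thesis
        using lim[OF M.finite_measure_axioms _ sd(2)] True by (simp add: dos_def sd(3))
    qed (simp add: dos_def)
    note [measurable] = measurable_V measurable_lap_power
    show "?u j \<in> borel_measurable (bernoulli_product X p)" for j
      unfolding moment_def by measurable
  qed
qed

lemma dos_bounds: "0 \<le> dos lt E \<omega>" "dos lt E \<omega> \<le> 1"
proof -
  show "0 \<le> dos lt E \<omega>" by (simp add: dos_def)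
  show "dos lt E \<omega> \<le> 1"
  proof (cases "0 \<in> V \<omega>")
    case True
    interpret M: real_distribution "spectral_measure lt (card S) (V \<omega>) (A \<omega>) 0"
      by (rule spectral_distribution[OF True])
    show ?thesis by (simp add: dos_def)
  qed (simp add: dos_def)
qed

lemma dos_mono:
  assumes "E \<le> E'"
  shows "dos lt E \<omega> \<le> dos lt E' \<omega>"
proof (cases "0 \<in> V \<omega>")
  case True
  interpret M: real_distribution "spectral_measure lt (card S) (V \<omega>) (A \<omega>) 0"
    by (rule spectral_distribution[OF True])
  show ?thesis using assms True by (auto simp: dos_def intro!: M.finite_measure_mono)
qed (simp add: dos_def)

lemma integrable_dos: "integrable (bernoulli_product X p) (dos lt E)"
proof -
  interpret prob_space "bernoulli_product X p" by (rule prob_space_bernoulli_product)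
  show ?thesis
    by (rule integrable_const_bound[where B = 1]) (use dos_bounds in \<open>auto intro: measurable_dos\<close>)
qed

lemma IDS_eq: "IDS S t lt p E = (\<integral>\<omega>. dos lt E \<omega> \<partial>bernoulli_product X p)"
  unfolding IDS_def dos_def perc_measure_eq_bernoulli_product ..

text \<open>Stated for finite subsets F so that it also covers an infinite cluster. The factor 2 is
  the maximal number of vertices of an element.\<close>

lemma eventually_large_cluster:
  assumes "0 \<in> V \<omega>" "F \<subseteq> W \<omega>" "finite F"
  shows "\<forall>\<^sub>F n in sequentially. card F \<le> 2 * card (\<Union>r\<in>roots. site_cluster nb {e \<in> box n. \<omega> e} r)"
proof -
  let ?C = "\<lambda>n. \<Union>r\<in>roots. site_cluster nb {e \<in> box n. \<omega> e} r"
  have "\<forall>x\<in>F. \<forall>\<^sub>F n in sequentially. x \<in> \<Union>(?C n)"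
  proof
    fix x assume "x \<in> F"
    then obtain e r where e: "x \<in> e" "r \<in> roots" "e \<in> site_cluster nb (open_elems \<omega>) r"
      using cluster_covered[OF assms(1)] assms(2) by blast
    from eventually_in_box_cluster[OF e(3)] show "\<forall>\<^sub>F n in sequentially. x \<in> \<Union>(?C n)"
      by eventually_elim (use e in blast)
  qed
  then have "\<forall>\<^sub>F n in sequentially. \<forall>x\<in>F. x \<in> \<Union>(?C n)"
    using assms(3) by (simp only: eventually_ball_finite_distrib)
  then show ?thesis
  proof eventually_elim
    case (elim n)
    have CX: "?C n \<subseteq> box n" using site_cluster_subset by fastforce
    then have fC: "finite (?C n)" and el: "\<And>e. e \<in> ?C n \<Longrightarrow> finite e \<and> card e \<le> 2"
      using finite_box finite_subset box_subset card_element by blast+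
    have "card F \<le> card (\<Union>(?C n))" using elim fC el by (intro card_mono) auto
    also have "\<dots> \<le> (\<Sum>e\<in>?C n. card e)" by (rule card_Union_le_sum_card)
    also have "\<dots> \<le> (\<Sum>e\<in>?C n. 2)" using el by (intro sum_mono) auto
    finally show ?case by simp
  qed
qed

text \<open>A Chernoff bound passed to the limit of boxes by Fatou. Where the two values differ, the
  cluster has at least r vertices, so in large boxes at least r/2 elements are counted and exp (- (h
  * r / 2)) times the exponential is at least 1, which dominates the difference.\<close>

lemma IDS_difference_bound:
  fixes m h r :: real
  assumes p: "0 \<le> p" "p \<le> 1" and h: "0 < h" and "0 \<le> E"
    and moment: "\<And>n. bern_exp p (box n) (\<lambda>\<omega>. exp (h * card (\<Union>r\<in>roots. site_cluster nb \<omega> r))) \<le> K"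
    and large: "\<And>\<omega>. 0 \<in> V \<omega> \<Longrightarrow> finite (W \<omega>) \<Longrightarrow>
      \<exists>a\<in>nonzero_eigenvalues lt (card S) (W \<omega>) (cluster_adj \<omega>). a \<le> E \<Longrightarrow> r \<le> card (W \<omega>)"
  shows "IDS S t lt p E - IDS S t lt p 0 \<le> K * exp (- (h * r / 2))"
proof -
  let ?P = "bernoulli_product X p"
  let ?G = "\<lambda>\<omega>. dos lt E \<omega> - dos lt 0 \<omega>"
  define g where "g n \<omega> = exp (h * card (\<Union>r\<in>roots. site_cluster nb {e \<in> box n. \<omega> e} r))" for n and \<omega> :: "'g set \<Rightarrow> bool"
  define k where "k = exp (- (h * r / 2))"
  have k: "k > 0" by (simp add: k_def)
  have G: "0 \<le> ?G \<omega>" "?G \<omega> \<le> 1" for \<omega>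
    using dos_mono[OF \<open>0 \<le> E\<close>, of lt \<omega>] dos_bounds[of lt E \<omega>] dos_bounds[of lt 0 \<omega>] by linarith+
  have gint: "integrable ?P (g n)" and gval: "(\<integral>\<omega>. g n \<omega> \<partial>?P) \<le> K" for n
    unfolding g_def
    using integrable_bernoulli_cylinder[OF p finite_box[of n] box_subset[of n], of "\<lambda>\<omega>. exp (h * card (\<Union>r\<in>roots. site_cluster nb \<omega> r))"]
      integral_bernoulli_cylinder[OF p finite_box[of n] box_subset[of n], of "\<lambda>\<omega>. exp (h * card (\<Union>r\<in>roots. site_cluster nb \<omega> r))"]
      moment[of n] by auto
  have g0: "0 \<le> g n \<omega>" for n \<omega>
    by (simp add: g_def)
  have K: "K \<ge> 0"
  proof -
    have "0 \<le> (\<integral>\<omega>. g 0 \<omega> \<partial>?P)" by (rule Bochner_Integration.integral_nonneg) (simp add: g0)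
    then show ?thesis using gval[of 0] by linarith
  qed
  have pointwise: "ennreal (?G \<omega>) \<le> liminf (\<lambda>n. ennreal (k * g n \<omega>))" for \<omega>
  proof (cases "?G \<omega> = 0")
    case False
    then have V0: "0 \<in> V \<omega>" by (auto simp: dos_def split: if_splits)
    \<comment> \<open>An infinite cluster contains finite sets of any size, so it obeys the same
      pointwise bound and needs no separate null-set argument.\<close>
    have "\<exists>F. F \<subseteq> W \<omega> \<and> finite F \<and> r \<le> card F"
    proof (cases "finite (W \<omega>)")
      case True
      have "\<exists>a\<in>nonzero_eigenvalues lt (card S) (W \<omega>) (cluster_adj \<omega>). a \<le> E"
        using False V0 by (intro eigenvalue_in_interval V0 True \<open>0 \<le> E\<close>) (auto simp: dos_def)
      then show ?thesis using large[OF V0 True] True by (intro exI[of _ "W \<omega>"]) auto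
    next
      case False
      obtain N :: nat where "r \<le> N" using real_arch_simple by blast
      moreover obtain F where "F \<subseteq> W \<omega>" "finite F" "card F = N"
        using infinite_arbitrarily_large[OF False] by blast
      ultimately show ?thesis by auto
    qed
    then obtain F where F: "F \<subseteq> W \<omega>" "finite F" "r \<le> card F" by blast
    have "\<forall>\<^sub>F n in sequentially. ennreal (?G \<omega>) \<le> ennreal (k * g n \<omega>)"
      using eventually_large_cluster[OF V0 F(1,2)]
    proof eventually_elim
      case (elim n)
      let ?c = "card (\<Union>r\<in>roots. site_cluster nb {e \<in> box n. \<omega> e} r)"
      have "r / 2 \<le> real ?c" using elim F(3) by linarith
      then have "h * (r / 2) \<le> h * real ?c" using h by (intro mult_left_mono) auto
      then have "1 \<le> k * g n \<omega>" by (simp add: k_def g_def flip: exp_add)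
      then show ?case using G(2)[of \<omega>] by (intro ennreal_leI) linarith
    qed
    then show ?thesis by (intro Liminf_bounded)
  qed simp
  have "ennreal (\<integral>\<omega>. ?G \<omega> \<partial>?P) = (\<integral>\<^sup>+\<omega>. ennreal (?G \<omega>) \<partial>?P)"
    using integrable_dos G by (intro nn_integral_eq_integral[symmetric]) auto
  also have "\<dots> \<le> (\<integral>\<^sup>+\<omega>. liminf (\<lambda>n. ennreal (k * g n \<omega>)) \<partial>?P)"
    by (intro nn_integral_mono pointwise)
  also have "\<dots> \<le> liminf (\<lambda>n. \<integral>\<^sup>+\<omega>. ennreal (k * g n \<omega>) \<partial>?P)"
  proof (rule nn_integral_liminf)
    show "(\<lambda>\<omega>. ennreal (k * g n \<omega>)) \<in> borel_measurable ?P" for n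
      using borel_measurable_integrable[OF gint[of n]] by measurable
  qed
  also have "\<dots> \<le> liminf (\<lambda>n. ennreal (k * K))"
  proof (intro Liminf_mono always_eventually allI)
    fix n
    have "(\<integral>\<^sup>+\<omega>. ennreal (k * g n \<omega>) \<partial>?P) = ennreal (\<integral>\<omega>. k * g n \<omega> \<partial>?P)"
      using gint[of n] k by (intro nn_integral_eq_integral) (auto simp: g0)
    also have "\<dots> \<le> ennreal (k * K)"
      using gval[of n] k by (intro ennreal_leI) simp
    finally show "(\<integral>\<^sup>+\<omega>. ennreal (k * g n \<omega>) \<partial>?P) \<le> ennreal (k * K)" .
  qed
  also have "\<dots> = ennreal (k * K)" by (simp add: Liminf_const)
  finally have "(\<integral>\<omega>. ?G \<omega> \<partial>?P) \<le> k * K" using k K by (simp add: ennreal_le_iff)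
  then show ?thesis
    using integrable_dos by (simp add: IDS_eq k_def mult.commute)
qed

end

section \<open>Inversion of \<open>f\<close> and choice of the constants\<close>

lemma decreasing_inverse:
  fixes f :: "real \<Rightarrow> real"
  assumes cont: "continuous_on {1..} f" and dec: "\<forall>x\<in>{1..}. \<forall>y\<in>{1..}. x < y \<longrightarrow> f y < f x"
    and lim: "(f \<longlongrightarrow> 0) at_top" and E: "0 < E" "E < f c" and "1 \<le> c"
  shows "f (the_inv_into {1..} f E) = E" "c < the_inv_into {1..} f E"
proof -
  have inj: "inj_on f {1..}" using dec by (intro linorder_inj_onI') force
  have "\<forall>\<^sub>F x in at_top. f x < E" using lim E(1) by (rule order_tendstoD(2))
  then obtain s where s: "s \<ge> c" "f s < E"
    by (metis eventually_at_top_linorder linear order_refl)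
  have "\<exists>x\<ge>c. x \<le> s \<and> f x = E"
    using s E \<open>1 \<le> c\<close> by (intro IVT2' continuous_on_subset[OF cont]) auto
  then obtain x where x: "c \<le> x" "f x = E" by blast
  then have "the_inv_into {1..} f E = x" using inj \<open>1 \<le> c\<close> by (auto intro!: the_inv_into_f_eq)
  then show "f (the_inv_into {1..} f E) = E" "c < the_inv_into {1..} f E"
    using x E by (auto simp: less_le)
qed

theorem theorem3p3:
  fixes S :: "'g::group_add set" and f :: "real \<Rightarrow> real"
    and lt :: lap_kind and t :: perc_kind and p :: real
  assumes "gen_set S"
    and "amenable_group TYPE('g)"
    and "continuous_on {1..} f"
    and "\<forall>x\<in>{1..}. \<forall>y\<in>{1..}. x < y \<longrightarrow> f y < f x"
    and "\<forall>x\<in>{1..}. f x > 0"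
    and "(f \<longlongrightarrow> 0) at_top"
    and "\<forall>V Adj. finite_subgraph S V Adj \<longrightarrow> nonzero_eigenvalues lt (card S) V Adj \<noteq> {} \<longrightarrow>
           lowest_nonzero_eigenvalue lt (card S) V Adj \<ge> f (real (card V))"
    and "0 < p" and "p < p_crit S t"
  shows "\<exists>a>0. \<forall>\<^sub>F E in at_right 0.
           IDS S t lt p E - IDS S t lt p 0 \<le> exp (- a * the_inv_into {1..} f E)"
proof -
  interpret cayley_percolation S t by unfold_locales fact
  obtain m h :: real where mh: "1 < m" "0 < h" "p \<le> 1"
    "\<And>n. bern_exp p (box n) (\<lambda>\<omega>. exp (h * card (\<Union>r\<in>roots. site_cluster nb \<omega> r))) \<le> m ^ card roots"
    using subcritical_exponential_moment[of p] assms(8,9) by auto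
  define K where "K = m ^ card roots"
  have K: "K \<ge> 1" using mh(1) by (simp add: K_def one_le_power)
  \<comment> \<open>The 1 keeps \<open>c\<close> in the domain of \<open>f\<close>. The other term
    makes \<open>ln K < h * r / 4\<close> for r > c, so that K is absorbed and a rate of h/4 remains
    out of h/2.\<close>
  define c where "c = max 1 (4 * ln K / h)"
  have "IDS S t lt p E - IDS S t lt p 0 \<le> exp (- (h / 4) * the_inv_into {1..} f E)"
    if E: "0 < E" "E < f c" for E
  proof -
    define r where "r = the_inv_into {1..} f E"
    have r: "f r = E" "c < r"
      using decreasing_inverse[OF assms(3,4,6) E] by (auto simp: r_def c_def)
    have large: "r \<le> card (W \<omega>)"
      if fin: "finite (W \<omega>)" and a: "a \<in> nonzero_eigenvalues lt (card S) (W \<omega>) (cluster_adj \<omega>)" "a \<le> E" for \<omega> a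
    proof (rule ccontr)
      assume less: "\<not> r \<le> card (W \<omega>)"
      \<comment> \<open>\<open>f\<close> is known to decrease only from 1 on, so the cluster size
        must be at least 1 before it can be compared with r.\<close>
      have "card (W \<omega>) \<noteq> 0" using fin origin_in_W by auto
      then have "E < f (real (card (W \<omega>)))"
        using less assms(4) r(1) by force
      also have "\<dots> \<le> lowest_nonzero_eigenvalue lt (card S) (W \<omega>) (cluster_adj \<omega>)"
        using assms(7) finite_subgraph_W[OF fin] a(1) by blast
      also have "\<dots> \<le> a"
        unfolding lowest_nonzero_eigenvalue_def using finite_nonzero_eigenvalues_W[OF fin] a(1) by (rule Min_le)
      finally show False using a(2) by simp
    qed
    have "IDS S t lt p E - IDS S t lt p 0 \<le> K * exp (- (h * r / 2))"
      using mh E(1) assms(8) large by (intro IDS_difference_bound) (auto simp: K_def)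
    also have "\<dots> = exp (ln K) * exp (- (h * r / 2))" using K by simp
    also have "\<dots> = exp (ln K + - (h * r / 2))" by (rule exp_add[symmetric])
    also have "\<dots> \<le> exp (- (h / 4) * r)"
    proof -
      have "4 * ln K / h < r" using r(2) by (simp add: c_def)
      then have "ln K < h * r / 4" using mh(2) by (simp add: field_simps)
      then show ?thesis by (simp add: field_simps)
    qed
    finally show ?thesis by (simp add: r_def)
  qed
  moreover have "0 < f c" using assms(5) by (auto simp: c_def)
  ultimately have "\<forall>\<^sub>F E in at_right 0.
      IDS S t lt p E - IDS S t lt p 0 \<le> exp (- (h / 4) * the_inv_into {1..} f E)"
    unfolding eventually_at_right_field by blast
  then show ?thesis using mh(2) by (intro exI[of _ "h / 4"]) auto
qed

end
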